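(* Let $p$ be a prime and let $G$ be the fundamental group of an algebraically clean graph of free groups. Then $G$ has a finite index subgroup that is residually $p$-finite.
   Context: A graph of groups $\mathcal G$ with underlying graph $Y$ consists of vertex groups $G_v$ ($v\in V(Y)$), edge groups $G_e=G_{\bar e}$ ($e\in E(Y)$, $\bar e$ the reversed edge, $\tau(e)$ the terminal vertex of $e$), and injective homomorphisms $f_e:G_e\to G_{\tau(e)}$. An algebraically clean graph of free groups is a graph of groups whose underlying graph $Y$ is finite, whose vertex groups and edge groups are free groups of finite rank, and all of whose maps $f_e$ are injections onto free factors of $G_{\tau(e)}$. A group $G$ is residually $p$-finite if for every $g\in G\setminus\{1\}$ there is a homomorphism from $G$ onto a finite $p$-group in which the image of $g$ is nontrivial. *)

theory Defs
  imports "HOL-Algebra.Algebra" "HOL-Computational_Algebra.Primes"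
begin

definition eval_word :: "('a, 'm) monoid_scheme \<Rightarrow> ('a \<times> bool) list \<Rightarrow> 'a" where
  "eval_word G w = foldr (\<lambda>(x, b) acc. (if b then x else inv\<^bsub>G\<^esub> x) \<otimes>\<^bsub>G\<^esub> acc) w \<one>\<^bsub>G\<^esub>"

definition freely_reduced :: "('x \<times> bool) list \<Rightarrow> bool" where
  "freely_reduced w = successively (\<lambda>a c. \<not> (fst a = fst c \<and> snd a \<noteq> snd c)) w"

definition free_group_finite_rank :: "('a, 'm) monoid_scheme \<Rightarrow> bool" where
  "free_group_finite_rank G \<longleftrightarrow> group G \<and>
     (\<exists>B. finite B \<and> B \<subseteq> carrier G \<and> generate G B = carrier G \<and>
        (\<forall>w. w \<noteq> [] \<and> set (map fst w) \<subseteq> B \<and> freely_reduced w \<longrightarrow> eval_word G w \<noteq> \<one>\<^bsub>G\<^esub>))"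

definition free_factor :: "('a, 'm) monoid_scheme \<Rightarrow> 'a set \<Rightarrow> bool" where
  "free_factor G H \<longleftrightarrow> subgroup H G \<and>
     (\<exists>K. subgroup K G \<and> generate G (H \<union> K) = carrier G \<and>
        (\<forall>xs. xs \<noteq> [] \<and> (\<forall>(b, x) \<in> set xs. x \<in> (if b then H else K) \<and> x \<noteq> \<one>\<^bsub>G\<^esub>) \<and>
              successively (\<lambda>a c. fst a \<noteq> fst c) xs
              \<longrightarrow> foldr (\<lambda>(b, x) acc. x \<otimes>\<^bsub>G\<^esub> acc) xs \<one>\<^bsub>G\<^esub> \<noteq> \<one>\<^bsub>G\<^esub>))"

text \<open>Underlying graph (Serre): vertex set V, edge set E, fixed-point-free involution
  bar (e \<mapsto> e-bar), terminal vertex tau; origin of e is tau (bar e).\<close>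

fun graph_path :: "('e \<Rightarrow> 'e) \<Rightarrow> ('e \<Rightarrow> 'v) \<Rightarrow> 'v \<Rightarrow> 'e list \<Rightarrow> 'v \<Rightarrow> bool" where
  "graph_path bar tau u [] v \<longleftrightarrow> u = v"
| "graph_path bar tau u (e # es) v \<longleftrightarrow> tau (bar e) = u \<and> graph_path bar tau (tau e) es v"

definition graph_of_groups ::
  "'v set \<Rightarrow> 'e set \<Rightarrow> ('e \<Rightarrow> 'e) \<Rightarrow> ('e \<Rightarrow> 'v) \<Rightarrow> ('v \<Rightarrow> 'a monoid) \<Rightarrow> ('e \<Rightarrow> 'b monoid)
    \<Rightarrow> ('e \<Rightarrow> 'b \<Rightarrow> 'a) \<Rightarrow> bool" where
  "graph_of_groups V E bar tau Gv Ge f \<longleftrightarrow>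
     (\<forall>e\<in>E. bar e \<in> E \<and> bar e \<noteq> e \<and> bar (bar e) = e \<and> tau e \<in> V) \<and>
     (\<forall>u\<in>V. \<forall>v\<in>V. \<exists>es. set es \<subseteq> E \<and> graph_path bar tau u es v) \<and>
     (\<forall>v\<in>V. group (Gv v)) \<and>
     (\<forall>e\<in>E. group (Ge e) \<and> Ge (bar e) = Ge e) \<and>
     (\<forall>e\<in>E. f e \<in> hom (Ge e) (Gv (tau e)) \<and> inj_on (f e) (carrier (Ge e)))"

definition algebraically_clean ::
  "'v set \<Rightarrow> 'e set \<Rightarrow> ('e \<Rightarrow> 'e) \<Rightarrow> ('e \<Rightarrow> 'v) \<Rightarrow> ('v \<Rightarrow> 'a monoid) \<Rightarrow> ('e \<Rightarrow> 'b monoid)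
    \<Rightarrow> ('e \<Rightarrow> 'b \<Rightarrow> 'a) \<Rightarrow> bool" where
  "algebraically_clean V E bar tau Gv Ge f \<longleftrightarrow>
     graph_of_groups V E bar tau Gv Ge f \<and> finite V \<and> finite E \<and>
     (\<forall>v\<in>V. free_group_finite_rank (Gv v)) \<and>
     (\<forall>e\<in>E. free_group_finite_rank (Ge e)) \<and>
     (\<forall>e\<in>E. free_factor (Gv (tau e)) (f e ` carrier (Ge e)))"

type_synonym ('v, 'a, 'e) gog_letter = "((('v \<times> 'a) + 'e) \<times> bool)"

inductive rel_cong :: "('w list \<times> 'w list) set \<Rightarrow> 'w list \<Rightarrow> 'w list \<Rightarrow> bool" for R where
  base: "(u, v) \<in> R \<Longrightarrow> rel_cong R u v"
| refl: "rel_cong R u u"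
| sym: "rel_cong R u v \<Longrightarrow> rel_cong R v u"
| trans: "rel_cong R u v \<Longrightarrow> rel_cong R v w \<Longrightarrow> rel_cong R u w"
| ctxt: "rel_cong R u v \<Longrightarrow> rel_cong R (a @ u @ b) (a @ v @ b)"

definition gog_generators :: "'v set \<Rightarrow> 'e set \<Rightarrow> ('v \<Rightarrow> 'a monoid) \<Rightarrow> (('v \<times> 'a) + 'e) set" where
  "gog_generators V E Gv = {Inl (v, g) | v g. v \<in> V \<and> g \<in> carrier (Gv v)} \<union> Inr ` E"

definition gog_words :: "'v set \<Rightarrow> 'e set \<Rightarrow> ('v \<Rightarrow> 'a monoid) \<Rightarrow> ('v, 'a, 'e) gog_letter list set" where
  "gog_words V E Gv = {w. set (map fst w) \<subseteq> gog_generators V E Gv}"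

definition gog_relations ::
  "'v set \<Rightarrow> 'e set \<Rightarrow> ('e \<Rightarrow> 'e) \<Rightarrow> ('e \<Rightarrow> 'v) \<Rightarrow> ('v \<Rightarrow> 'a monoid) \<Rightarrow> ('e \<Rightarrow> 'b monoid)
    \<Rightarrow> ('e \<Rightarrow> 'b \<Rightarrow> 'a) \<Rightarrow> (('v, 'a, 'e) gog_letter list \<times> ('v, 'a, 'e) gog_letter list) set" where
  "gog_relations V E bar tau Gv Ge f =
     {([(x, True), (x, False)], []) | x. x \<in> gog_generators V E Gv} \<union>
     {([(x, False), (x, True)], []) | x. x \<in> gog_generators V E Gv} \<union>
     {([(Inl (v, g), True), (Inl (v, h), True)], [(Inl (v, g \<otimes>\<^bsub>Gv v\<^esub> h), True)]) | v g h.
        v \<in> V \<and> g \<in> carrier (Gv v) \<and> h \<in> carrier (Gv v)} \<union>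
     {([(Inl (v, \<one>\<^bsub>Gv v\<^esub>), True)], []) | v. v \<in> V} \<union>
     {([(Inr (bar e), True)], [(Inr e, False)]) | e. e \<in> E} \<union>
     {([(Inr e, True), (Inl (tau e, f e a), True), (Inr e, False)],
       [(Inl (tau (bar e), f (bar e) a), True)]) | e a. e \<in> E \<and> a \<in> carrier (Ge e)}"

definition path_group ::
  "'v set \<Rightarrow> 'e set \<Rightarrow> ('e \<Rightarrow> 'e) \<Rightarrow> ('e \<Rightarrow> 'v) \<Rightarrow> ('v \<Rightarrow> 'a monoid) \<Rightarrow> ('e \<Rightarrow> 'b monoid)
    \<Rightarrow> ('e \<Rightarrow> 'b \<Rightarrow> 'a) \<Rightarrow> ('v, 'a, 'e) gog_letter list set monoid" where
  "path_group V E bar tau Gv Ge f =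
     (let W = gog_words V E Gv; R = gog_relations V E bar tau Gv Ge f;
          cls = (\<lambda>w. {z \<in> W. rel_cong R w z})
      in \<lparr> carrier = cls ` W,
           monoid.mult = (\<lambda>S T. {z \<in> W. \<exists>x\<in>S. \<exists>y\<in>T. rel_cong R (x @ y) z}),
           one = cls [] \<rparr>)"

inductive path_word ::
  "'v set \<Rightarrow> 'e set \<Rightarrow> ('e \<Rightarrow> 'e) \<Rightarrow> ('e \<Rightarrow> 'v) \<Rightarrow> ('v \<Rightarrow> 'a monoid)
    \<Rightarrow> 'v \<Rightarrow> 'v \<Rightarrow> ('v, 'a, 'e) gog_letter list \<Rightarrow> bool"
  for V E bar tau Gv where
  start: "u \<in> V \<Longrightarrow> g \<in> carrier (Gv u) \<Longrightarrow> path_word V E bar tau Gv u u [(Inl (u, g), True)]"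
| step: "path_word V E bar tau Gv u v w \<Longrightarrow> e \<in> E \<Longrightarrow> tau (bar e) = v \<Longrightarrow> g \<in> carrier (Gv (tau e))
         \<Longrightarrow> path_word V E bar tau Gv u (tau e) (w @ [(Inr e, True), (Inl (tau e, g), True)])"

text \<open>The fundamental group pi_1(G, v0): the subgroup of the path group represented by
  path words that are loops at v0 (Serre, Trees, I.5.1).\<close>

definition fundamental_group ::
  "'v set \<Rightarrow> 'e set \<Rightarrow> ('e \<Rightarrow> 'e) \<Rightarrow> ('e \<Rightarrow> 'v) \<Rightarrow> ('v \<Rightarrow> 'a monoid) \<Rightarrow> ('e \<Rightarrow> 'b monoid)
    \<Rightarrow> ('e \<Rightarrow> 'b \<Rightarrow> 'a) \<Rightarrow> 'v \<Rightarrow> ('v, 'a, 'e) gog_letter list set monoid" where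
  "fundamental_group V E bar tau Gv Ge f v0 =
     (let P = path_group V E bar tau Gv Ge f;
          W = gog_words V E Gv; R = gog_relations V E bar tau Gv Ge f
      in P\<lparr> carrier := {{z \<in> W. rel_cong R w z} | w. path_word V E bar tau Gv v0 v0 w} \<rparr>)"

text \<open>Finite quotients are represented by groups with carrier in nat (every finite group
  is isomorphic to such a group).\<close>

definition residually_p_finite :: "nat \<Rightarrow> ('a, 'm) monoid_scheme \<Rightarrow> bool" where
  "residually_p_finite p G \<longleftrightarrow>
     (\<forall>g \<in> carrier G. g \<noteq> \<one>\<^bsub>G\<^esub> \<longrightarrow>
        (\<exists>(P :: nat monoid) \<phi> k. group P \<and> finite (carrier P) \<and> card (carrier P) = p ^ k \<and>
           \<phi> \<in> hom G P \<and> \<phi> ` carrier G = carrier P \<and> \<phi> g \<noteq> \<one>\<^bsub>P\<^esub>))"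

end

theory Submission
  imports Defs
begin

text \<open>For a finite p-group U let Omega U consist of two homomorphisms to U from each vertex group.
  Since the edge groups are free factors, every edge e induces a permutation of Omega U that carries
  the restriction to one side of e to the restriction to the other side. Hence the fundamental group acts on
  Omega U times U, a vertex group element g sending (rho, u) to (rho, rho(g) u). These permutations are
  natural in U. A loop acting trivially for U = Z/p therefore acts with p-power order for every finite
  p-group U, by induction over central extensions, so the subgroup H of all such loops has finite index
  and its image in each of the finite groups so obtained is a p-group.

  Free groups are residually p-finite and free factors are retracts, so for a suitable U the vertex
  elements of a given reduced path stay outside the edge groups. Finally, adjoining the mod p chains on the
  edges of the coset graph repeatedly (semidirect products with elementary abelian p-groups) gives larger
  finite groups, still with p-torsion over the previous one, in which longer and longer reduced
  paths remain nontrivial, since the first edge of a vanishing chain must be cancelled by a later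
  edge and thus bounds a shorter relation.\<close>

section \<open>Finite p-groups\<close>

text \<open>The obstacle is uniformity. A separating p-group \<open>U\<close> depends on the element
  to be separated, whereas the finite index subgroup has to be fixed beforehand. So the subgroup is
  cut out by Z/p alone, and naturality in \<open>U\<close> must lift triviality over Z/p to every
  finite p-group. The factor \<open>U\<close> in Omega U times U turns the values rho(g) into
  permutations: vertex elements leave the Omega coordinate alone, only edges move it, and the order
  of a permutation can be bounded one coordinate at a time. In the permutation group itself a
  reduced path may still act trivially. The chain extensions repair this at the cost of a kernel
  with p-torsion only. The permutation group need not be a p-group, because only the image of the
  subgroup has to be one. For \<open>U\<close> of order p^k and a reduced path with n edges,
  elements of the subgroup acquire exponent p^(2k+n) in the resulting finite group: p^k until Omega
  no longer moves, p^k for the left multiplications on \<open>U\<close> that remain, p^n for the n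
  chain extensions.\<close>

lemma finite_group_iso_nat:
  assumes "group G" "finite (carrier G)"
  obtains N :: "nat monoid" and h where "group N" "finite (carrier N)" "h \<in> iso G N"
proof -
  interpret G: group G by fact
  obtain h where h: "bij_betw h (carrier G) {0..<card (carrier G)}"
    using ex_bij_betw_finite_nat[OF assms(2)] by blast
  \<comment> \<open>Transport of structure keeps all finite groups of the proof in the one type
    \<open>nat monoid\<close>, over which existential statements and inductions can range.\<close>
  define N :: "nat monoid" where
    "N = \<lparr>carrier = h ` carrier G,
          monoid.mult = (\<lambda>x y. h (inv_into (carrier G) h x \<otimes>\<^bsub>G\<^esub> inv_into (carrier G) h y)),
          one = h \<one>\<^bsub>G\<^esub>\<rparr>"
  have inj: "inj_on h (carrier G)"
    using h by (rule bij_betw_imp_inj_on)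
  have iso: "h \<in> iso G N"
    by (auto simp: iso_def hom_def N_def bij_betw_def inj)
  have "group (N\<lparr>one := h \<one>\<^bsub>G\<^esub>\<rparr>)"
    by (rule G.iso_imp_img_group[OF iso])
  then have "group N"
    by (simp add: N_def)
  moreover have "finite (carrier N)"
    using assms(2) by (simp add: N_def)
  ultimately show thesis
    using iso that by blast
qed

text \<open>Cauchy's theorem, as Sylow's theorem with exponent one: a prime \<open>q\<close> other
  than \<open>p\<close> dividing the order would give a subgroup of order \<open>q\<close>, and a
  nontrivial element of it would have order dividing both \<open>q\<close> and a power of
  \<open>p\<close>.\<close>

lemma p_torsion_imp_p_group:
  assumes "Factorial_Ring.prime p" "group G" "finite (carrier G)"
    and tors: "\<And>x. x \<in> carrier G \<Longrightarrow> \<exists>k. x [^]\<^bsub>G\<^esub> (p ^ k :: nat) = \<one>\<^bsub>G\<^esub>"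
  shows "\<exists>k. card (carrier G) = p ^ k"
proof -
  interpret G: group G by fact
  have pos: "card (carrier G) \<noteq> 0"
    using assms(3) by (simp add: card_eq_0_iff G.carrier_not_empty)
  obtain j m where m: "card (carrier G) = p ^ j * m" and ndvd: "\<not> p dvd m"
    using multiplicity_decompose'[of "card (carrier G)" p] pos assms(1) by (metis not_prime_unit)
  have "m = 1"
  proof (rule ccontr)
    assume "m \<noteq> 1"
    then obtain q where q: "Factorial_Ring.prime q" "q dvd m"
      using prime_factor_nat by blast
    have "q dvd order G"
      unfolding order_def m using q(2) by (rule dvd_mult)
    then obtain d where "order G = q ^ 1 * d"
      by auto
    then obtain S where S: "subgroup S G" "card S = q ^ 1"
      using sylow_thm[OF q(1) assms(2) _ assms(3)] by blast
    have "\<exists>x\<in>S. x \<noteq> \<one>\<^bsub>G\<^esub>"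
    proof (rule ccontr)
      assume "\<not> ?thesis"
      then have "S \<subseteq> {\<one>\<^bsub>G\<^esub>}" by blast
      then have "card S \<le> 1"
        by (metis card.empty card_mono finite.emptyI finite_insert is_singletonI is_singleton_altdef)
      then show False using S(2) prime_gt_1_nat[OF q(1)] by simp
    qed
    then obtain x where x: "x \<in> S" "x \<noteq> \<one>\<^bsub>G\<^esub>" by blast
    have xG: "x \<in> carrier G" using S(1) x(1) subgroup.mem_carrier by metis
    interpret S: group "G\<lparr>carrier := S\<rparr>"
      by (rule subgroup.subgroup_is_group[OF S(1) assms(2)])
    have "x [^]\<^bsub>G\<^esub> q = \<one>\<^bsub>G\<^esub>"
      using S.pow_order_eq_1[of x] x(1) S(2) by (simp add: order_def nat_pow_def)
    then have "G.ord x dvd q" using xG by (simp add: G.pow_eq_id)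
    moreover obtain k where "x [^]\<^bsub>G\<^esub> (p ^ k) = \<one>\<^bsub>G\<^esub>" using tors[OF xG] by blast
    then have "G.ord x dvd p ^ k" using xG by (simp add: G.pow_eq_id)
    moreover have "G.ord x \<noteq> 1" using x(2) xG G.ord_eq_1 by blast
    ultimately have "q dvd p ^ k"
      using q(1) by (metis prime_nat_iff)
    then have "q = p"
      using q(1) assms(1) by (metis prime_dvd_power primes_dvd_imp_eq)
    then show False using q(2) ndvd by simp
  qed
  then show ?thesis using m by auto
qed

text \<open>Class equation modulo \<open>p\<close>: orbits under conjugation have p-power size and
  the orbit of the identity is a singleton. Were it the only singleton, the order of the group would
  be 1 modulo \<open>p\<close>.\<close>

lemma p_group_center_nontrivial:
  assumes "Factorial_Ring.prime p" "group G" "finite (carrier G)" "card (carrier G) = p ^ Suc k"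
  obtains z where "z \<in> carrier G" "z \<noteq> \<one>\<^bsub>G\<^esub>" "\<And>x. x \<in> carrier G \<Longrightarrow> x \<otimes>\<^bsub>G\<^esub> z = z \<otimes>\<^bsub>G\<^esub> x"
proof -
  interpret G: group G by fact
  define \<phi> where "\<phi> = (\<lambda>g. \<lambda>h\<in>carrier G. g \<otimes>\<^bsub>G\<^esub> h \<otimes>\<^bsub>G\<^esub> inv\<^bsub>G\<^esub> g)"
  interpret act: group_action G "carrier G" \<phi>
    unfolding \<phi>_def by (rule G.action_by_conjugation)
  let ?O = "orbits G (carrier G) \<phi>"
  have p1: "p > 1" using assms(1) prime_gt_1_nat by blast
  have finO: "finite ?O"
    using assms(3) by (simp add: orbits_def)
  have finorb: "finite o1" if "o1 \<in> ?O" for o1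
    using that assms(3) act.orbits_coverture by (metis Union_upper finite_subset)
  have orb1: "orbit G \<phi> \<one>\<^bsub>G\<^esub> = {\<one>\<^bsub>G\<^esub>}"
  proof -
    have "\<phi> g \<one>\<^bsub>G\<^esub> = \<one>\<^bsub>G\<^esub>" if "g \<in> carrier G" for g
      using that by (simp add: \<phi>_def)
    then show ?thesis
      unfolding orbit_def using G.one_closed by (fastforce intro!: exI[of _ "\<one>\<^bsub>G\<^esub>"])
  qed
  have one_in: "{\<one>\<^bsub>G\<^esub>} \<in> ?O"
    using orb1 by (force simp: orbits_def)
  have sum: "(\<Sum>o1\<in>?O. card o1) = p ^ Suc k"
    using act.disjoint_sum[OF assms(3), of "\<lambda>_. 1::nat"] assms(4) by simp
  have "\<exists>z\<in>carrier G. z \<noteq> \<one>\<^bsub>G\<^esub> \<and> orbit G \<phi> z = {z}"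
  proof (rule ccontr)
    assume none: "\<not> ?thesis"
    have "p dvd card o1" if o1: "o1 \<in> ?O - {{\<one>\<^bsub>G\<^esub>}}" for o1
    proof -
      obtain x where x: "x \<in> carrier G" "o1 = orbit G \<phi> x" using o1 by (auto simp: orbits_def)
      have xin: "x \<in> o1" using x act.orbit_refl by blast
      have "card o1 dvd p ^ Suc k"
        using act.orbit_stabilizer_theorem[OF x(1)] x(2) assms(4) by (metis dvd_triv_left order_def)
      then obtain i where i: "card o1 = p ^ i"
        using assms(1) divides_primepow_nat by blast
      have "i \<noteq> 0"
      proof
        assume "i = 0"
        then have "card o1 = 1" using i by simp
        then have "o1 = {x}" using xin by (metis card_1_singletonE singletonD)
        moreover from this have "x \<noteq> \<one>\<^bsub>G\<^esub>" using o1 by auto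
        ultimately show False using none x by blast
      qed
      then show ?thesis using i by simp
    qed
    then have "p dvd (\<Sum>o1\<in>?O - {{\<one>\<^bsub>G\<^esub>}}. card o1)" by (rule dvd_sum)
    moreover have "(\<Sum>o1\<in>?O. card o1) = 1 + (\<Sum>o1\<in>?O - {{\<one>\<^bsub>G\<^esub>}}. card o1)"
      using sum.remove[OF finO one_in, of card] by simp
    ultimately have "p dvd 1"
      using sum by (metis dvd_add_left_iff dvd_triv_left power_Suc)
    then show False using p1 by simp
  qed
  then obtain z where z: "z \<in> carrier G" "z \<noteq> \<one>\<^bsub>G\<^esub>" "orbit G \<phi> z = {z}" by blast
  have "x \<otimes>\<^bsub>G\<^esub> z = z \<otimes>\<^bsub>G\<^esub> x" if x: "x \<in> carrier G" for x
  proof -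
    have "x \<otimes>\<^bsub>G\<^esub> z \<otimes>\<^bsub>G\<^esub> inv\<^bsub>G\<^esub> x \<in> orbit G \<phi> z"
      using x z(1) by (force simp: orbit_def \<phi>_def)
    then have "x \<otimes>\<^bsub>G\<^esub> z \<otimes>\<^bsub>G\<^esub> inv\<^bsub>G\<^esub> x = z" using z(3) by simp
    then show ?thesis using x z(1)
      by (metis G.inv_solve_right' G.m_closed)
  qed
  then show thesis using z that by blast
qed

text \<open>The descent step for inductions over p-groups. The central subgroup is given by an
  explicit embedding \<open>c\<close> of the integers modulo \<open>p\<close>, so that differences
  of homomorphisms can be read in Z/p.\<close>

lemma p_group_central_extension:
  fixes U :: "nat monoid"
  assumes p: "Factorial_Ring.prime p" and "group U" "finite (carrier U)" "card (carrier U) = p ^ Suc k"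
  obtains c :: "int \<Rightarrow> nat" and N :: "nat monoid" and q
  where "c \<in> hom (integer_mod_group p) U" "inj_on c (carrier (integer_mod_group p))"
    "\<And>i x. i \<in> carrier (integer_mod_group p) \<Longrightarrow> x \<in> carrier U \<Longrightarrow> x \<otimes>\<^bsub>U\<^esub> c i = c i \<otimes>\<^bsub>U\<^esub> x"
    "group N" "finite (carrier N)" "card (carrier N) = p ^ k" "q \<in> hom U N"
    "\<And>x. x \<in> carrier U \<Longrightarrow> q x = \<one>\<^bsub>N\<^esub> \<Longrightarrow> x \<in> c ` carrier (integer_mod_group p)"
proof -
  interpret U: group U by fact
  have p1: "p > 1" using p prime_gt_1_nat by blast
  obtain y where y: "y \<in> carrier U" "y \<noteq> \<one>\<^bsub>U\<^esub>" and yc: "\<And>x. x \<in> carrier U \<Longrightarrow> x \<otimes>\<^bsub>U\<^esub> y = y \<otimes>\<^bsub>U\<^esub> x"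
    using p_group_center_nontrivial[OF assms] by blast
  have "U.ord y dvd p ^ Suc k"
    using U.ord_dvd_group_order[OF y(1)] assms(4) by (simp add: order_def)
  then obtain i where i: "U.ord y = p ^ i" using p divides_primepow_nat by blast
  have "i \<noteq> 0" using i y U.ord_eq_1 by (metis power_0)
  then obtain j where j: "i = Suc j" using not0_implies_Suc by blast
  \<comment> \<open>\<open>y\<close> has order \<open>p ^ Suc j\<close>, so this power has order
    exactly \<open>p\<close>.\<close>
  define z where "z = y [^]\<^bsub>U\<^esub> (p ^ j)"
  have z: "z \<in> carrier U" using y by (simp add: z_def)
  have zpow: "z [^]\<^bsub>U\<^esub> n = y [^]\<^bsub>U\<^esub> (p ^ j * n)" for n :: nat
    using y by (simp add: z_def U.nat_pow_pow)
  have ordz: "z [^]\<^bsub>U\<^esub> n = \<one>\<^bsub>U\<^esub> \<longleftrightarrow> p dvd n" for n :: nat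
    unfolding zpow using y(1) i j p1 by (simp add: U.pow_eq_id mult.commute)
  have ycn: "x \<otimes>\<^bsub>U\<^esub> y [^]\<^bsub>U\<^esub> n = y [^]\<^bsub>U\<^esub> n \<otimes>\<^bsub>U\<^esub> x" if "x \<in> carrier U" for x and n :: nat
  proof (induction n)
    case (Suc n)
    then show ?case using that y(1) yc
      by (metis U.m_assoc U.nat_pow_Suc U.nat_pow_closed)
  qed (use that in simp)
  define c where "c = (\<lambda>i::int. z [^]\<^bsub>U\<^esub> (nat i))"
  have carr: "carrier (integer_mod_group p) = {0..<int p}"
    using p1 by (simp add: carrier_integer_mod_group)
  have zmod: "z [^]\<^bsub>U\<^esub> (n mod p) = z [^]\<^bsub>U\<^esub> n" for n :: nat
  proof -
    have "z [^]\<^bsub>U\<^esub> n = z [^]\<^bsub>U\<^esub> (p * (n div p)) \<otimes>\<^bsub>U\<^esub> z [^]\<^bsub>U\<^esub> (n mod p)"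
      using z by (simp add: U.nat_pow_mult)
    also have "z [^]\<^bsub>U\<^esub> (p * (n div p)) = \<one>\<^bsub>U\<^esub>" using ordz by simp
    finally show ?thesis using z by simp
  qed
  have chom: "c \<in> hom (integer_mod_group p) U"
  proof (rule homI)
    fix a b assume "a \<in> carrier (integer_mod_group p)" "b \<in> carrier (integer_mod_group p)"
    then have ab: "a \<ge> 0" "b \<ge> 0" by (auto simp: carr)
    have "nat ((a + b) mod int p) = (nat a + nat b) mod p"
      using ab by (simp add: nat_mod_distrib nat_add_distrib)
    then show "c (a \<otimes>\<^bsub>integer_mod_group p\<^esub> b) = c a \<otimes>\<^bsub>U\<^esub> c b"
      using z by (simp add: c_def zmod U.nat_pow_mult)
  qed (use z in \<open>simp add: c_def\<close>)
  interpret c: group_hom "integer_mod_group p" U c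
    using chom by (simp add: group_hom_def group_hom_axioms_def)
  have cinj: "inj_on c (carrier (integer_mod_group p))"
  proof (subst c.inj_on_one_iff, intro allI impI)
    fix a assume a: "a \<in> carrier (integer_mod_group p)" "c a = \<one>\<^bsub>U\<^esub>"
    then have "p dvd nat a" by (simp add: c_def ordz)
    moreover have "0 \<le> a" "nat a < p" using a(1) by (auto simp: carr)
    ultimately have "nat a = 0" by (meson dvd_imp_le linorder_not_le neq0_conv)
    then show "a = \<one>\<^bsub>integer_mod_group p\<^esub>" using \<open>0 \<le> a\<close> by simp
  qed
  define Z where "Z = c ` carrier (integer_mod_group p)"
  have Zcent: "x \<otimes>\<^bsub>U\<^esub> w = w \<otimes>\<^bsub>U\<^esub> x" if "x \<in> carrier U" "w \<in> Z" for x w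
    using that by (auto simp: Z_def c_def zpow ycn)
  have Zsub: "subgroup Z U"
    unfolding Z_def by (rule c.img_is_subgroup)
  have cardZ: "card Z = p"
    using cinj by (simp add: Z_def card_image carr)
  have "Z \<lhd> U"
  proof (rule U.normalI[OF Zsub], rule ballI)
    fix x assume "x \<in> carrier U"
    then show "Z #>\<^bsub>U\<^esub> x = x <#\<^bsub>U\<^esub> Z"
      unfolding r_coset_def l_coset_def using Zcent by auto
  qed
  then interpret Z: normal Z U .
  have "group (U Mod Z)" by (rule Z.factorgroup_is_group)
  moreover have finF: "finite (carrier (U Mod Z))"
    using assms(3) by (simp add: FactGroup_def RCOSETS_def)
  ultimately obtain N :: "nat monoid" and h where N: "group N" "finite (carrier N)" and h: "h \<in> iso (U Mod Z) N"
    using finite_group_iso_nat by blast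
  have "card (rcosets\<^bsub>U\<^esub> Z) * p = p ^ Suc k"
    using U.lagrange[OF Zsub] cardZ assms(4) by (simp add: order_def)
  then have "card (carrier (U Mod Z)) = p ^ k"
    using p1 by (simp add: FactGroup_def)
  then have cardN: "card (carrier N) = p ^ k"
    using bij_betw_same_card[of h "carrier (U Mod Z)" "carrier N"] h by (simp add: iso_def)
  define q where "q = h \<circ> (\<lambda>a. Z #>\<^bsub>U\<^esub> a)"
  have qhom: "q \<in> hom U N"
    unfolding q_def using h Z.r_coset_hom_Mod by (intro hom_compose) (auto simp: iso_def)
  have ker: "x \<in> c ` carrier (integer_mod_group p)" if x: "x \<in> carrier U" "q x = \<one>\<^bsub>N\<^esub>" for x
  proof -
    interpret h: group_hom "U Mod Z" N h
      using h N(1) Z.factorgroup_is_group by (simp add: group_hom_def group_hom_axioms_def iso_def)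
    have "h (Z #>\<^bsub>U\<^esub> x) = h Z" using x(2) h.hom_one by (simp add: q_def FactGroup_def)
    moreover have "Z #>\<^bsub>U\<^esub> x \<in> carrier (U Mod Z)" "Z \<in> carrier (U Mod Z)"
      using x(1) U.rcosetsI[OF Z.subset] Z.factorgroup_is_group monoid.one_closed[of "U Mod Z"] group.is_monoid
      by (auto simp: FactGroup_def)
    ultimately have "Z #>\<^bsub>U\<^esub> x = Z"
      using h by (auto simp: iso_def bij_betw_def dest: inj_onD)
    then have "x \<in> Z" using x(1) U.rcos_self[OF x(1) Zsub] by simp
    then show ?thesis by (simp add: Z_def)
  qed
  have comm: "x \<otimes>\<^bsub>U\<^esub> c i = c i \<otimes>\<^bsub>U\<^esub> x" if "i \<in> carrier (integer_mod_group p)" "x \<in> carrier U" for i x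
    using Zcent[of x "c i"] that by (simp add: Z_def)
  show thesis
    by (rule that[OF chom cinj comm N cardN qhom ker])
qed

section \<open>Universal properties of free groups and free products\<close>

lemma hom_eq_on_generate:
  assumes "group G" "group U" "h \<in> hom G U" "h' \<in> hom G U" "S \<subseteq> carrier G"
    and eq: "\<And>x. x \<in> S \<Longrightarrow> h x = h' x" and "x \<in> generate G S"
  shows "h x = h' x"
proof -
  interpret h: group_hom G U h
    using assms by (simp add: group_hom_def group_hom_axioms_def)
  interpret h': group_hom G U h'
    using assms by (simp add: group_hom_def group_hom_axioms_def)
  have sub: "generate G S \<subseteq> carrier G"
    by (rule group.generate_incl[OF assms(1) assms(5)])
  show ?thesis
    using assms(7)
  proof (induction rule: generate.induct)
    case (inv x)
    then show ?case using eq assms(5) by (metis h'.hom_inv h.hom_inv subsetD)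
  next
    case (eng x y)
    then show ?case using sub by (metis h'.hom_mult h.hom_mult subsetD)
  qed (use eq in auto)
qed

text \<open>\<open>T\<close> need not be a subgroup. It will be a set of values of normal forms,
  where only left multiplication by a generator or its inverse is easy to control.\<close>

lemma generate_subset_left_closed:
  assumes "group G" "S \<subseteq> carrier G" "T \<subseteq> carrier G" "\<one>\<^bsub>G\<^esub> \<in> T"
    and S: "\<And>s t. s \<in> S \<Longrightarrow> t \<in> T \<Longrightarrow> s \<otimes>\<^bsub>G\<^esub> t \<in> T"
    and invS: "\<And>s t. s \<in> S \<Longrightarrow> t \<in> T \<Longrightarrow> inv\<^bsub>G\<^esub> s \<otimes>\<^bsub>G\<^esub> t \<in> T"
  shows "generate G S \<subseteq> T"
proof -
  interpret G: group G by fact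
  have sub: "generate G S \<subseteq> carrier G"
    by (rule G.generate_incl[OF assms(2)])
  have "\<forall>t\<in>T. r \<otimes>\<^bsub>G\<^esub> t \<in> T" if "r \<in> generate G S" for r
    using that
  proof (induction rule: generate.induct)
    case one
    then show ?case using assms(3) by auto
  next
    case (eng x y)
    then show ?case using sub assms(3) by (metis G.m_assoc subsetD)
  qed (use S invS in auto)
  then show ?thesis
    using assms(4) sub G.r_one by (metis subsetD subsetI)
qed

text \<open>The homomorphism is found as a subgroup of \<open>G \<times>\<times> U\<close>: the
  pairs in \<open>S\<close> generate a subgroup that projects onto \<open>G\<close>, and it is the
  graph of a function because it meets the second factor trivially. Well-definedness thus becomes a
  condition over the identity alone.\<close>

lemma hom_of_graph:
  assumes "group G" "group U" "S \<subseteq> carrier G \<times> carrier U" "generate G (fst ` S) = carrier G"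
    and triv: "\<And>u. (\<one>\<^bsub>G\<^esub>, u) \<in> generate (G \<times>\<times> U) S \<Longrightarrow> u = \<one>\<^bsub>U\<^esub>"
  obtains h where "h \<in> hom G U" "\<And>x u. (x, u) \<in> S \<Longrightarrow> h x = u"
proof -
  interpret G: group G by fact
  interpret U: group U by fact
  interpret D: group "G \<times>\<times> U" by (rule DirProd_group[OF assms(1,2)])
  define R where "R = generate (G \<times>\<times> U) S"
  have Scarr: "S \<subseteq> carrier (G \<times>\<times> U)" using assms(3) by simp
  have Rsub: "R \<subseteq> carrier G \<times> carrier U"
    using D.generate_incl[OF Scarr] by (simp add: R_def)
  have R: "subgroup R (G \<times>\<times> U)"
    unfolding R_def by (rule D.generate_is_subgroup[OF Scarr])
  have SR: "S \<subseteq> R" unfolding R_def by (auto intro: generate.incl)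
  have multR: "(x \<otimes>\<^bsub>G\<^esub> y, u \<otimes>\<^bsub>U\<^esub> v) \<in> R" if "(x, u) \<in> R" "(y, v) \<in> R" for x u y v
    using subgroup.m_closed[OF R that] by simp
  have invR: "(inv\<^bsub>G\<^esub> x, inv\<^bsub>U\<^esub> u) \<in> R" if "(x, u) \<in> R" for x u
    using subgroup.m_inv_closed[OF R that] that Rsub
    by (metis assms(1,2) inv_DirProd mem_Sigma_iff subsetD)
  have uniq: "u = v" if "(x, u) \<in> R" "(x, v) \<in> R" for x u v
  proof -
    have c: "x \<in> carrier G" "u \<in> carrier U" "v \<in> carrier U" using that Rsub by auto
    have "(\<one>\<^bsub>G\<^esub>, u \<otimes>\<^bsub>U\<^esub> inv\<^bsub>U\<^esub> v) \<in> R"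
      using multR[OF that(1) invR[OF that(2)]] c by simp
    then have "u \<otimes>\<^bsub>U\<^esub> inv\<^bsub>U\<^esub> v = \<one>\<^bsub>U\<^esub>" using triv by (simp add: R_def)
    then show ?thesis using c by (metis U.inv_closed U.inv_equality U.inv_inv)
  qed
  have total: "\<exists>u. (x, u) \<in> R" if "x \<in> carrier G" for x
  proof -
    have "x \<in> generate G (fst ` S)" using that assms(4) by simp
    then show ?thesis
    proof (induction rule: generate.induct)
      case one
      then show ?case using subgroup.one_closed[OF R] by auto
    next
      case (incl x)
      then show ?case using SR by auto
    next
      case (inv x)
      then show ?case using SR invR by (metis (no_types, lifting) imageE prod.collapse subsetD)
    next
      case (eng x y)
      then show ?case using multR by blast
    qed
  qed
  define h where "h x = (THE u. (x, u) \<in> R)" for x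
  have h: "h x = u" if "(x, u) \<in> R" for x u
    unfolding h_def using that uniq by blast
  have hR: "(x, h x) \<in> R" if "x \<in> carrier G" for x
    using total[OF that] h by metis
  have "h \<in> hom G U"
  proof (rule homI)
    show "h x \<in> carrier U" if "x \<in> carrier G" for x
      using hR[OF that] Rsub by auto
    show "h (x \<otimes>\<^bsub>G\<^esub> y) = h x \<otimes>\<^bsub>U\<^esub> h y" if "x \<in> carrier G" "y \<in> carrier G" for x y
      using h multR hR that by blast
  qed
  then show thesis using that h SR by blast
qed

text \<open>The witness hidden in \<open>free_factor\<close> is made explicit, so that a complement
  can be chosen once per edge and reused.\<close>

definition free_complement :: "('a, 'm) monoid_scheme \<Rightarrow> 'a set \<Rightarrow> 'a set \<Rightarrow> bool" where
  "free_complement G H K \<longleftrightarrow> subgroup H G \<and> subgroup K G \<and> generate G (H \<union> K) = carrier G \<and>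
     (\<forall>xs. xs \<noteq> [] \<and> (\<forall>(b, x) \<in> set xs. x \<in> (if b then H else K) \<and> x \<noteq> \<one>\<^bsub>G\<^esub>) \<and>
           successively (\<lambda>a c. fst a \<noteq> fst c) xs
           \<longrightarrow> foldr (\<lambda>(b, x) acc. x \<otimes>\<^bsub>G\<^esub> acc) xs \<one>\<^bsub>G\<^esub> \<noteq> \<one>\<^bsub>G\<^esub>)"

lemma free_factor_iff: "free_factor G H \<longleftrightarrow> (\<exists>K. free_complement G H K)"
  by (auto simp: free_factor_def free_complement_def)

text \<open>The pairs of values in \<open>G\<close> and in \<open>U\<close> of one alternating word
  form a set closed under left multiplication by letters, so it contains the subgroup generated by
  the prescribed pairs. Over the identity of \<open>G\<close> only the empty word is possible, and
  \<open>hom_of_graph\<close> applies.\<close>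

lemma free_product_extend:
  assumes G: "group G" and U: "group U" and HK: "free_complement G H K"
    and \<alpha>: "\<alpha> \<in> hom (G\<lparr>carrier := H\<rparr>) U" and \<beta>: "\<beta> \<in> hom (G\<lparr>carrier := K\<rparr>) U"
  obtains h where "h \<in> hom G U" "\<forall>x\<in>H. h x = \<alpha> x" "\<forall>x\<in>K. h x = \<beta> x"
proof -
  interpret G: group G by fact
  interpret U: group U by fact
  interpret D: group "G \<times>\<times> U" by (rule DirProd_group[OF G U])
  define A where "A b = (if b then H else K)" for b
  define \<gamma> where "\<gamma> b = (if b then \<alpha> else \<beta>)" for b
  have sub: "subgroup (A b) G" for b
    using HK by (simp add: A_def free_complement_def)
  have Acarr: "x \<in> carrier G" if "x \<in> A b" for x b
    using sub that subgroup.mem_carrier by metis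
  have \<gamma>hom: "\<gamma> b \<in> hom (G\<lparr>carrier := A b\<rparr>) U" for b
    using \<alpha> \<beta> by (simp add: A_def \<gamma>_def)
  have \<gamma>c: "\<gamma> b x \<in> carrier U" if "x \<in> A b" for b x
    using \<gamma>hom[of b] that by (auto simp: hom_def)
  have \<gamma>m: "\<gamma> b (x \<otimes>\<^bsub>G\<^esub> y) = \<gamma> b x \<otimes>\<^bsub>U\<^esub> \<gamma> b y" if "x \<in> A b" "y \<in> A b" for b x y
    using \<gamma>hom[of b] that by (auto simp: hom_def)
  have Ah: "group_hom (G\<lparr>carrier := A b\<rparr>) U (\<gamma> b)" for b
    using subgroup.subgroup_is_group[OF sub G] U \<gamma>hom by (simp add: group_hom_def group_hom_axioms_def)
  have \<gamma>1: "\<gamma> b \<one>\<^bsub>G\<^esub> = \<one>\<^bsub>U\<^esub>" for b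
    using group_hom.hom_one[OF Ah] by simp
  have \<gamma>i: "\<gamma> b (inv\<^bsub>G\<^esub> x) = inv\<^bsub>U\<^esub> \<gamma> b x" if "x \<in> A b" for b x
    using group_hom.hom_inv[OF Ah, of x b] that G.m_inv_consistent[OF sub that] by simp
  define pG where "pG = (\<lambda>xs :: (bool \<times> _) list. foldr (\<lambda>(b, x) acc. x \<otimes>\<^bsub>G\<^esub> acc) xs \<one>\<^bsub>G\<^esub>)"
  define pU where "pU = (\<lambda>xs :: (bool \<times> _) list. foldr (\<lambda>(b, x) acc. \<gamma> b x \<otimes>\<^bsub>U\<^esub> acc) xs \<one>\<^bsub>U\<^esub>)"
  define good where "good xs \<longleftrightarrow> (\<forall>(b, x) \<in> set xs. x \<in> A b \<and> x \<noteq> \<one>\<^bsub>G\<^esub>) \<and> successively (\<lambda>a c. fst a \<noteq> fst c) xs" for xs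
  have alt: "pG xs \<noteq> \<one>\<^bsub>G\<^esub>" if "xs \<noteq> []" "good xs" for xs
    using HK that unfolding free_complement_def good_def A_def pG_def by blast
  have pG: "pG [] = \<one>\<^bsub>G\<^esub>" "pG ((b, x) # xs) = x \<otimes>\<^bsub>G\<^esub> pG xs"
    and pU: "pU [] = \<one>\<^bsub>U\<^esub>" "pU ((b, x) # xs) = \<gamma> b x \<otimes>\<^bsub>U\<^esub> pU xs" for b x xs
    by (simp_all add: pG_def pU_def)
  have good_Cons: "good ((b, x) # xs) \<longleftrightarrow> x \<in> A b \<and> x \<noteq> \<one>\<^bsub>G\<^esub> \<and> good xs \<and> (xs = [] \<or> fst (hd xs) \<noteq> b)" for b x xs
    by (cases xs) (auto simp: good_def)
  have pGc: "pG xs \<in> carrier G" and pUc: "pU xs \<in> carrier U" if "good xs" for xs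
    using that
  proof (induction xs)
    case (Cons a xs)
    { case 1 then show ?case using Cons Acarr by (cases a) (auto simp: good_Cons pG) }
    { case 2 then show ?case using Cons \<gamma>c by (cases a) (auto simp: good_Cons pU) }
  qed (simp_all add: pG pU)
  define T where "T = {(pG xs, pU xs) | xs. good xs}"
  \<comment> \<open>A new letter either extends the alternating word or merges with a head from the
    same factor. A merged letter equal to the identity is dropped, and what is left still
    alternates.\<close>
  have Tmult: "(x \<otimes>\<^bsub>G\<^esub> g, \<gamma> b x \<otimes>\<^bsub>U\<^esub> u) \<in> T" if x: "x \<in> A b" and t: "(g, u) \<in> T" for x b g u
  proof -
    obtain xs where xs: "good xs" "g = pG xs" "u = pU xs"
      using t by (auto simp: T_def)
    show ?thesis
    proof (cases "x = \<one>\<^bsub>G\<^esub>")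
      case True
      then show ?thesis using t xs \<gamma>1 pGc pUc by simp
    next
      case x1: False
      show ?thesis
      proof (cases "xs = [] \<or> fst (hd xs) \<noteq> b")
        case True
        then have "good ((b, x) # xs)" using x x1 xs by (simp add: good_Cons)
        then show ?thesis unfolding T_def using xs by (force simp: pG pU intro!: exI[of _ "(b, x) # xs"])
      next
        case False
        then obtain y ys where ys: "xs = (b, y) # ys" by (cases xs) auto
        have y: "y \<in> A b" "good ys" "ys = [] \<or> fst (hd ys) \<noteq> b" using xs(1) ys by (auto simp: good_Cons)
        have eqs: "x \<otimes>\<^bsub>G\<^esub> g = (x \<otimes>\<^bsub>G\<^esub> y) \<otimes>\<^bsub>G\<^esub> pG ys" "\<gamma> b x \<otimes>\<^bsub>U\<^esub> u = \<gamma> b (x \<otimes>\<^bsub>G\<^esub> y) \<otimes>\<^bsub>U\<^esub> pU ys"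
          using x y xs ys Acarr \<gamma>c pGc pUc by (simp_all add: pG pU \<gamma>m G.m_assoc U.m_assoc)
        have xy: "x \<otimes>\<^bsub>G\<^esub> y \<in> A b" using x y(1) sub subgroup.m_closed by metis
        show ?thesis
        proof (cases "x \<otimes>\<^bsub>G\<^esub> y = \<one>\<^bsub>G\<^esub>")
          case True
          then show ?thesis unfolding eqs T_def using y pGc pUc \<gamma>1 by auto
        next
          case False
          then have "good ((b, x \<otimes>\<^bsub>G\<^esub> y) # ys)" using xy y by (simp add: good_Cons)
          then show ?thesis unfolding eqs T_def
            by (force simp: pG pU intro!: exI[of _ "(b, x \<otimes>\<^bsub>G\<^esub> y) # ys"])
        qed
      qed
    qed
  qed
  define S where "S = {(x, \<gamma> b x) | x b. x \<in> A b}"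
  have Ssub: "S \<subseteq> carrier G \<times> carrier U" using Acarr \<gamma>c by (auto simp: S_def)
  have fstS: "fst ` S = H \<union> K"
  proof -
    have "fst ` S = A True \<union> A False"
      unfolding S_def by (auto simp: image_iff) (metis (full_types))+
    then show ?thesis by (simp add: A_def)
  qed
  have gen: "generate (G \<times>\<times> U) S \<subseteq> T"
  proof (rule generate_subset_left_closed[OF DirProd_group[OF G U]])
    show "S \<subseteq> carrier (G \<times>\<times> U)" using Ssub by simp
    show "T \<subseteq> carrier (G \<times>\<times> U)" using pGc pUc by (auto simp: T_def)
    show "\<one>\<^bsub>G \<times>\<times> U\<^esub> \<in> T" unfolding T_def by (auto simp: pG pU good_def intro!: exI[of _ "[]"])
    show "s \<otimes>\<^bsub>G \<times>\<times> U\<^esub> t \<in> T" if "s \<in> S" "t \<in> T" for s t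
      using that Tmult by (cases t) (auto simp: S_def)
    show "inv\<^bsub>G \<times>\<times> U\<^esub> s \<otimes>\<^bsub>G \<times>\<times> U\<^esub> t \<in> T" if s: "s \<in> S" and t: "t \<in> T" for s t
    proof -
      obtain x b where x: "s = (x, \<gamma> b x)" "x \<in> A b" using s by (auto simp: S_def)
      have "inv\<^bsub>G \<times>\<times> U\<^esub> s = (inv\<^bsub>G\<^esub> x, \<gamma> b (inv\<^bsub>G\<^esub> x))"
        using x Acarr \<gamma>c \<gamma>i by (simp add: inv_DirProd[OF G U])
      then show ?thesis using Tmult[of "inv\<^bsub>G\<^esub> x" b] t x(2) subgroup.m_inv_closed[OF sub] by (cases t) auto
    qed
  qed
  have triv: "u = \<one>\<^bsub>U\<^esub>" if "(\<one>\<^bsub>G\<^esub>, u) \<in> generate (G \<times>\<times> U) S" for u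
  proof -
    have "(\<one>\<^bsub>G\<^esub>, u) \<in> T" by (rule subsetD[OF gen that])
    then obtain xs where xs: "good xs" "\<one>\<^bsub>G\<^esub> = pG xs" "u = pU xs" unfolding T_def by blast
    then have "xs = []" using alt by metis
    then show ?thesis using xs pU by simp
  qed
  have "generate G (fst ` S) = carrier G"
    using HK by (simp add: fstS free_complement_def)
  then obtain h where h: "h \<in> hom G U" "\<And>x u. (x, u) \<in> S \<Longrightarrow> h x = u"
    using hom_of_graph[OF G U Ssub _ triv] by blast
  have "h x = \<gamma> b x" if "x \<in> A b" for x b using h(2) that by (auto simp: S_def)
  from this[of _ True] this[of _ False] show thesis using that h(1) by (simp add: A_def \<gamma>_def)
qed

lemma eval_word_Nil [simp]: "eval_word G [] = \<one>\<^bsub>G\<^esub>"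
  and eval_word_Cons: "eval_word G ((x, b) # w) = (if b then x else inv\<^bsub>G\<^esub> x) \<otimes>\<^bsub>G\<^esub> eval_word G w"
  by (simp_all add: eval_word_def)

lemma eval_word_closed:
  "group G \<Longrightarrow> set (map fst w) \<subseteq> carrier G \<Longrightarrow> eval_word G w \<in> carrier G"
  by (induction w) (auto simp: eval_word_Cons group.is_monoid monoid.m_closed)

lemma hom_eval_word:
  assumes "group_hom G U h" "set (map fst w) \<subseteq> carrier G"
  shows "h (eval_word G w) = eval_word U (map (\<lambda>(x, b). (h x, b)) w)"
proof -
  interpret group_hom G U h by fact
  show ?thesis
    using assms(2)
  proof (induction w)
    case (Cons a w)
    moreover have "eval_word G w \<in> carrier G"
      using Cons.prems by (intro eval_word_closed[OF G.is_group]) auto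
    ultimately show ?case by (cases a) (simp add: eval_word_Cons)
  qed simp
qed

text \<open>The argument of \<open>free_product_extend\<close> with freely reduced words in place of
  alternating ones. The last conclusion comes from the same closure property and supplies the word
  whose length fixes the stage in \<open>free_group_p_separated\<close>.\<close>

lemma free_group_extend:
  assumes G: "group G" and U: "group U" and B: "B \<subseteq> carrier G" "generate G B = carrier G"
    and free: "\<forall>w. w \<noteq> [] \<and> set (map fst w) \<subseteq> B \<and> freely_reduced w \<longrightarrow> eval_word G w \<noteq> \<one>\<^bsub>G\<^esub>"
    and u: "u \<in> B \<rightarrow> carrier U"
  obtains h where "h \<in> hom G U" "\<forall>x\<in>B. h x = u x"
    "\<forall>x\<in>carrier G. \<exists>w. set (map fst w) \<subseteq> B \<and> freely_reduced w \<and> x = eval_word G w"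
proof -
  interpret G: group G by fact
  interpret U: group U by fact
  interpret D: group "G \<times>\<times> U" by (rule DirProd_group[OF G U])
  define eU where "eU w = eval_word U (map (\<lambda>(b, s). (u b, s)) w)" for w
  define good where "good w \<longleftrightarrow> set (map fst w) \<subseteq> B \<and> freely_reduced w" for w :: "('a \<times> bool) list"
  have eU: "eU [] = \<one>\<^bsub>U\<^esub>" "eU ((x, b) # w) = (if b then u x else inv\<^bsub>U\<^esub> u x) \<otimes>\<^bsub>U\<^esub> eU w" for x b w
    by (simp_all add: eU_def eval_word_Cons)
  have good_Cons: "good ((x, b) # w) \<longleftrightarrow> x \<in> B \<and> good w \<and> (w = [] \<or> hd w \<noteq> (x, \<not> b))" for x b w
    by (cases w) (auto simp: good_def freely_reduced_def)
  have uc: "x \<in> B \<Longrightarrow> u x \<in> carrier U" for x using u by auto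
  have Bc: "x \<in> B \<Longrightarrow> x \<in> carrier G" for x using B by auto
  have eGc: "good w \<Longrightarrow> eval_word G w \<in> carrier G" for w
    using eval_word_closed[OF G] B(1) by (auto simp: good_def)
  have eUc: "good w \<Longrightarrow> eU w \<in> carrier U" for w
    by (induction w) (auto simp: good_Cons eU uc)
  define T where "T = {(eval_word G w, eU w) | w. good w}"
  have Tmult: "((if b then x else inv\<^bsub>G\<^esub> x) \<otimes>\<^bsub>G\<^esub> g, (if b then u x else inv\<^bsub>U\<^esub> u x) \<otimes>\<^bsub>U\<^esub> v) \<in> T"
    if x: "x \<in> B" and t: "(g, v) \<in> T" for x b g v
  proof -
    obtain w where w: "good w" "g = eval_word G w" "v = eU w" using t by (auto simp: T_def)
    show ?thesis
    proof (cases "w = [] \<or> hd w \<noteq> (x, \<not> b)")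
      case True
      then have "good ((x, b) # w)" using x w by (simp add: good_Cons)
      then show ?thesis unfolding T_def using w by (force simp: eval_word_Cons eU intro!: exI[of _ "(x, b) # w"])
    next
      case False
      then obtain w' where w': "w = (x, \<not> b) # w'" by (cases w) auto
      have gw': "good w'" using w(1) w' by (simp add: good_Cons)
      have "(if b then x else inv\<^bsub>G\<^esub> x) \<otimes>\<^bsub>G\<^esub> g = eval_word G w'"
        using w w' eGc[OF gw'] Bc[OF x] by (simp add: eval_word_Cons G.m_assoc[symmetric])
      moreover have "(if b then u x else inv\<^bsub>U\<^esub> u x) \<otimes>\<^bsub>U\<^esub> v = eU w'"
        using w w' eUc[OF gw'] uc[OF x] by (simp add: eU U.m_assoc[symmetric])
      ultimately show ?thesis using gw' by (auto simp: T_def)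
    qed
  qed
  define S where "S = (\<lambda>x. (x, u x)) ` B"
  have Ssub: "S \<subseteq> carrier G \<times> carrier U" using Bc uc by (auto simp: S_def)
  have fstS: "fst ` S = B" by (force simp: S_def)
  have gen: "generate (G \<times>\<times> U) S \<subseteq> T"
  proof (rule generate_subset_left_closed[OF DirProd_group[OF G U]])
    show "S \<subseteq> carrier (G \<times>\<times> U)" using Ssub by simp
    show "T \<subseteq> carrier (G \<times>\<times> U)" using eGc eUc by (auto simp: T_def)
    show "\<one>\<^bsub>G \<times>\<times> U\<^esub> \<in> T" unfolding T_def by (auto simp: eU good_def freely_reduced_def intro!: exI[of _ "[]"])
    show "s \<otimes>\<^bsub>G \<times>\<times> U\<^esub> t \<in> T" if "s \<in> S" "t \<in> T" for s t
      using that Tmult[of _ _ _ True] by (cases t) (auto simp: S_def)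
    show "inv\<^bsub>G \<times>\<times> U\<^esub> s \<otimes>\<^bsub>G \<times>\<times> U\<^esub> t \<in> T" if s: "s \<in> S" and t: "t \<in> T" for s t
      using s t Tmult[of _ _ _ False] Bc uc by (cases t) (auto simp: S_def inv_DirProd[OF G U])
  qed
  have triv: "v = \<one>\<^bsub>U\<^esub>" if "(\<one>\<^bsub>G\<^esub>, v) \<in> generate (G \<times>\<times> U) S" for v
  proof -
    have "(\<one>\<^bsub>G\<^esub>, v) \<in> T" by (rule subsetD[OF gen that])
    then obtain w where w: "good w" "\<one>\<^bsub>G\<^esub> = eval_word G w" "v = eU w" unfolding T_def by blast
    have "w = []"
    proof (rule ccontr)
      assume "w \<noteq> []"
      then have "eval_word G w \<noteq> \<one>\<^bsub>G\<^esub>" using spec[OF free, of w] w(1) by (simp add: good_def)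
      then show False using w(2) by simp
    qed
    then show ?thesis using w eU by simp
  qed
  have "generate G (fst ` S) = carrier G"
    by (simp add: fstS B(2))
  then obtain h where h: "h \<in> hom G U" "\<And>x u. (x, u) \<in> S \<Longrightarrow> h x = u"
    using hom_of_graph[OF G U Ssub _ triv] by blast
  have hB: "h x = u x" if "x \<in> B" for x using h(2) that by (auto simp: S_def)
  have "\<exists>w. good w \<and> x = eval_word G w" if "x \<in> carrier G" for x
  proof -
    have "generate G B \<subseteq> {eval_word G w | w. good w}"
    proof (rule generate_subset_left_closed[OF G B(1)])
      show "{eval_word G w | w. good w} \<subseteq> carrier G" using eGc by auto
      show "\<one>\<^bsub>G\<^esub> \<in> {eval_word G w | w. good w}"
        by (auto simp: good_def freely_reduced_def intro!: exI[of _ "[]"])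
      show "s \<otimes>\<^bsub>G\<^esub> t \<in> {eval_word G w | w. good w}" if "s \<in> B" "t \<in> {eval_word G w | w. good w}" for s t
        using Tmult[OF that(1), of t _ True] that(2) by (auto simp: T_def)
      show "inv\<^bsub>G\<^esub> s \<otimes>\<^bsub>G\<^esub> t \<in> {eval_word G w | w. good w}" if "s \<in> B" "t \<in> {eval_word G w | w. good w}" for s t
        using Tmult[OF that(1), of t _ False] that(2) by (auto simp: T_def)
    qed
    then show ?thesis using that B(2) by auto
  qed
  then show thesis using that[OF h(1)] hB unfolding good_def by blast
qed

section \<open>Finite quotients of multiple HNN extensions\<close>

text \<open>The elements \<open>t e\<close> are images of the stable letters in the base, so the HNN
  extension retracts onto \<open>P0\<close>, and \<open>P0\<close> itself is a finite quotient to
  start from. \<open>C e\<close> is the associated subgroup at the origin of \<open>e\<close>; it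
  will stabilise the edge \<open>e\<close> at the base vertex of the coset graph.\<close>

locale hnn_data =
  fixes P0 :: "'g monoid" and E :: "'e set" and bar :: "'e \<Rightarrow> 'e" and t :: "'e \<Rightarrow> 'g" and C :: "'e \<Rightarrow> 'g set"
  assumes grp0: "group P0" and fin0: "finite (carrier P0)" and finE: "finite E"
    and bar: "\<And>e. e \<in> E \<Longrightarrow> bar e \<in> E" "\<And>e. e \<in> E \<Longrightarrow> bar e \<noteq> e" "\<And>e. e \<in> E \<Longrightarrow> bar (bar e) = e"
    and t: "\<And>e. e \<in> E \<Longrightarrow> t e \<in> carrier P0" "\<And>e. e \<in> E \<Longrightarrow> t (bar e) = inv\<^bsub>P0\<^esub> t e"
    and C: "\<And>e. e \<in> E \<Longrightarrow> subgroup (C e) P0"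
    and tC: "\<And>e c. e \<in> E \<Longrightarrow> c \<in> C (bar e) \<Longrightarrow> t e \<otimes>\<^bsub>P0\<^esub> c \<otimes>\<^bsub>P0\<^esub> inv\<^bsub>P0\<^esub> t e \<in> C e"
begin

text \<open>A pair \<open>(e, g)\<close> stands for the stable letter of \<open>e\<close> followed
  by \<open>g\<close>; the excluded pattern is a pinch in the sense of Britton's lemma.\<close>

definition reduced :: "('e \<times> 'g) list \<Rightarrow> bool" where
  "reduced l \<longleftrightarrow> set l \<subseteq> E \<times> carrier P0 \<and>
     successively (\<lambda>x y. \<not> (fst y = bar (fst x) \<and> snd x \<in> C (fst y))) l"

definition word_val :: "('c, 'm) monoid_scheme \<Rightarrow> ('e \<Rightarrow> 'c) \<Rightarrow> ('g \<Rightarrow> 'c) \<Rightarrow> ('e \<times> 'g) list \<Rightarrow> 'c" where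
  "word_val P s \<iota> l = foldr (\<lambda>(e, g) acc. s e \<otimes>\<^bsub>P\<^esub> (\<iota> g \<otimes>\<^bsub>P\<^esub> acc)) l \<one>\<^bsub>P\<^esub>"

lemma word_val_simps [simp]:
  "word_val P s \<iota> [] = \<one>\<^bsub>P\<^esub>"
  "word_val P s \<iota> ((e, g) # l) = s e \<otimes>\<^bsub>P\<^esub> (\<iota> g \<otimes>\<^bsub>P\<^esub> word_val P s \<iota> l)"
  by (simp_all add: word_val_def)

text \<open>The group P is a finite quotient of the multiple HNN extension of P0 with stable letters s e
  conjugating C (bar e) to C e, in which Britton's lemma still holds for words of length at most m.\<close>

definition stage :: "nat \<Rightarrow> nat \<Rightarrow> 'c monoid \<Rightarrow> ('g \<Rightarrow> 'c) \<Rightarrow> ('c \<Rightarrow> 'g) \<Rightarrow> ('e \<Rightarrow> 'c) \<Rightarrow> bool" where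
  "stage p m P \<iota> \<pi> s \<longleftrightarrow> group P \<and> finite (carrier P) \<and> \<iota> \<in> hom P0 P \<and> \<pi> \<in> hom P P0 \<and>
     (\<forall>x\<in>carrier P0. \<pi> (\<iota> x) = x) \<and>
     (\<forall>e\<in>E. s e \<in> carrier P \<and> s (bar e) = inv\<^bsub>P\<^esub> s e \<and> \<pi> (s e) = t e) \<and>
     (\<forall>e\<in>E. \<forall>c\<in>C (bar e). s e \<otimes>\<^bsub>P\<^esub> \<iota> c = \<iota> (t e \<otimes>\<^bsub>P0\<^esub> c \<otimes>\<^bsub>P0\<^esub> inv\<^bsub>P0\<^esub> t e) \<otimes>\<^bsub>P\<^esub> s e) \<and>
     (\<forall>x\<in>carrier P. \<pi> x = \<one>\<^bsub>P0\<^esub> \<longrightarrow> x [^]\<^bsub>P\<^esub> (p ^ m) = \<one>\<^bsub>P\<^esub>) \<and>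
     (\<forall>l. l \<noteq> [] \<longrightarrow> length l \<le> m \<longrightarrow> reduced l \<longrightarrow> word_val P s \<iota> l \<notin> \<iota> ` carrier P0)"

lemma stage_0: "stage p 0 P0 id id t"
proof -
  interpret P0: group P0 by (rule grp0)
  have "subgroup (C (bar e)) P0" if "e \<in> E" for e using C bar that by blast
  then have Cc: "c \<in> carrier P0" if "e \<in> E" "c \<in> C (bar e)" for e c
    using that subgroup.mem_carrier by metis
  then show ?thesis
    by (auto simp: stage_def grp0 fin0 t P0.m_assoc hom_def)
qed

text \<open>Each extension step produces a group over a larger type; this brings the result back to
  \<open>nat\<close>, so that the induction in \<open>ex_stage\<close> stays in one type.\<close>

lemma stage_iso:
  fixes P :: "'c monoid" and N :: "'d monoid"
  assumes st: "stage p m P \<iota> \<pi> s" and N: "group N" "finite (carrier N)" and h: "h \<in> iso P N"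
  shows "stage p m N (h \<circ> \<iota>) (\<pi> \<circ> inv_into (carrier P) h) (h \<circ> s)"
proof -
  have P: "group P" and \<iota>: "\<iota> \<in> hom P0 P" and \<pi>: "\<pi> \<in> hom P P0" and s: "\<And>e. e \<in> E \<Longrightarrow> s e \<in> carrier P"
    using st by (auto simp: stage_def)
  interpret P: group P by fact
  interpret N: group N by fact
  have hh: "h \<in> hom P N" using h by (simp add: iso_def)
  interpret h: group_hom P N h using hh by (simp add: group_hom_def group_hom_axioms_def P N)
  have inj: "inj_on h (carrier P)" using h by (simp add: iso_def bij_betw_def)
  have surj: "h ` carrier P = carrier N" using h by (simp add: iso_def bij_betw_def)
  have ic: "\<iota> x \<in> carrier P" if "x \<in> carrier P0" for x using \<iota> that by (auto simp: hom_def)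
  have inv_h: "inv_into (carrier P) h (h x) = x" if "x \<in> carrier P" for x
    using inj that by simp
  have wv: "word_val P s \<iota> l \<in> carrier P \<and> word_val N (h \<circ> s) (h \<circ> \<iota>) l = h (word_val P s \<iota> l)"
    if "set l \<subseteq> E \<times> carrier P0" for l
    using that by (induction l) (auto simp: s ic)
  have Cc: "c \<in> carrier P0" if "e \<in> E" "c \<in> C (bar e)" for e c
    using that C bar subgroup.mem_carrier by metis
  have inv_hom: "inv_into (carrier P) h \<in> hom N P"
    using P.iso_set_sym[OF h] by (simp add: iso_def)
  show ?thesis
    unfolding stage_def
  proof (intro conjI ballI allI impI)
    show "h \<circ> \<iota> \<in> hom P0 N" by (rule hom_compose[OF \<iota> hh])
    show "\<pi> \<circ> inv_into (carrier P) h \<in> hom N P0" by (rule hom_compose[OF inv_hom \<pi>])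
    show "(\<pi> \<circ> inv_into (carrier P) h) ((h \<circ> \<iota>) x) = x" if "x \<in> carrier P0" for x
      using that st by (simp add: inv_h ic stage_def)
    fix e assume e: "e \<in> E"
    show "(h \<circ> s) e \<in> carrier N" using s e by simp
    show "(h \<circ> s) (bar e) = inv\<^bsub>N\<^esub> (h \<circ> s) e" using s e st by (simp add: stage_def)
    show "(\<pi> \<circ> inv_into (carrier P) h) ((h \<circ> s) e) = t e" using s e st by (simp add: inv_h stage_def)
    fix c assume c: "c \<in> C (bar e)"
    have "t e \<otimes>\<^bsub>P0\<^esub> c \<otimes>\<^bsub>P0\<^esub> inv\<^bsub>P0\<^esub> t e \<in> carrier P0"
      using tC[OF e c] C[OF e] subgroup.mem_carrier by metis
    moreover have "s e \<otimes>\<^bsub>P\<^esub> \<iota> c = \<iota> (t e \<otimes>\<^bsub>P0\<^esub> c \<otimes>\<^bsub>P0\<^esub> inv\<^bsub>P0\<^esub> t e) \<otimes>\<^bsub>P\<^esub> s e"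
      using st e c by (simp add: stage_def)
    ultimately show "(h \<circ> s) e \<otimes>\<^bsub>N\<^esub> (h \<circ> \<iota>) c = (h \<circ> \<iota>) (t e \<otimes>\<^bsub>P0\<^esub> c \<otimes>\<^bsub>P0\<^esub> inv\<^bsub>P0\<^esub> t e) \<otimes>\<^bsub>N\<^esub> (h \<circ> s) e"
      using s[OF e] ic Cc[OF e c] by (simp flip: h.hom_mult)
  next
    fix x assume x: "x \<in> carrier N" "(\<pi> \<circ> inv_into (carrier P) h) x = \<one>\<^bsub>P0\<^esub>"
    obtain y where y: "y \<in> carrier P" "x = h y" using x(1) surj by blast
    then have "y [^]\<^bsub>P\<^esub> (p ^ m) = \<one>\<^bsub>P\<^esub>" using x(2) st by (simp add: inv_h stage_def)
    then show "x [^]\<^bsub>N\<^esub> (p ^ m) = \<one>\<^bsub>N\<^esub>" using y by (metis h.hom_nat_pow h.hom_one)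
  next
    fix l assume l: "l \<noteq> []" "length l \<le> m" "reduced l"
    then have "word_val P s \<iota> l \<notin> \<iota> ` carrier P0" using st by (simp add: stage_def)
    moreover have "set l \<subseteq> E \<times> carrier P0" using l(3) by (simp add: reduced_def)
    ultimately show "word_val N (h \<circ> s) (h \<circ> \<iota>) l \<notin> (h \<circ> \<iota>) ` carrier P0"
      using wv[of l] inj ic by (auto dest!: inj_onD)
  qed (use N in auto)
qed

lemma reduced_subword: "reduced (l1 @ l2 @ l3) \<Longrightarrow> reduced l2"
  by (auto simp: reduced_def successively_append_iff)

end

section \<open>One extension step: the semidirect product with the mod p chains of the coset
  graph\<close>

locale hnn_step = hnn_data P0 E bar t C
  for P0 :: "'g monoid" and E :: "'e set" and bar t C +
  fixes p m :: nat and P :: "'c monoid" and \<iota> \<pi> s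
  assumes p: "p > 1" and st: "stage p m P \<iota> \<pi> s"
begin

lemma grpP: "group P" and finP: "finite (carrier P)" and \<iota>hom: "\<iota> \<in> hom P0 P" and \<pi>hom: "\<pi> \<in> hom P P0"
  and \<pi>\<iota>: "x \<in> carrier P0 \<Longrightarrow> \<pi> (\<iota> x) = x"
  and s_closed: "e \<in> E \<Longrightarrow> s e \<in> carrier P" and s_bar: "e \<in> E \<Longrightarrow> s (bar e) = inv\<^bsub>P\<^esub> s e"
  and \<pi>s: "e \<in> E \<Longrightarrow> \<pi> (s e) = t e"
  and s_comm: "e \<in> E \<Longrightarrow> c \<in> C (bar e) \<Longrightarrow> s e \<otimes>\<^bsub>P\<^esub> \<iota> c = \<iota> (t e \<otimes>\<^bsub>P0\<^esub> c \<otimes>\<^bsub>P0\<^esub> inv\<^bsub>P0\<^esub> t e) \<otimes>\<^bsub>P\<^esub> s e"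
  and tors: "a \<in> carrier P \<Longrightarrow> \<pi> a = \<one>\<^bsub>P0\<^esub> \<Longrightarrow> a [^]\<^bsub>P\<^esub> (p ^ m) = \<one>\<^bsub>P\<^esub>"
  and sep: "l \<noteq> [] \<Longrightarrow> length l \<le> m \<Longrightarrow> reduced l \<Longrightarrow> word_val P s \<iota> l \<notin> \<iota> ` carrier P0"
  using st by (auto simp: stage_def)

sublocale P: group P by (rule grpP)
sublocale P0: group P0 by (rule grp0)
sublocale \<iota>: group_hom P0 P \<iota> using \<iota>hom by (simp add: group_hom_def group_hom_axioms_def grpP grp0)
sublocale \<pi>: group_hom P P0 \<pi> using \<pi>hom by (simp add: group_hom_def group_hom_axioms_def grpP grp0)

text \<open>Chains modulo \<open>p\<close>, with representatives in \<open>0..<p\<close> and zero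
  outside the support, so that equal chains are equal functions. An edge of the coset graph, a left
  coset of the image of \<open>C e\<close>, is encoded by its indicator function; no type of cosets
  is required.\<close>

definition M :: "('c \<times> 'e \<Rightarrow> int) set" where
  "M = {\<Phi>. (\<forall>z. \<Phi> z \<in> {0..<int p}) \<and> (\<forall>z. z \<notin> carrier P \<times> E \<longrightarrow> \<Phi> z = 0)}"

definition shift :: "'c \<Rightarrow> ('c \<times> 'e \<Rightarrow> int) \<Rightarrow> 'c \<times> 'e \<Rightarrow> int" where
  "shift x \<Phi> = (\<lambda>(u, e). if u \<in> carrier P \<and> e \<in> E then \<Phi> (inv\<^bsub>P\<^esub> x \<otimes>\<^bsub>P\<^esub> u, e) else 0)"

text \<open>The semidirect product of \<open>M\<close> with \<open>P\<close> acting by left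
  translation. Along a word in the lifted letters \<open>s'\<close> the first coordinate accumulates
  the chain of the path that the word traces in the coset graph.\<close>

definition D :: "(('c \<times> 'e \<Rightarrow> int) \<times> 'c) monoid" where
  "D = \<lparr>carrier = M \<times> carrier P,
        monoid.mult = (\<lambda>(\<Phi>, x) (\<Psi>, y). (\<lambda>z. (\<Phi> z + shift x \<Psi> z) mod int p, x \<otimes>\<^bsub>P\<^esub> y)),
        one = (\<lambda>_. 0, \<one>\<^bsub>P\<^esub>)\<rparr>"

lemma carrier_D: "carrier D = M \<times> carrier P"
  and mult_D: "(\<Phi>, x) \<otimes>\<^bsub>D\<^esub> (\<Psi>, y) = (\<lambda>z. (\<Phi> z + shift x \<Psi> z) mod int p, x \<otimes>\<^bsub>P\<^esub> y)"
  and one_D: "\<one>\<^bsub>D\<^esub> = (\<lambda>_. 0, \<one>\<^bsub>P\<^esub>)"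
  by (simp_all add: D_def)

lemma M_range:
  assumes "\<Phi> \<in> M"
  shows "\<Phi> z mod int p = \<Phi> z"
proof -
  have "\<Phi> z \<in> {0..<int p}" using assms unfolding M_def by blast
  then show ?thesis by simp
qed

lemma M_outside: "\<Phi> \<in> M \<Longrightarrow> z \<notin> carrier P \<times> E \<Longrightarrow> \<Phi> z = 0"
  unfolding M_def by blast

lemma zero_M: "(\<lambda>_. 0) \<in> M"
  using p by (auto simp: M_def)

lemma M_modI: "(\<And>z. z \<notin> carrier P \<times> E \<Longrightarrow> f z = 0) \<Longrightarrow> (\<lambda>z. f z mod int p) \<in> M"
  unfolding M_def using p by simp

lemma shift_outside: "z \<notin> carrier P \<times> E \<Longrightarrow> shift x \<Phi> z = 0"
  by (auto simp: shift_def split: prod.splits)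

lemma shift_zero [simp]: "shift x (\<lambda>_. 0) = (\<lambda>_. 0)"
  by (auto simp: shift_def)

lemma shift_one: "\<Phi> \<in> M \<Longrightarrow> shift \<one>\<^bsub>P\<^esub> \<Phi> = \<Phi>"
  by (auto simp: shift_def fun_eq_iff M_outside)

lemma shift_mult: "x \<in> carrier P \<Longrightarrow> y \<in> carrier P \<Longrightarrow> shift (x \<otimes>\<^bsub>P\<^esub> y) \<Phi> = shift x (shift y \<Phi>)"
  by (auto simp: shift_def fun_eq_iff P.inv_mult_group P.m_assoc)

lemma shift_mod: "shift x (\<lambda>z. f z mod int p) z = shift x f z mod int p"
  by (auto simp: shift_def split: prod.splits)

lemma shift_add: "shift x (\<lambda>z. f z + g z) z = shift x f z + shift x g z"
  by (auto simp: shift_def split: prod.splits)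

lemma group_D: "group D"
proof (rule groupI)
  fix a b assume "a \<in> carrier D" "b \<in> carrier D"
  then obtain \<Phi> x \<Psi> y where ab: "a = (\<Phi>, x)" "b = (\<Psi>, y)" "\<Phi> \<in> M" "\<Psi> \<in> M" "x \<in> carrier P" "y \<in> carrier P"
    by (auto simp: carrier_D)
  then have "(\<lambda>z. (\<Phi> z + shift x \<Psi> z) mod int p) \<in> M"
    using M_outside[of \<Phi>] shift_outside by (intro M_modI) (metis add.right_neutral)
  with ab show "a \<otimes>\<^bsub>D\<^esub> b \<in> carrier D" by (simp add: carrier_D mult_D)
next
  show "\<one>\<^bsub>D\<^esub> \<in> carrier D" by (simp add: carrier_D one_D zero_M)
next
  fix a b c assume "a \<in> carrier D" "b \<in> carrier D" "c \<in> carrier D"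
  then show "a \<otimes>\<^bsub>D\<^esub> b \<otimes>\<^bsub>D\<^esub> c = a \<otimes>\<^bsub>D\<^esub> (b \<otimes>\<^bsub>D\<^esub> c)"
    by (auto simp: carrier_D mult_D fun_eq_iff P.m_assoc shift_mult shift_mod shift_add mod_simps add.assoc)
next
  fix a assume "a \<in> carrier D"
  then show "\<one>\<^bsub>D\<^esub> \<otimes>\<^bsub>D\<^esub> a = a"
    by (auto simp: carrier_D mult_D one_D shift_one M_range)
next
  fix a assume "a \<in> carrier D"
  then obtain \<Phi> x where a: "a = (\<Phi>, x)" "\<Phi> \<in> M" "x \<in> carrier P" by (auto simp: carrier_D)
  let ?b = "(\<lambda>z. (- shift (inv\<^bsub>P\<^esub> x) \<Phi> z) mod int p, inv\<^bsub>P\<^esub> x)"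
  have "?b \<in> carrier D" using a by (auto simp: carrier_D intro!: M_modI simp: shift_outside)
  moreover have "?b \<otimes>\<^bsub>D\<^esub> a = \<one>\<^bsub>D\<^esub>"
    using a by (auto simp: mult_D one_D mod_simps)
  ultimately show "\<exists>b\<in>carrier D. b \<otimes>\<^bsub>D\<^esub> a = \<one>\<^bsub>D\<^esub>" by blast
qed

sublocale D: group D by (rule group_D)

lemma finite_D: "finite (carrier D)"
proof -
  have "M \<subseteq> (\<lambda>f z. if z \<in> carrier P \<times> E then f z else 0) ` ((carrier P \<times> E) \<rightarrow>\<^sub>E {0..<int p})"
  proof
    fix \<Phi> assume \<Phi>: "\<Phi> \<in> M"
    have "\<Phi> = (\<lambda>z. if z \<in> carrier P \<times> E then restrict \<Phi> (carrier P \<times> E) z else 0)"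
      using \<Phi> M_outside by (auto simp: fun_eq_iff)
    moreover have "restrict \<Phi> (carrier P \<times> E) \<in> (carrier P \<times> E) \<rightarrow>\<^sub>E {0..<int p}"
      using \<Phi> by (auto simp: M_def)
    ultimately show "\<Phi> \<in> (\<lambda>f z. if z \<in> carrier P \<times> E then f z else 0) ` ((carrier P \<times> E) \<rightarrow>\<^sub>E {0..<int p})"
      by blast
  qed
  moreover have "finite ((carrier P \<times> E) \<rightarrow>\<^sub>E {0..<int p})"
    using finP finE by (intro finite_PiE) auto
  ultimately have "finite M" by (meson finite_imageI finite_subset)
  then show ?thesis using finP by (simp add: carrier_D)
qed

text \<open>The 1-chain of the edge e leaving the base vertex in the coset graph of P; the two
  summands record the edge and its reversal.\<close>

definition chain :: "'e \<Rightarrow> 'c \<times> 'e \<Rightarrow> int" where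
  "chain e = (\<lambda>(u, e'). if u \<in> carrier P \<and> e' \<in> E
     then (of_bool (e' = e \<and> u \<in> \<iota> ` C e) -
           of_bool (e' = bar e \<and> inv\<^bsub>P\<^esub> s e \<otimes>\<^bsub>P\<^esub> u \<in> \<iota> ` C (bar e))) mod int p
     else 0)"

definition \<iota>' where "\<iota>' g = (\<lambda>_ :: 'c \<times> 'e. 0 :: int, \<iota> g)"
definition \<pi>' where "\<pi>' = (\<lambda>a :: ('c \<times> 'e \<Rightarrow> int) \<times> 'c. \<pi> (snd a))"
definition s' where "s' e = (chain e, s e)"

lemma chain_M: "chain e \<in> M"
  using p by (auto simp: M_def chain_def split: prod.splits)

lemma C_carrier: "e \<in> E \<Longrightarrow> c \<in> C e \<Longrightarrow> c \<in> carrier P0"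
  using C subgroup.mem_carrier by metis

lemma \<iota>C: "e \<in> E \<Longrightarrow> subgroup (\<iota> ` C e) P"
  using \<iota>.subgroup_img_is_subgroup C by blast

lemma left_mult_iff:
  assumes "subgroup K P" "d \<in> K" "u \<in> carrier P"
  shows "d \<otimes>\<^bsub>P\<^esub> u \<in> K \<longleftrightarrow> u \<in> K"
proof
  assume "d \<otimes>\<^bsub>P\<^esub> u \<in> K"
  then have "inv\<^bsub>P\<^esub> d \<otimes>\<^bsub>P\<^esub> (d \<otimes>\<^bsub>P\<^esub> u) \<in> K"
    using subgroup.m_closed[OF assms(1) subgroup.m_inv_closed[OF assms(1,2)]] by blast
  then show "u \<in> K"
    using assms subgroup.mem_carrier[OF assms(1,2)] by (simp add: P.m_assoc[symmetric])
qed (rule subgroup.m_closed[OF assms(1,2)])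

text \<open>Translating \<open>chain e\<close> by \<open>s (bar e)\<close> gives the edge
  \<open>bar e\<close> at the base vertex run through backwards, and the antisymmetric form of
  \<open>chain\<close> makes the two contributions cancel.\<close>

lemma s'_bar: assumes e: "e \<in> E" shows "s' (bar e) \<otimes>\<^bsub>D\<^esub> s' e = \<one>\<^bsub>D\<^esub>"
proof -
  have "(chain (bar e) z + shift (s (bar e)) (chain e) z) mod int p = 0" for z
  proof (cases z)
    case (Pair u e')
    show ?thesis
    proof (cases "u \<in> carrier P \<and> e' \<in> E")
      case True
      have "inv\<^bsub>P\<^esub> s e \<otimes>\<^bsub>P\<^esub> (s e \<otimes>\<^bsub>P\<^esub> u) = u"
        using True s_closed[OF e] by (simp add: P.m_assoc[symmetric])
      then show ?thesis
        using True e Pair s_closed[OF e] s_bar[OF e] bar[OF e]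
        by (simp add: chain_def shift_def mod_simps)
    next
      case False
      then show ?thesis
        using M_outside[OF chain_M, of z] shift_outside[of z] by (simp add: Pair)
    qed
  qed
  then show ?thesis
    using s_closed[OF e] s_bar[OF e] by (simp add: s'_def mult_D one_D)
qed

lemma s'_closed: "e \<in> E \<Longrightarrow> s' e \<in> carrier D"
  by (simp add: s'_def carrier_D chain_M s_closed)

text \<open>The image of \<open>C e\<close> fixes the edge \<open>e\<close> at the base vertex, and
  it fixes the reversed edge because the inverse of \<open>s e\<close> conjugates it into the image
  of \<open>C (bar e)\<close>. In the first coordinate of \<open>D\<close> this invariance is
  exactly the HNN relation.\<close>

lemma shift_chain:
  assumes e: "e \<in> E" and d: "d \<in> C e"
  shows "shift (\<iota> d) (chain e) = chain e"
proof -
  have dP: "\<iota> d \<in> carrier P" using C_carrier[OF e d] by simp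
  have inv_d: "inv\<^bsub>P\<^esub> \<iota> d \<in> \<iota> ` C e"
    using \<iota>C[OF e] d by (simp add: subgroup.m_inv_closed)
  have "shift (\<iota> d) (chain e) (u, e') = chain e (u, e')" if u: "u \<in> carrier P" "e' \<in> E" for u e'
  proof -
    have 1: "inv\<^bsub>P\<^esub> \<iota> d \<otimes>\<^bsub>P\<^esub> u \<in> \<iota> ` C e \<longleftrightarrow> u \<in> \<iota> ` C e"
      using left_mult_iff[OF \<iota>C[OF e] inv_d u(1)] .
    have inv_dC: "inv\<^bsub>P0\<^esub> d \<in> C (bar (bar e))"
      using C[OF e] d bar(3)[OF e] by (simp add: subgroup.m_inv_closed)
    have be: "bar e \<in> E" using bar e by blast
    let ?d' = "t (bar e) \<otimes>\<^bsub>P0\<^esub> inv\<^bsub>P0\<^esub> d \<otimes>\<^bsub>P0\<^esub> inv\<^bsub>P0\<^esub> t (bar e)"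
    have d': "?d' \<in> C (bar e)" by (rule tC[OF be inv_dC])
    have "inv\<^bsub>P\<^esub> s e \<otimes>\<^bsub>P\<^esub> inv\<^bsub>P\<^esub> \<iota> d = \<iota> ?d' \<otimes>\<^bsub>P\<^esub> inv\<^bsub>P\<^esub> s e"
      using s_comm[OF be inv_dC] s_bar[OF e] C_carrier[OF e d] by simp
    then have "inv\<^bsub>P\<^esub> s e \<otimes>\<^bsub>P\<^esub> (inv\<^bsub>P\<^esub> \<iota> d \<otimes>\<^bsub>P\<^esub> u) = \<iota> ?d' \<otimes>\<^bsub>P\<^esub> (inv\<^bsub>P\<^esub> s e \<otimes>\<^bsub>P\<^esub> u)"
      using s_closed[OF e] dP u(1) C_carrier[OF be d'] by (metis P.inv_closed P.m_assoc \<iota>.hom_closed)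
    then have 2: "inv\<^bsub>P\<^esub> s e \<otimes>\<^bsub>P\<^esub> (inv\<^bsub>P\<^esub> \<iota> d \<otimes>\<^bsub>P\<^esub> u) \<in> \<iota> ` C (bar e) \<longleftrightarrow> inv\<^bsub>P\<^esub> s e \<otimes>\<^bsub>P\<^esub> u \<in> \<iota> ` C (bar e)"
      using left_mult_iff[OF \<iota>C[OF be], of "\<iota> ?d'" "inv\<^bsub>P\<^esub> s e \<otimes>\<^bsub>P\<^esub> u"] d' s_closed[OF e] u(1) by simp
    show ?thesis using u dP by (simp add: shift_def chain_def 1 2)
  qed
  moreover have "shift (\<iota> d) (chain e) z = chain e z" if "z \<notin> carrier P \<times> E" for z
    using M_outside[OF chain_M that] shift_outside[OF that] by simp
  ultimately have "shift (\<iota> d) (chain e) z = chain e z" for z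
    by (cases "z \<in> carrier P \<times> E") (blast elim: SigmaE2, blast)
  then show ?thesis by (rule ext)
qed

lemma word_val_P: "set l \<subseteq> E \<times> carrier P0 \<Longrightarrow> word_val P s \<iota> l \<in> carrier P"
  by (induction l) (auto simp: s_closed)

lemma fst_word_val_Cons:
  assumes "set l \<subseteq> E \<times> carrier P0" "e \<in> E" "g \<in> carrier P0" "u \<in> carrier P" "e' \<in> E"
  shows "fst (word_val D s' \<iota>' ((e, g) # l)) (u, e') =
    (chain e (u, e') + fst (word_val D s' \<iota>' l) (inv\<^bsub>P\<^esub> \<iota> g \<otimes>\<^bsub>P\<^esub> (inv\<^bsub>P\<^esub> s e \<otimes>\<^bsub>P\<^esub> u), e')) mod int p"
  using assms s_closed[OF assms(2)]
  by (cases "word_val D s' \<iota>' l") (auto simp: mult_D s'_def \<iota>'_def shift_mod mod_simps shift_def)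

text \<open>The first coordinate of a word value is a sum of edge chains, each translated by the
  value of the prefix before its letter; a nonzero coefficient must come from one of them.\<close>

lemma fst_word_val_nonzero:
  assumes "set l \<subseteq> E \<times> carrier P0" "u \<in> carrier P" "e' \<in> E" "fst (word_val D s' \<iota>' l) (u, e') \<noteq> 0"
  shows "\<exists>l1 e g l2. l = l1 @ (e, g) # l2 \<and> chain e (inv\<^bsub>P\<^esub> word_val P s \<iota> l1 \<otimes>\<^bsub>P\<^esub> u, e') \<noteq> 0"
  using assms
proof (induction l arbitrary: u)
  case (Cons a l)
  obtain e g where a: "a = (e, g)" "e \<in> E" "g \<in> carrier P0" using Cons.prems by auto
  have l: "set l \<subseteq> E \<times> carrier P0" using Cons.prems by simp
  let ?u = "inv\<^bsub>P\<^esub> \<iota> g \<otimes>\<^bsub>P\<^esub> (inv\<^bsub>P\<^esub> s e \<otimes>\<^bsub>P\<^esub> u)"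
  show ?case
  proof (cases "chain e (u, e') = 0")
    case True
    then have "fst (word_val D s' \<iota>' l) (?u, e') \<noteq> 0"
      using Cons.prems fst_word_val_Cons[OF l a(2,3) Cons.prems(2,3)] unfolding a(1) by auto
    moreover have u: "?u \<in> carrier P" using a s_closed Cons.prems by simp
    ultimately obtain l1 e1 g1 l2 where l1: "l = l1 @ (e1, g1) # l2"
      "chain e1 (inv\<^bsub>P\<^esub> word_val P s \<iota> l1 \<otimes>\<^bsub>P\<^esub> ?u, e') \<noteq> 0"
      using Cons.IH[OF l _ Cons.prems(3)] by blast
    have w: "word_val P s \<iota> l1 \<in> carrier P" using word_val_P l l1(1) by simp
    have "inv\<^bsub>P\<^esub> word_val P s \<iota> ((e, g) # l1) \<otimes>\<^bsub>P\<^esub> u = inv\<^bsub>P\<^esub> word_val P s \<iota> l1 \<otimes>\<^bsub>P\<^esub> ?u"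
      using w a s_closed[OF a(2)] Cons.prems(2) by (simp add: P.inv_mult_group P.m_assoc)
    then show ?thesis using l1 a(1) by (metis append_Cons)
  next
    case False
    then show ?thesis using a Cons.prems(2) by (intro exI[of _ "[]"]) auto
  qed
qed (simp add: one_D)

lemma chain_nonzero:
  assumes "chain e (u, e') \<noteq> 0"
  shows "(e' = e \<and> u \<in> \<iota> ` C e) \<or> (e' = bar e \<and> inv\<^bsub>P\<^esub> s e \<otimes>\<^bsub>P\<^esub> u \<in> \<iota> ` C (bar e))"
  using assms by (auto simp: chain_def of_bool_def split: if_splits)

text \<open>If the value of a reduced word lies in the base group, its chain vanishes, so the first edge is
  cancelled by a later one; the subword in between then has its value in the base group as well.\<close>

lemma sep_D:
  assumes l: "l \<noteq> []" "length l \<le> Suc m" "reduced l"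
  shows "word_val D s' \<iota>' l \<notin> \<iota>' ` carrier P0"
proof
  assume "word_val D s' \<iota>' l \<in> \<iota>' ` carrier P0"
  then have zero: "fst (word_val D s' \<iota>' l) z = 0" for z by (auto simp: \<iota>'_def)
  obtain e g l' where l': "l = (e, g) # l'" using l(1) by (cases l) auto
  have E: "e \<in> E" "g \<in> carrier P0" "set l' \<subseteq> E \<times> carrier P0" using l(3) l' by (auto simp: reduced_def)
  have se: "s e \<in> carrier P" using s_closed E by blast
  define v where "v = inv\<^bsub>P\<^esub> \<iota> g \<otimes>\<^bsub>P\<^esub> inv\<^bsub>P\<^esub> s e"
  have v: "v \<in> carrier P" using E se by (simp add: v_def)
  have "\<one>\<^bsub>P\<^esub> \<in> \<iota> ` C e" using \<iota>C[OF E(1)] subgroup.one_closed by blast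
  \<comment> \<open>Only one of the two indicators contributes, as \<open>bar e\<close> differs from
    \<open>e\<close>; the rest of the word has to contribute -1 at the same place.\<close>
  then have "chain e (\<one>\<^bsub>P\<^esub>, e) = 1"
    using E bar(2)[OF E(1)] p by (simp add: chain_def)
  then have "(1 + fst (word_val D s' \<iota>' l') (v, e)) mod int p = 0"
    using zero[of "(\<one>\<^bsub>P\<^esub>, e)"] fst_word_val_Cons[OF E(3,1,2) P.one_closed E(1)] E se by (simp add: l' v_def)
  then have "fst (word_val D s' \<iota>' l') (v, e) \<noteq> 0" using p by auto
  then obtain l1 e1 g1 l2 where l1: "l' = l1 @ (e1, g1) # l2"
    and ch: "chain e1 (inv\<^bsub>P\<^esub> word_val P s \<iota> l1 \<otimes>\<^bsub>P\<^esub> v, e) \<noteq> 0"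
    using fst_word_val_nonzero[OF E(3) v E(1)] by blast
  have e1: "e1 \<in> E" "set l1 \<subseteq> E \<times> carrier P0" using E(3) l1 by auto
  define w where "w = word_val P s \<iota> l1"
  have w: "w \<in> carrier P" using word_val_P e1 by (simp add: w_def)
  have red1: "reduced ((e, g) # l1)" "reduced l1"
    using reduced_subword[of "[]" "(e, g) # l1" "(e1, g1) # l2"] reduced_subword[of "[(e, g)]" l1 "(e1, g1) # l2"]
      l(3) by (simp_all add: l' l1)
  \<comment> \<open>The cancelling letter comes after this prefix, which is what brings the bound
    down from \<open>Suc m\<close> to \<open>m\<close>.\<close>
  have len: "length ((e, g) # l1) \<le> m" using l(2) by (simp add: l' l1)
  from chain_nonzero[OF ch] show False
  proof
    \<comment> \<open>Same orientation: the path has returned to the coset where it began, so the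
      prefix ending with \<open>l1\<close> takes its value in the base group.\<close>
    assume "e = e1 \<and> inv\<^bsub>P\<^esub> word_val P s \<iota> l1 \<otimes>\<^bsub>P\<^esub> v \<in> \<iota> ` C e1"
    then have "inv\<^bsub>P\<^esub> w \<otimes>\<^bsub>P\<^esub> v \<in> \<iota> ` carrier P0"
      using C_carrier[OF e1(1)] by (auto simp: w_def)
    moreover have "inv\<^bsub>P\<^esub> w \<otimes>\<^bsub>P\<^esub> v = inv\<^bsub>P\<^esub> word_val P s \<iota> ((e, g) # l1)"
      using w E se by (simp add: v_def P.inv_mult_group P.m_assoc flip: w_def)
    ultimately have "word_val P s \<iota> ((e, g) # l1) \<in> \<iota> ` carrier P0"
      using subgroup.m_inv_closed[OF \<iota>.img_is_subgroup] w E se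
      by (metis P.inv_inv P.m_closed \<iota>.hom_closed w_def word_val_simps(2))
    then show False using sep[OF _ len red1(1)] by simp
  next
    \<comment> \<open>Opposite orientation: the path runs back over its first edge, so
      \<open>l1\<close> itself takes its value in the base group; if \<open>l1\<close> is empty,
      this is a pinch in \<open>l\<close>.\<close>
    assume eb: "e = bar e1 \<and> inv\<^bsub>P\<^esub> s e1 \<otimes>\<^bsub>P\<^esub> (inv\<^bsub>P\<^esub> word_val P s \<iota> l1 \<otimes>\<^bsub>P\<^esub> v) \<in> \<iota> ` C (bar e1)"
    then have e1b: "e1 = bar e" using bar e1 by simp
    obtain c where c: "c \<in> C e" "inv\<^bsub>P\<^esub> s e1 \<otimes>\<^bsub>P\<^esub> (inv\<^bsub>P\<^esub> w \<otimes>\<^bsub>P\<^esub> v) = \<iota> c"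
      using eb by (auto simp: w_def)
    have cP: "c \<in> carrier P0" using C_carrier[OF E(1) c(1)] .
    have se1: "s e1 = inv\<^bsub>P\<^esub> s e" using s_bar E e1b by simp
    have "\<iota> g \<otimes>\<^bsub>P\<^esub> w = inv\<^bsub>P\<^esub> s e \<otimes>\<^bsub>P\<^esub> inv\<^bsub>P\<^esub> \<iota> c \<otimes>\<^bsub>P\<^esub> s e"
      unfolding c(2)[symmetric] using w E se by (simp add: v_def se1 P.inv_mult_group P.m_assoc P.l_cancel_one' P.inv_solve_left)
    also have "\<dots> = \<iota> (t e1 \<otimes>\<^bsub>P0\<^esub> inv\<^bsub>P0\<^esub> c \<otimes>\<^bsub>P0\<^esub> inv\<^bsub>P0\<^esub> t e1) \<otimes>\<^bsub>P\<^esub> inv\<^bsub>P\<^esub> s e \<otimes>\<^bsub>P\<^esub> s e"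
      using s_comm[OF e1(1), of "inv\<^bsub>P0\<^esub> c"] c(1) cP eb subgroup.m_inv_closed[OF C[OF E(1)]] by (simp add: se1)
    finally have gw: "\<iota> g \<otimes>\<^bsub>P\<^esub> w = \<iota> (t e1 \<otimes>\<^bsub>P0\<^esub> inv\<^bsub>P0\<^esub> c \<otimes>\<^bsub>P0\<^esub> inv\<^bsub>P0\<^esub> t e1) "
      using se t[OF e1(1)] cP by (simp add: P.m_assoc)
    define d where "d = t e1 \<otimes>\<^bsub>P0\<^esub> inv\<^bsub>P0\<^esub> c \<otimes>\<^bsub>P0\<^esub> inv\<^bsub>P0\<^esub> t e1"
    have d: "d \<in> C e1"
      unfolding d_def using tC[OF e1(1)] c(1) eb subgroup.m_inv_closed[OF C[OF E(1)]] by simp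
    have dP: "d \<in> carrier P0" using C_carrier[OF e1(1) d] .
    show False
    proof (cases "l1 = []")
      case True
      then have "\<iota> g = \<iota> d" using gw E by (simp add: w_def d_def)
      then have "g = d" using \<pi>\<iota> E dP by metis
      then show False using l(3) d True e1b by (simp add: l' l1 reduced_def)
    next
      case False
      have "w = \<iota> (inv\<^bsub>P0\<^esub> g \<otimes>\<^bsub>P0\<^esub> d)"
        using gw w E dP unfolding d_def[symmetric] by (simp add: P.inv_solve_left)
      then have "word_val P s \<iota> l1 \<in> \<iota> ` carrier P0"
        unfolding w_def using E dP by (metis P0.inv_closed P0.m_closed imageI)
      then show False using sep[OF False _ red1(2)] len by simp
    qed
  qed
qed

text \<open>An element over the identity of the base has its \<open>p ^ m\<close>-th power in
  \<open>M\<close>, a group of exponent \<open>p\<close>. So one step costs one more factor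
  \<open>p\<close> in the torsion bound and gains one more letter in the length bound.\<close>

lemma stage_D: "stage p (Suc m) D \<iota>' \<pi>' s'"
  unfolding stage_def
proof (intro conjI ballI allI impI)
  show "group D" "finite (carrier D)" by (rule group_D finite_D)+
  show "\<iota>' \<in> hom P0 D"
    by (rule homI) (auto simp: \<iota>'_def carrier_D zero_M mult_D)
  show "\<pi>' \<in> hom D P0"
    by (rule homI) (auto simp: \<pi>'_def carrier_D mult_D)
  show "\<pi>' (\<iota>' x) = x" if "x \<in> carrier P0" for x
    using that by (simp add: \<pi>'_def \<iota>'_def \<pi>\<iota>)
  fix e assume e: "e \<in> E"
  show "s' e \<in> carrier D" by (rule s'_closed[OF e])
  show "s' (bar e) = inv\<^bsub>D\<^esub> s' e"
    using s'_bar[OF e] s'_closed bar e by (metis D.inv_equality)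
  show "\<pi>' (s' e) = t e" using e by (simp add: \<pi>'_def s'_def \<pi>s)
  fix c assume c: "c \<in> C (bar e)"
  show "s' e \<otimes>\<^bsub>D\<^esub> \<iota>' c = \<iota>' (t e \<otimes>\<^bsub>P0\<^esub> c \<otimes>\<^bsub>P0\<^esub> inv\<^bsub>P0\<^esub> t e) \<otimes>\<^bsub>D\<^esub> s' e"
    using s_comm[OF e c] tC[OF e c] e by (simp add: s'_def \<iota>'_def mult_D M_range chain_M shift_chain)
next
  fix a assume a: "a \<in> carrier D" "\<pi>' a = \<one>\<^bsub>P0\<^esub>"
  have snd_pow: "snd (a [^]\<^bsub>D\<^esub> n) = snd a [^]\<^bsub>P\<^esub> n" for n :: nat
    by (induction n) (auto simp: one_D D_def split: prod.splits)
  have "snd a [^]\<^bsub>P\<^esub> (p ^ m) = \<one>\<^bsub>P\<^esub>"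
    using a tors by (auto simp: carrier_D \<pi>'_def)
  then obtain \<Psi> where \<Psi>: "a [^]\<^bsub>D\<^esub> (p ^ m) = (\<Psi>, \<one>\<^bsub>P\<^esub>)"
    using snd_pow by (metis prod.collapse)
  have \<Psi>M: "\<Psi> \<in> M" using D.nat_pow_closed[OF a(1), of "p ^ m"] by (simp add: \<Psi> carrier_D)
  have pow: "(\<Psi>, \<one>\<^bsub>P\<^esub>) [^]\<^bsub>D\<^esub> n = (\<lambda>z. int n * \<Psi> z mod int p, \<one>\<^bsub>P\<^esub>)" for n :: nat
    by (induction n) (auto simp: one_D mult_D shift_one[OF \<Psi>M] mod_simps algebra_simps)
  have "a [^]\<^bsub>D\<^esub> (p ^ Suc m) = (a [^]\<^bsub>D\<^esub> (p ^ m)) [^]\<^bsub>D\<^esub> p"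
    using a(1) by (simp add: D.nat_pow_pow mult.commute)
  also have "\<dots> = \<one>\<^bsub>D\<^esub>" unfolding \<Psi> pow by (simp add: one_D)
  finally show "a [^]\<^bsub>D\<^esub> (p ^ Suc m) = \<one>\<^bsub>D\<^esub>" .
next
  fix l assume "l \<noteq> []" "length l \<le> Suc m" "reduced l"
  then show "word_val D s' \<iota>' l \<notin> \<iota>' ` carrier P0" by (rule sep_D)
qed

end

theorem (in hnn_data) ex_stage:
  assumes "p > 1"
  shows "\<exists>(P :: nat monoid) \<iota> \<pi> s. stage p m P \<iota> \<pi> s"
proof (induction m)
  case 0
  obtain N :: "nat monoid" and h where "group N" "finite (carrier N)" "h \<in> iso P0 N"
    using finite_group_iso_nat[OF grp0 fin0] by blast
  then show ?case using stage_iso[OF stage_0] by blast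
next
  case (Suc m)
  then obtain P :: "nat monoid" and \<iota> \<pi> s where "stage p m P \<iota> \<pi> s" by blast
  then interpret hnn_step P0 E bar t C p m P \<iota> \<pi> s
    using assms by unfold_locales
  obtain N :: "nat monoid" and h where "group N" "finite (carrier N)" "h \<in> iso D N"
    using finite_group_iso_nat[OF group_D finite_D] by blast
  then show ?case using stage_iso[OF stage_D] by blast
qed

section \<open>Separation of free groups by finite p-groups\<close>

definition trivial_nat_group :: "nat monoid" where
  "trivial_nat_group = \<lparr>carrier = {0}, monoid.mult = (\<lambda>_ _. 0), one = 0\<rparr>"

lemma group_trivial_nat_group: "group trivial_nat_group"
  by (rule groupI) (auto simp: trivial_nat_group_def)

text \<open>A free group is a multiple HNN extension of the trivial group with the basis as stable
  letters, and reduced then means freely reduced. Over the trivial base every element of a stage is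
  in the kernel of \<open>\<pi>\<close>, so a stage is a p-group in which short reduced words
  survive.\<close>

lemma free_group_p_separated:
  fixes F :: "('a, 'm) monoid_scheme"
  assumes p: "Factorial_Ring.prime p" and F: "free_group_finite_rank F" and g: "g \<in> carrier F" "g \<noteq> \<one>\<^bsub>F\<^esub>"
  shows "\<exists>(U :: nat monoid) k \<mu>. group U \<and> finite (carrier U) \<and> card (carrier U) = p ^ k \<and>
           \<mu> \<in> hom F U \<and> \<mu> g \<noteq> \<one>\<^bsub>U\<^esub>"
proof -
  have grpF: "group F" using F by (simp add: free_group_finite_rank_def)
  obtain B where B: "finite B" "B \<subseteq> carrier F" "generate F B = carrier F"
    and free: "\<forall>w. w \<noteq> [] \<and> set (map fst w) \<subseteq> B \<and> freely_reduced w \<longrightarrow> eval_word F w \<noteq> \<one>\<^bsub>F\<^esub>"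
    using F unfolding free_group_finite_rank_def by blast
  let ?Z = trivial_nat_group
  interpret Z: group ?Z by (rule group_trivial_nat_group)
  have Z: "group ?Z" "carrier ?Z = {0}" "\<one>\<^bsub>?Z\<^esub> = 0"
    using Z.is_group by (simp_all add: trivial_nat_group_def)
  \<comment> \<open>Every basis element gives two mutually reverse edges, with trivial associated
    subgroups.\<close>
  interpret hnn_data ?Z "B \<times> UNIV" "\<lambda>(b, s). (b, \<not> s)" "\<lambda>_. 0" "\<lambda>_. {0}"
  proof -
    have "subgroup {0} ?Z" "inv\<^bsub>?Z\<^esub> 0 = 0" using Z.triv_subgroup Z.inv_one by (simp_all add: Z)
    then show "hnn_data ?Z (B \<times> UNIV) (\<lambda>(b, s). (b, \<not> s)) (\<lambda>_. 0) (\<lambda>_. {0})"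
      using B(1) Z.m_closed by unfold_locales (auto simp: Z)
  qed
  obtain w where w: "set (map fst w) \<subseteq> B" "freely_reduced w" "g = eval_word F w"
  proof (rule free_group_extend[OF grpF Z(1) B(2,3) free, of "\<lambda>_. 0"])
    show "(\<lambda>_. 0) \<in> B \<rightarrow> carrier ?Z" by (simp add: Z)
  qed (use g(1) that in blast)
  obtain P :: "nat monoid" and \<iota> \<pi> s where st: "stage p (length w) P \<iota> \<pi> s"
    using ex_stage[of p "length w"] prime_gt_1_nat[OF p] by blast
  then have P: "group P" "finite (carrier P)" and \<iota>: "\<iota> \<in> hom ?Z P" and \<pi>: "\<pi> \<in> hom P ?Z"
    and s: "\<And>e. e \<in> B \<times> UNIV \<Longrightarrow> s e \<in> carrier P"
    and s_bar: "\<And>b i. b \<in> B \<Longrightarrow> s (b, \<not> i) = inv\<^bsub>P\<^esub> s (b, i)"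
    and tors: "\<And>x. x \<in> carrier P \<Longrightarrow> \<pi> x = 0 \<Longrightarrow> x [^]\<^bsub>P\<^esub> (p ^ length w) = \<one>\<^bsub>P\<^esub>"
    and sep: "\<And>l. l \<noteq> [] \<Longrightarrow> length l \<le> length w \<Longrightarrow> reduced l \<Longrightarrow> word_val P s \<iota> l \<notin> \<iota> ` carrier ?Z"
    by (auto simp: stage_def Z)
  have s_inv: "s (b, False) = inv\<^bsub>P\<^esub> s (b, True)" if "b \<in> B" for b
    using s_bar[OF that, of True] by simp
  interpret P: group P by (rule P(1))
  have \<iota>0: "\<iota> 0 = \<one>\<^bsub>P\<^esub>" using hom_one[OF \<iota> Z(1) P(1)] by (simp add: Z)
  have "\<pi> x = 0" if "x \<in> carrier P" for x using \<pi> that by (auto simp: hom_def Z)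
  then obtain k where k: "card (carrier P) = p ^ k"
    using p_torsion_imp_p_group[OF p P] tors by blast
  have u: "(\<lambda>b. s (b, True)) \<in> B \<rightarrow> carrier P" using s by auto
  obtain h where h: "h \<in> hom F P" "\<forall>x\<in>B. h x = s (x, True)"
    by (rule free_group_extend[OF grpF P(1) B(2,3) free u])
  have "h g = eval_word P (map (\<lambda>(x, b). (h x, b)) w)"
    unfolding w(3) using w(1) B(2) h(1) grpF P(1)
    by (intro hom_eval_word) (auto simp: group_hom_def group_hom_axioms_def)
  also have "\<dots> = word_val P s \<iota> (map (\<lambda>a. (a, 0)) w)"
    using w(1)
  proof (induction w)
    case (Cons a w)
    have "eval_word P (map (\<lambda>(x, b). (h x, b)) w) \<in> carrier P"
      using Cons.prems h(2) s by (intro eval_word_closed[OF P(1)]) auto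
    then show ?case using Cons h(2) s_inv \<iota>0 by (cases a) (auto simp: eval_word_Cons)
  qed simp
  finally have hg: "h g = word_val P s \<iota> (map (\<lambda>a. (a, 0)) w)" .
  have "w \<noteq> []" using w(3) g(2) by auto
  moreover have "reduced (map (\<lambda>a. (a, 0)) w)"
    using w(1,2) by (auto simp: reduced_def freely_reduced_def successively_map Z elim!: successively_mono)
  ultimately have "h g \<notin> \<iota> ` carrier ?Z" using sep hg by simp
  then have "h g \<noteq> \<one>\<^bsub>P\<^esub>" using \<iota>0 by (auto simp: Z)
  then show ?thesis using P k h(1) by blast
qed

text \<open>Direct products of the groups for the single elements. One \<open>U\<close> has to serve
  the whole list, while the homomorphism may vary with the element.\<close>

lemma p_separated_list:
  fixes Gv :: "'v \<Rightarrow> ('a, 'm) monoid_scheme"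
  assumes p: "Factorial_Ring.prime p"
    and xs: "\<And>v x. (v, x) \<in> set xs \<Longrightarrow> free_group_finite_rank (Gv v) \<and> x \<in> carrier (Gv v) \<and> x \<noteq> \<one>\<^bsub>Gv v\<^esub>"
  shows "\<exists>(U :: nat monoid) k. group U \<and> finite (carrier U) \<and> card (carrier U) = p ^ k \<and>
           (\<forall>(v, x) \<in> set xs. \<exists>\<mu> \<in> hom (Gv v) U. \<mu> x \<noteq> \<one>\<^bsub>U\<^esub>)"
  using xs
proof (induction xs)
  case Nil
  have "group trivial_nat_group \<and> finite (carrier trivial_nat_group) \<and> card (carrier trivial_nat_group) = p ^ 0"
    using group_trivial_nat_group by (simp add: trivial_nat_group_def)
  then show ?case by (intro exI[of _ trivial_nat_group] exI[of _ 0]) simp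
next
  case (Cons a xs)
  obtain v x where a: "a = (v, x)" by (cases a)
  obtain U1 :: "nat monoid" and k1 where U1: "group U1" "finite (carrier U1)" "card (carrier U1) = p ^ k1"
    and sep1: "\<And>v x. (v, x) \<in> set xs \<Longrightarrow> \<exists>\<mu> \<in> hom (Gv v) U1. \<mu> x \<noteq> \<one>\<^bsub>U1\<^esub>"
    using Cons.IH Cons.prems by fastforce
  obtain U2 :: "nat monoid" and k2 \<mu>2 where U2: "group U2" "finite (carrier U2)" "card (carrier U2) = p ^ k2"
    and \<mu>2: "\<mu>2 \<in> hom (Gv v) U2" "\<mu>2 x \<noteq> \<one>\<^bsub>U2\<^esub>"
    using free_group_p_separated[OF p, of "Gv v" x] Cons.prems[of v x] a by auto
  have "group (U1 \<times>\<times> U2)" "finite (carrier (U1 \<times>\<times> U2))"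
    using U1 U2 DirProd_group by auto
  then obtain U :: "nat monoid" and h where U: "group U" "finite (carrier U)" and h: "h \<in> iso (U1 \<times>\<times> U2) U"
    using finite_group_iso_nat by blast
  have "card (carrier U) = card (carrier (U1 \<times>\<times> U2))"
    using bij_betw_same_card[of h "carrier (U1 \<times>\<times> U2)" "carrier U"] h by (simp add: iso_def)
  then have card: "card (carrier U) = p ^ (k1 + k2)"
    using U1 U2 by (simp add: card_cartesian_product power_add)
  have hh: "h \<in> hom (U1 \<times>\<times> U2) U" using h by (simp add: iso_def)
  interpret h: group_hom "U1 \<times>\<times> U2" U h
    using hh U(1) U1 U2 DirProd_group by (auto simp: group_hom_def group_hom_axioms_def)
  have h1: "u = \<one>\<^bsub>U1\<^esub> \<and> u' = \<one>\<^bsub>U2\<^esub>" if "h (u, u') = \<one>\<^bsub>U\<^esub>" "u \<in> carrier U1" "u' \<in> carrier U2" for u u'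
    using h that h.inj_on_one_iff by (auto simp: iso_def bij_betw_def)
  have grpv: "group (Gv w)" if "(w, y) \<in> set (a # xs)" for w y
    using Cons.prems[OF that] by (simp add: free_group_finite_rank_def)
  have "\<exists>\<mu> \<in> hom (Gv w) U. \<mu> y \<noteq> \<one>\<^bsub>U\<^esub>" if wy: "(w, y) \<in> set (a # xs)" for w y
  proof -
    have "\<exists>\<mu>1 \<mu>2. \<mu>1 \<in> hom (Gv w) U1 \<and> \<mu>2 \<in> hom (Gv w) U2 \<and> (\<mu>1 y \<noteq> \<one>\<^bsub>U1\<^esub> \<or> \<mu>2 y \<noteq> \<one>\<^bsub>U2\<^esub>)"
    proof (cases "(w, y) = (v, x)")
      case True
      have "(\<lambda>_. \<one>\<^bsub>U1\<^esub>) \<in> hom (Gv w) U1"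
        using U1 by (auto simp: hom_def group.is_monoid)
      then show ?thesis using True \<mu>2 by blast
    next
      case False
      have "(\<lambda>_. \<one>\<^bsub>U2\<^esub>) \<in> hom (Gv w) U2"
        using U2 by (auto simp: hom_def group.is_monoid)
      then show ?thesis using False sep1[of w y] wy a by auto
    qed
    then obtain \<mu>1 \<mu>2 where \<mu>: "\<mu>1 \<in> hom (Gv w) U1" "\<mu>2 \<in> hom (Gv w) U2" "\<mu>1 y \<noteq> \<one>\<^bsub>U1\<^esub> \<or> \<mu>2 y \<noteq> \<one>\<^bsub>U2\<^esub>"
      by blast
    have yc: "y \<in> carrier (Gv w)" using Cons.prems[OF wy] by blast
    have "h \<circ> (\<lambda>z. (\<mu>1 z, \<mu>2 z)) \<in> hom (Gv w) U"
      using \<mu> by (intro hom_compose[OF _ hh]) (auto simp: hom_def)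
    moreover have "(h \<circ> (\<lambda>z. (\<mu>1 z, \<mu>2 z))) y \<noteq> \<one>\<^bsub>U\<^esub>"
      using \<mu> h1[of "\<mu>1 y" "\<mu>2 y"] yc by (auto simp: hom_def)
    ultimately show ?thesis by blast
  qed
  then show ?case using U card by blast
qed

section \<open>Symmetries of the homomorphism sets\<close>

locale clean_gog =
  fixes V :: "'v set" and E :: "'e set" and bar :: "'e \<Rightarrow> 'e" and tau :: "'e \<Rightarrow> 'v"
    and Gv :: "'v \<Rightarrow> 'a monoid" and Ge :: "'e \<Rightarrow> 'b monoid" and f :: "'e \<Rightarrow> 'b \<Rightarrow> 'a"
  assumes clean: "algebraically_clean V E bar tau Gv Ge f"
begin

lemma finV: "finite V" and finE: "finite E"
  and bar: "e \<in> E \<Longrightarrow> bar e \<in> E" "e \<in> E \<Longrightarrow> bar e \<noteq> e" "e \<in> E \<Longrightarrow> bar (bar e) = e"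
  and tau: "e \<in> E \<Longrightarrow> tau e \<in> V"
  and grpv: "v \<in> V \<Longrightarrow> group (Gv v)" and grpe: "e \<in> E \<Longrightarrow> group (Ge e)"
  and Ge_bar: "e \<in> E \<Longrightarrow> Ge (bar e) = Ge e"
  and f_hom: "e \<in> E \<Longrightarrow> f e \<in> hom (Ge e) (Gv (tau e))"
  and f_inj: "e \<in> E \<Longrightarrow> inj_on (f e) (carrier (Ge e))"
  and free_v: "v \<in> V \<Longrightarrow> free_group_finite_rank (Gv v)"
  and factor: "e \<in> E \<Longrightarrow> free_factor (Gv (tau e)) (f e ` carrier (Ge e))"
  using clean by (auto simp: algebraically_clean_def graph_of_groups_def)

abbreviation A :: "'e \<Rightarrow> 'a set" where
  "A e \<equiv> f e ` carrier (Ge e)"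

text \<open>The permutation of an edge depends on the complement, so the choice must be the same for
  all \<open>U\<close> if the permutations are to be natural in \<open>U\<close>.\<close>

definition K :: "'e \<Rightarrow> 'a set" where
  "K e = (SOME K. free_complement (Gv (tau e)) (A e) K)"

lemma K: "e \<in> E \<Longrightarrow> free_complement (Gv (tau e)) (A e) (K e)"
  unfolding K_def using factor by (metis free_factor_iff someI_ex)

lemma subgroup_A: "e \<in> E \<Longrightarrow> subgroup (A e) (Gv (tau e))"
  and subgroup_K: "e \<in> E \<Longrightarrow> subgroup (K e) (Gv (tau e))"
  and generate_AK: "e \<in> E \<Longrightarrow> generate (Gv (tau e)) (A e \<union> K e) = carrier (Gv (tau e))"
  using K by (auto simp: free_complement_def)

lemma f_closed: "e \<in> E \<Longrightarrow> a \<in> carrier (Ge e) \<Longrightarrow> f e a \<in> carrier (Gv (tau e))"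
  using f_hom by (auto simp: hom_def)

lemma f_bar_closed: "e \<in> E \<Longrightarrow> a \<in> carrier (Ge e) \<Longrightarrow> f (bar e) a \<in> carrier (Gv (tau (bar e)))"
  using f_closed[of "bar e"] bar Ge_bar by simp

lemma K_closed: "e \<in> E \<Longrightarrow> k \<in> K e \<Longrightarrow> k \<in> carrier (Gv (tau e))"
  using subgroup_K subgroup.mem_carrier by metis

text \<open>Extensionality makes a homomorphism determined by its values on the vertex group;
  finiteness of \<open>Omega\<close> and uniqueness of the edge permutation rest on this.\<close>

definition homs :: "('c, 'm) monoid_scheme \<Rightarrow> 'v \<Rightarrow> ('a \<Rightarrow> 'c) set" where
  "homs U v = hom (Gv v) U \<inter> extensional (carrier (Gv v))"

text \<open>Two homomorphisms for each vertex group: doubling makes every edge isomorphism extend to a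
  symmetry, because the complements of the two copies involved become isomorphic.\<close>

definition Omega :: "('c, 'm) monoid_scheme \<Rightarrow> ('v \<times> bool \<Rightarrow> 'a \<Rightarrow> 'c) set" where
  "Omega U = PiE (V \<times> UNIV) (\<lambda>z. homs U (fst z))"

text \<open>First exchange the two copies of every vertex group, then exchange the subgroup A e of the first
  copy at tau e with the subgroup A (bar e) of the second copy at tau (bar e).\<close>

definition swapped :: "'e \<Rightarrow> ('v \<times> bool \<Rightarrow> 'a \<Rightarrow> 'c) \<Rightarrow> ('v \<times> bool \<Rightarrow> 'a \<Rightarrow> 'c) \<Rightarrow> bool" where
  "swapped e \<rho> \<sigma> \<longleftrightarrow>
     (\<forall>a\<in>carrier (Ge e). \<sigma> (tau e, False) (f e a) = \<rho> (tau (bar e), False) (f (bar e) a)) \<and>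
     (\<forall>k\<in>K e. \<sigma> (tau e, False) k = \<rho> (tau e, True) k) \<and>
     (\<forall>a\<in>carrier (Ge e). \<sigma> (tau (bar e), True) (f (bar e) a) = \<rho> (tau e, True) (f e a)) \<and>
     (\<forall>k\<in>K (bar e). \<sigma> (tau (bar e), True) k = \<rho> (tau (bar e), False) k) \<and>
     (\<forall>x\<in>V. \<forall>i. (x, i) \<noteq> (tau e, False) \<and> (x, i) \<noteq> (tau (bar e), True) \<longrightarrow> \<sigma> (x, i) = \<rho> (x, \<not> i))"

text \<open>The condition is symmetric under exchanging the two families together with
  \<open>e\<close> and \<open>bar e\<close>; hence the permutation of \<open>bar e\<close> will undo
  that of \<open>e\<close>.\<close>

lemma swapped_sym:
  assumes "e \<in> E" "swapped e \<rho> \<sigma>"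
  shows "swapped (bar e) \<sigma> \<rho>"
  using assms(2) bar(3)[OF assms(1)] Ge_bar[OF assms(1)] unfolding swapped_def by simp

lemma finite_homs:
  assumes "v \<in> V" "group U" "finite (carrier U)"
  shows "finite (homs U v)"
proof -
  obtain B where B: "finite B" "B \<subseteq> carrier (Gv v)" "generate (Gv v) B = carrier (Gv v)"
    using free_v[OF assms(1)] unfolding free_group_finite_rank_def by blast
  have "inj_on (\<lambda>h. restrict h B) (homs U v)"
  proof (rule inj_onI)
    fix h h' assume h: "h \<in> homs U v" "h' \<in> homs U v" "restrict h B = restrict h' B"
    have "h x = h' x" if "x \<in> carrier (Gv v)" for x
      using hom_eq_on_generate[OF grpv[OF assms(1)] assms(2) _ _ B(2), of h h' x] h B(3) that
      by (auto simp: homs_def) (metis restrict_apply')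
    then show "h = h'" using h by (auto simp: homs_def intro: extensionalityI)
  qed
  moreover have "(\<lambda>h. restrict h B) ` homs U v \<subseteq> B \<rightarrow>\<^sub>E carrier U"
    using B(2) by (auto simp: homs_def hom_def)
  moreover have "finite (B \<rightarrow>\<^sub>E carrier U)" using B(1) assms(3) by (intro finite_PiE) auto
  ultimately show ?thesis by (meson finite_imageD finite_subset)
qed

lemma finite_Omega: "group U \<Longrightarrow> finite (carrier U) \<Longrightarrow> finite (Omega U)"
  unfolding Omega_def using finV finite_homs by (intro finite_PiE) auto

lemma Omega_hom: "\<rho> \<in> Omega U \<Longrightarrow> v \<in> V \<Longrightarrow> \<rho> (v, i) \<in> hom (Gv v) U"
  and Omega_ext: "\<rho> \<in> Omega U \<Longrightarrow> v \<in> V \<Longrightarrow> \<rho> (v, i) \<in> extensional (carrier (Gv v))"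
  by (force simp: Omega_def homs_def PiE_iff)+

lemma Omega_closed: "\<rho> \<in> Omega U \<Longrightarrow> v \<in> V \<Longrightarrow> g \<in> carrier (Gv v) \<Longrightarrow> \<rho> (v, i) g \<in> carrier U"
  using Omega_hom by (fastforce simp: hom_def)

lemma Omega_mult: "\<rho> \<in> Omega U \<Longrightarrow> v \<in> V \<Longrightarrow> g \<in> carrier (Gv v) \<Longrightarrow> h \<in> carrier (Gv v) \<Longrightarrow>
    \<rho> (v, i) (g \<otimes>\<^bsub>Gv v\<^esub> h) = \<rho> (v, i) g \<otimes>\<^bsub>U\<^esub> \<rho> (v, i) h"
  using Omega_hom by (fastforce simp: hom_def)

lemma Omega_eqI:
  assumes "\<rho> \<in> Omega U" "\<sigma> \<in> Omega U'" "\<And>v i g. v \<in> V \<Longrightarrow> g \<in> carrier (Gv v) \<Longrightarrow> \<rho> (v, i) g = \<sigma> (v, i) g"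
  shows "\<rho> = \<sigma>"
proof (rule PiE_ext[where k = "V \<times> UNIV" and s = "\<lambda>_. UNIV"])
  show "\<rho> \<in> (V \<times> UNIV) \<rightarrow>\<^sub>E UNIV" "\<sigma> \<in> (V \<times> UNIV) \<rightarrow>\<^sub>E UNIV"
    using assms(1,2) by (auto simp: Omega_def PiE_iff)
  show "\<rho> z = \<sigma> z" if "z \<in> V \<times> UNIV" for z
  proof -
    obtain v i where z: "z = (v, i)" "v \<in> V" using \<open>z \<in> V \<times> UNIV\<close> by (cases z) auto
    show ?thesis
      unfolding z(1)
      by (rule extensionalityI[OF Omega_ext[OF assms(1) z(2)] Omega_ext[OF assms(2) z(2)]]) (rule assms(3)[OF z(2)])
  qed
qed

lemma Omega_I:
  assumes "\<And>v i. v \<in> V \<Longrightarrow> h v i \<in> hom (Gv v) U"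
  shows "(\<lambda>z\<in>V \<times> UNIV. \<lambda>g\<in>carrier (Gv (fst z)). h (fst z) (snd z) g) \<in> Omega U"
proof -
  have "(\<lambda>g\<in>carrier (Gv v). h v i g) \<in> hom (Gv v) U" if "v \<in> V" for v i
    using assms[OF that] grpv[OF that]
    by (auto simp: hom_def restrict_def group.is_monoid monoid.m_closed Pi_iff)
  then show ?thesis by (auto simp: Omega_def homs_def)
qed

text \<open>The clauses of \<open>swapped\<close> prescribe the two changed homomorphisms on a free
  factor and on its complement, which generate the vertex group; the other coordinates are
  prescribed outright.\<close>

lemma swapped_unique:
  assumes U: "group U" and e: "e \<in> E" and \<sigma>: "\<sigma> \<in> Omega U" "\<sigma>' \<in> Omega U"
    and sw: "swapped e \<rho> \<sigma>" "swapped e \<rho> \<sigma>'"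
  shows "\<sigma> = \<sigma>'"
proof (rule Omega_eqI[OF \<sigma>])
  have eb: "bar e \<in> E" using bar e by blast
  have gen: "\<sigma> (tau e', i) g = \<sigma>' (tau e', i) g"
    if "e' \<in> E" "g \<in> carrier (Gv (tau e'))" "\<And>x. x \<in> A e' \<union> K e' \<Longrightarrow> \<sigma> (tau e', i) x = \<sigma>' (tau e', i) x" for e' i g
  proof (rule hom_eq_on_generate[OF grpv[OF tau[OF that(1)]] U, where S = "A e' \<union> K e'"])
    show "A e' \<union> K e' \<subseteq> carrier (Gv (tau e'))" using f_closed K_closed that(1) by auto
    show "\<sigma> (tau e', i) \<in> hom (Gv (tau e')) U" "\<sigma>' (tau e', i) \<in> hom (Gv (tau e')) U"
      using \<sigma> tau[OF that(1)] by (simp_all add: Omega_hom)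
  qed (use that generate_AK in auto)
  fix v i g assume v: "v \<in> V" "g \<in> carrier (Gv v)"
  consider "(v, i) = (tau e, False)" | "(v, i) = (tau (bar e), True)"
    | "(v, i) \<noteq> (tau e, False)" "(v, i) \<noteq> (tau (bar e), True)" by blast
  then show "\<sigma> (v, i) g = \<sigma>' (v, i) g"
  proof cases
    case 1
    moreover have "\<sigma> (tau e, False) x = \<sigma>' (tau e, False) x" if "x \<in> A e \<union> K e" for x
      using that sw by (auto simp: swapped_def)
    ultimately show ?thesis using gen[OF e, of g False] v by simp
  next
    case 2
    moreover have "\<sigma> (tau (bar e), True) x = \<sigma>' (tau (bar e), True) x" if "x \<in> A (bar e) \<union> K (bar e)" for x
      using that sw Ge_bar[OF e] by (auto simp: swapped_def)
    ultimately show ?thesis using gen[OF eb, of g True] v by simp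
  next
    case 3
    then show ?thesis using sw v unfolding swapped_def by metis
  qed
qed

text \<open>This is where cleanness enters: \<open>\<alpha>\<close> is carried through the edge
  group to \<open>A e\<close>, and a free product accepts any pair of homomorphisms on its two
  factors.\<close>

lemma glue_exists:
  assumes U: "group U" and e: "e \<in> E" and \<alpha>: "\<alpha> \<in> hom (Gv (tau (bar e))) U" and \<beta>: "\<beta> \<in> hom (Gv (tau e)) U"
  shows "\<exists>h\<in>hom (Gv (tau e)) U. (\<forall>a\<in>carrier (Ge e). h (f e a) = \<alpha> (f (bar e) a)) \<and> (\<forall>k\<in>K e. h k = \<beta> k)"
proof -
  have inv: "inv_into (carrier (Ge e)) (f e) (f e a) = a" if "a \<in> carrier (Ge e)" for a
    using f_inj[OF e] that by simp
  have fb: "f (bar e) \<in> hom (Ge e) (Gv (tau (bar e)))"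
    using f_hom[OF bar(1)[OF e]] Ge_bar[OF e] by simp
  have mc: "a \<otimes>\<^bsub>Ge e\<^esub> b \<in> carrier (Ge e)" if "a \<in> carrier (Ge e)" "b \<in> carrier (Ge e)" for a b
    using that grpe[OF e] by (simp add: group.is_monoid monoid.m_closed)
  have inv_m: "inv_into (carrier (Ge e)) (f e) (f e a \<otimes>\<^bsub>Gv (tau e)\<^esub> f e b) = a \<otimes>\<^bsub>Ge e\<^esub> b"
    if "a \<in> carrier (Ge e)" "b \<in> carrier (Ge e)" for a b
    using inv[OF mc[OF that]] hom_mult[OF f_hom[OF e] that] by simp
  have \<alpha>': "(\<lambda>x. \<alpha> (f (bar e) (inv_into (carrier (Ge e)) (f e) x))) \<in> hom (Gv (tau e)\<lparr>carrier := A e\<rparr>) U"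
    using \<alpha> fb by (auto simp: hom_def inv inv_m Pi_iff)
  have \<beta>': "\<beta> \<in> hom (Gv (tau e)\<lparr>carrier := K e\<rparr>) U"
    using \<beta> K_closed[OF e] by (auto simp: hom_def Pi_iff)
  obtain h where h: "h \<in> hom (Gv (tau e)) U" "\<forall>x\<in>A e. h x = \<alpha> (f (bar e) (inv_into (carrier (Ge e)) (f e) x))"
    "\<forall>x\<in>K e. h x = \<beta> x"
    by (rule free_product_extend[OF grpv[OF tau[OF e]] U K[OF e] \<alpha>' \<beta>'])
  show ?thesis
    using h inv by (intro bexI[of _ h]) simp_all
qed

lemma swapped_exists:
  assumes U: "group U" and e: "e \<in> E" and \<rho>: "\<rho> \<in> Omega U"
  shows "\<exists>\<sigma>\<in>Omega U. swapped e \<rho> \<sigma>"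
proof -
  have eb: "bar e \<in> E" using bar e by blast
  have te: "tau e \<in> V" "tau (bar e) \<in> V" using tau e eb by auto
  obtain h1 where h1: "h1 \<in> hom (Gv (tau e)) U"
    "\<And>a. a \<in> carrier (Ge e) \<Longrightarrow> h1 (f e a) = \<rho> (tau (bar e), False) (f (bar e) a)"
    "\<And>k. k \<in> K e \<Longrightarrow> h1 k = \<rho> (tau e, True) k"
    using glue_exists[OF U e Omega_hom[OF \<rho> te(2), of False] Omega_hom[OF \<rho> te(1), of True]] by blast
  have "\<rho> (tau (bar (bar e)), True) \<in> hom (Gv (tau (bar (bar e)))) U"
    using Omega_hom[OF \<rho> te(1)] bar(3)[OF e] by simp
  then have "\<exists>h\<in>hom (Gv (tau (bar e))) U. (\<forall>a\<in>carrier (Ge e). h (f (bar e) a) = \<rho> (tau e, True) (f e a)) \<and>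
      (\<forall>k\<in>K (bar e). h k = \<rho> (tau (bar e), False) k)"
    using glue_exists[OF U eb _ Omega_hom[OF \<rho> te(2), of False], of "\<rho> (tau e, True)"] bar(3)[OF e] Ge_bar[OF e] by simp
  then obtain h2 where h2: "h2 \<in> hom (Gv (tau (bar e))) U"
    "\<And>a. a \<in> carrier (Ge e) \<Longrightarrow> h2 (f (bar e) a) = \<rho> (tau e, True) (f e a)"
    "\<And>k. k \<in> K (bar e) \<Longrightarrow> h2 k = \<rho> (tau (bar e), False) k"
    by blast
  define h where "h x i = (if (x, i) = (tau e, False) then h1 else
    if (x, i) = (tau (bar e), True) then h2 else \<rho> (x, \<not> i))" for x i
  define \<sigma> where "\<sigma> = (\<lambda>z\<in>V \<times> UNIV. \<lambda>g\<in>carrier (Gv (fst z)). h (fst z) (snd z) g)"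
  have "\<sigma> \<in> Omega U"
    unfolding \<sigma>_def by (rule Omega_I) (auto simp: h_def h1 h2 Omega_hom[OF \<rho>])
  moreover have "\<sigma> (x, i) = \<rho> (x, \<not> i)"
    if "x \<in> V" "(x, i) \<noteq> (tau e, False)" "(x, i) \<noteq> (tau (bar e), True)" for x i
    using that Omega_ext[OF \<rho> that(1)] by (auto simp: \<sigma>_def h_def extensional_restrict)
  then have "swapped e \<rho> \<sigma>"
    unfolding swapped_def using te f_closed[OF e] f_bar_closed[OF e] K_closed[OF e] K_closed[OF eb]
    by (auto simp: \<sigma>_def h_def h1 h2)
  ultimately show ?thesis by blast
qed

section \<open>The edge permutations of Omega and their naturality\<close>

definition act :: "('c, 'm) monoid_scheme \<Rightarrow> 'e \<Rightarrow> ('v \<times> bool \<Rightarrow> 'a \<Rightarrow> 'c) \<Rightarrow> 'v \<times> bool \<Rightarrow> 'a \<Rightarrow> 'c" where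
  "act U e \<rho> = (THE \<sigma>. \<sigma> \<in> Omega U \<and> swapped e \<rho> \<sigma>)"

lemma act_eqI: "group U \<Longrightarrow> e \<in> E \<Longrightarrow> \<sigma> \<in> Omega U \<Longrightarrow> swapped e \<rho> \<sigma> \<Longrightarrow> act U e \<rho> = \<sigma>"
  unfolding act_def using swapped_unique by blast

lemma act_closed: "group U \<Longrightarrow> e \<in> E \<Longrightarrow> \<rho> \<in> Omega U \<Longrightarrow> act U e \<rho> \<in> Omega U"
  and swapped_act: "group U \<Longrightarrow> e \<in> E \<Longrightarrow> \<rho> \<in> Omega U \<Longrightarrow> swapped e \<rho> (act U e \<rho>)"
  using swapped_exists act_eqI by (metis, metis)

lemma act_bar_act: "group U \<Longrightarrow> e \<in> E \<Longrightarrow> \<rho> \<in> Omega U \<Longrightarrow> act U (bar e) (act U e \<rho>) = \<rho>"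
  using act_eqI swapped_sym swapped_act bar(1) by metis

definition push :: "('c \<Rightarrow> 'd) \<Rightarrow> ('v \<times> bool \<Rightarrow> 'a \<Rightarrow> 'c) \<Rightarrow> 'v \<times> bool \<Rightarrow> 'a \<Rightarrow> 'd" where
  "push q \<rho> = (\<lambda>z\<in>V \<times> UNIV. \<lambda>g\<in>carrier (Gv (fst z)). q (\<rho> z g))"

definition pmul :: "('c, 'm) monoid_scheme \<Rightarrow> ('v \<times> bool \<Rightarrow> 'a \<Rightarrow> 'c) \<Rightarrow> ('v \<times> bool \<Rightarrow> 'a \<Rightarrow> 'c) \<Rightarrow> 'v \<times> bool \<Rightarrow> 'a \<Rightarrow> 'c" where
  "pmul U \<rho> \<zeta> = (\<lambda>z\<in>V \<times> UNIV. \<lambda>g\<in>carrier (Gv (fst z)). \<rho> z g \<otimes>\<^bsub>U\<^esub> \<zeta> z g)"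

lemma push_apply: "v \<in> V \<Longrightarrow> g \<in> carrier (Gv v) \<Longrightarrow> push q \<rho> (v, i) g = q (\<rho> (v, i) g)"
  and pmul_apply: "v \<in> V \<Longrightarrow> g \<in> carrier (Gv v) \<Longrightarrow> pmul U \<rho> \<zeta> (v, i) g = \<rho> (v, i) g \<otimes>\<^bsub>U\<^esub> \<zeta> (v, i) g"
  by (simp_all add: push_def pmul_def)

lemma push_closed:
  assumes "q \<in> hom U U'" "\<rho> \<in> Omega U"
  shows "push q \<rho> \<in> Omega U'"
proof -
  have "(\<lambda>g. q (\<rho> (v, i) g)) \<in> hom (Gv v) U'" if "v \<in> V" for v i
    using hom_compose[OF Omega_hom[OF assms(2) that] assms(1)] by (simp add: comp_def)
  then show ?thesis unfolding push_def using Omega_I[of "\<lambda>v i g. q (\<rho> (v, i) g)" U'] by (simp add: case_prod_unfold cong: restrict_cong)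
qed

text \<open>Every clause of \<open>swapped\<close> equates a value of one family with a value of the
  other, so it survives applying any map to the values.\<close>

lemma swapped_push:
  assumes e: "e \<in> E" and sw: "swapped e \<rho> \<sigma>"
  shows "swapped e (push q \<rho>) (push q \<sigma>)"
proof -
  have eb: "bar e \<in> E" using bar e by blast
  have "push q \<sigma> (x, i) = push q \<rho> (x, \<not> i)"
    if "x \<in> V" "(x, i) \<noteq> (tau e, False)" "(x, i) \<noteq> (tau (bar e), True)" for x i
  proof -
    have "\<sigma> (x, i) = \<rho> (x, \<not> i)" using that sw unfolding swapped_def by blast
    then show ?thesis using that(1) by (simp add: push_def)
  qed
  then show ?thesis
    using sw tau[OF e] tau[OF eb] f_closed[OF e] f_bar_closed[OF e] K_closed[OF e] K_closed[OF eb]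
    unfolding swapped_def by (auto simp: push_apply)
qed

lemma swapped_pmul:
  assumes e: "e \<in> E" and sw: "swapped e \<rho> \<sigma>" "swapped e \<zeta> \<eta>"
  shows "swapped e (pmul U \<rho> \<zeta>) (pmul U \<sigma> \<eta>)"
proof -
  have eb: "bar e \<in> E" using bar e by blast
  have "pmul U \<sigma> \<eta> (x, i) = pmul U \<rho> \<zeta> (x, \<not> i)"
    if "x \<in> V" "(x, i) \<noteq> (tau e, False)" "(x, i) \<noteq> (tau (bar e), True)" for x i
  proof -
    have "\<sigma> (x, i) = \<rho> (x, \<not> i)" "\<eta> (x, i) = \<zeta> (x, \<not> i)" using that sw unfolding swapped_def by blast+
    then show ?thesis using that(1) by (simp add: pmul_def)
  qed
  then show ?thesis
    using sw tau[OF e] tau[OF eb] f_closed[OF e] f_bar_closed[OF e] K_closed[OF e] K_closed[OF eb]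
    unfolding swapped_def by (auto simp: pmul_apply)
qed

lemma act_push:
  assumes "group U" "group U'" "e \<in> E" "q \<in> hom U U'" "\<rho> \<in> Omega U"
  shows "act U' e (push q \<rho>) = push q (act U e \<rho>)"
  by (rule act_eqI[OF assms(2,3) push_closed[OF assms(4) act_closed[OF assms(1,3,5)]]
      swapped_push[OF assms(3) swapped_act[OF assms(1,3,5)]]])

definition central_hom :: "('d, 'n) monoid_scheme \<Rightarrow> ('c, 'm) monoid_scheme \<Rightarrow> ('d \<Rightarrow> 'c) \<Rightarrow> bool" where
  "central_hom Z U c \<longleftrightarrow> c \<in> hom Z U \<and> (\<forall>z\<in>carrier Z. \<forall>x\<in>carrier U. x \<otimes>\<^bsub>U\<^esub> c z = c z \<otimes>\<^bsub>U\<^esub> x)"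

text \<open>A pointwise product of homomorphisms is again a homomorphism once one factor takes
  central values; this is why the induction over p-groups uses central extensions.\<close>

lemma pmul_closed:
  assumes U: "group U" and c: "central_hom Z U c" and \<rho>: "\<rho> \<in> Omega U" and \<zeta>: "\<zeta> \<in> Omega Z"
  shows "pmul U \<rho> (push c \<zeta>) \<in> Omega U"
proof -
  interpret U: group U by fact
  have chom: "c \<in> hom Z U" using c by (simp add: central_hom_def)
  have cc: "c z \<in> carrier U" if "z \<in> carrier Z" for z using chom that by (auto simp: hom_def)
  have "(\<lambda>g. \<rho> (v, i) g \<otimes>\<^bsub>U\<^esub> c (\<zeta> (v, i) g)) \<in> hom (Gv v) U" if v: "v \<in> V" for v i
  proof (rule homI)
    fix g h assume g: "g \<in> carrier (Gv v)" and h: "h \<in> carrier (Gv v)"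
    note cl = Omega_closed[OF \<rho> v g] Omega_closed[OF \<rho> v h] cc[OF Omega_closed[OF \<zeta> v g]] cc[OF Omega_closed[OF \<zeta> v h]]
    have cm: "\<rho> (v, i) h \<otimes>\<^bsub>U\<^esub> c (\<zeta> (v, i) g) = c (\<zeta> (v, i) g) \<otimes>\<^bsub>U\<^esub> \<rho> (v, i) h"
      using c Omega_closed[OF \<zeta> v g] Omega_closed[OF \<rho> v h] by (simp add: central_hom_def)
    have "\<rho> (v, i) (g \<otimes>\<^bsub>Gv v\<^esub> h) \<otimes>\<^bsub>U\<^esub> c (\<zeta> (v, i) (g \<otimes>\<^bsub>Gv v\<^esub> h)) =
      \<rho> (v, i) g \<otimes>\<^bsub>U\<^esub> (\<rho> (v, i) h \<otimes>\<^bsub>U\<^esub> c (\<zeta> (v, i) g)) \<otimes>\<^bsub>U\<^esub> c (\<zeta> (v, i) h)"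
      using cl hom_mult[OF chom Omega_closed[OF \<zeta> v g] Omega_closed[OF \<zeta> v h]]
      by (simp add: Omega_mult[OF \<rho> v g h] Omega_mult[OF \<zeta> v g h] U.m_assoc)
    also have "\<dots> = (\<rho> (v, i) g \<otimes>\<^bsub>U\<^esub> c (\<zeta> (v, i) g)) \<otimes>\<^bsub>U\<^esub> (\<rho> (v, i) h \<otimes>\<^bsub>U\<^esub> c (\<zeta> (v, i) h))"
      unfolding cm using cl by (simp add: U.m_assoc)
    finally show "\<rho> (v, i) (g \<otimes>\<^bsub>Gv v\<^esub> h) \<otimes>\<^bsub>U\<^esub> c (\<zeta> (v, i) (g \<otimes>\<^bsub>Gv v\<^esub> h)) =
      (\<rho> (v, i) g \<otimes>\<^bsub>U\<^esub> c (\<zeta> (v, i) g)) \<otimes>\<^bsub>U\<^esub> (\<rho> (v, i) h \<otimes>\<^bsub>U\<^esub> c (\<zeta> (v, i) h))" .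
  qed (use cc Omega_closed[OF \<rho> v] Omega_closed[OF \<zeta> v] in simp)
  then have "(\<lambda>z\<in>V \<times> UNIV. \<lambda>g\<in>carrier (Gv (fst z)). \<rho> (fst z, snd z) g \<otimes>\<^bsub>U\<^esub> c (\<zeta> (fst z, snd z) g)) \<in> Omega U"
    by (rule Omega_I)
  moreover have "(\<lambda>z\<in>V \<times> UNIV. \<lambda>g\<in>carrier (Gv (fst z)). \<rho> (fst z, snd z) g \<otimes>\<^bsub>U\<^esub> c (\<zeta> (fst z, snd z) g)) = pmul U \<rho> (push c \<zeta>)"
    unfolding pmul_def push_def by (intro restrict_ext) auto
  ultimately show ?thesis by simp
qed

lemma act_pmul:
  assumes U: "group U" and Z: "group Z" and e: "e \<in> E" and c: "central_hom Z U c"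
    and \<rho>: "\<rho> \<in> Omega U" and \<zeta>: "\<zeta> \<in> Omega Z"
  shows "act U e (pmul U \<rho> (push c \<zeta>)) = pmul U (act U e \<rho>) (push c (act Z e \<zeta>))"
proof (rule act_eqI[OF U e])
  show "pmul U (act U e \<rho>) (push c (act Z e \<zeta>)) \<in> Omega U"
    by (rule pmul_closed[OF U c act_closed[OF U e \<rho>] act_closed[OF Z e \<zeta>]])
  show "swapped e (pmul U \<rho> (push c \<zeta>)) (pmul U (act U e \<rho>) (push c (act Z e \<zeta>)))"
    by (intro swapped_pmul[OF e] swapped_push[OF e] swapped_act U Z e \<rho> \<zeta>)
qed

text \<open>The stable letter of \<open>e\<close> will act on \<open>Omega U\<close> by
  \<open>act U (bar e)\<close>, so this is the \<open>n\<close>-th power of the action of the edge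
  sequence \<open>es\<close>.\<close>

definition moves :: "('c, 'm) monoid_scheme \<Rightarrow> 'e list \<Rightarrow> nat \<Rightarrow> ('v \<times> bool \<Rightarrow> 'a \<Rightarrow> 'c) \<Rightarrow> 'v \<times> bool \<Rightarrow> 'a \<Rightarrow> 'c" where
  "moves U es n = (foldr (\<lambda>e. act U (bar e)) es) ^^ n"

text \<open>One induction for several invariance statements: closure and compatibility with
  \<open>push\<close> result from different choices of \<open>R\<close>.\<close>

lemma moves_natural:
  fixes R :: "('v \<times> bool \<Rightarrow> 'a \<Rightarrow> 'c) \<Rightarrow> ('v \<times> bool \<Rightarrow> 'a \<Rightarrow> 'd) \<Rightarrow> bool"
  assumes es: "set es \<subseteq> E"
    and R: "\<And>e \<rho> \<sigma>. e \<in> E \<Longrightarrow> R \<rho> \<sigma> \<Longrightarrow> R (act U e \<rho>) (act U' e \<sigma>)" and "R \<rho> \<sigma>"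
  shows "R (moves U es n \<rho>) (moves U' es n \<sigma>)"
proof -
  have step: "R (foldr (\<lambda>e. act U (bar e)) es \<rho>) (foldr (\<lambda>e. act U' (bar e)) es \<sigma>)" if "R \<rho> \<sigma>" for \<rho> \<sigma>
    using es that by (induction es) (auto simp: R bar)
  show ?thesis unfolding moves_def by (induction n) (auto simp: step assms(3))
qed

lemma moves_closed: "group U \<Longrightarrow> set es \<subseteq> E \<Longrightarrow> \<rho> \<in> Omega U \<Longrightarrow> moves U es n \<rho> \<in> Omega U"
  using moves_natural[of es "\<lambda>\<rho> _. \<rho> \<in> Omega U" U U \<rho> \<rho> n] act_closed by blast

lemma moves_push:
  assumes "group U" "group U'" "set es \<subseteq> E" "q \<in> hom U U'" "\<rho> \<in> Omega U"
  shows "moves U' es n (push q \<rho>) = push q (moves U es n \<rho>)"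
proof -
  have "moves U es n \<rho> \<in> Omega U \<and> moves U' es n (push q \<rho>) = push q (moves U es n \<rho>)"
    by (rule moves_natural[where R = "\<lambda>\<rho> \<sigma>. \<rho> \<in> Omega U \<and> \<sigma> = push q \<rho>"])
      (use assms in \<open>auto simp: act_push act_closed\<close>)
  then show ?thesis by blast
qed

text \<open>The word moves the central factor as a point of \<open>Omega Z\<close>. Since it acts
  trivially there, the factor can be pulled out of every iterate unchanged.\<close>

lemma moves_pmul:
  assumes U: "group U" and Z: "group Z" and es: "set es \<subseteq> E" and c: "central_hom Z U c"
    and \<rho>: "\<rho> \<in> Omega U" and \<zeta>: "\<zeta> \<in> Omega Z" and triv: "\<And>\<zeta>. \<zeta> \<in> Omega Z \<Longrightarrow> moves Z es 1 \<zeta> = \<zeta>"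
  shows "moves U es n (pmul U \<rho> (push c \<zeta>)) = pmul U (moves U es n \<rho>) (push c \<zeta>)"
proof -
  have step: "foldr (\<lambda>e. act U (bar e)) es (pmul U \<rho> (push c \<zeta>)) =
      pmul U (foldr (\<lambda>e. act U (bar e)) es \<rho>) (push c (foldr (\<lambda>e. act Z (bar e)) es \<zeta>)) \<and>
      foldr (\<lambda>e. act U (bar e)) es \<rho> \<in> Omega U \<and> foldr (\<lambda>e. act Z (bar e)) es \<zeta> \<in> Omega Z"
    if "\<rho> \<in> Omega U" for \<rho>
    using es
  proof (induction es)
    case (Cons e es)
    then show ?case
      using act_pmul[OF U Z bar(1)[of e] c] act_closed[OF U bar(1)[of e]] act_closed[OF Z bar(1)[of e]] by auto
  qed (use that \<zeta> in simp)
  have "foldr (\<lambda>e. act Z (bar e)) es \<zeta> = \<zeta>" using triv[OF \<zeta>] by (simp add: moves_def)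
  then have step': "foldr (\<lambda>e. act U (bar e)) es (pmul U \<rho> (push c \<zeta>)) =
      pmul U (foldr (\<lambda>e. act U (bar e)) es \<rho>) (push c \<zeta>)" if "\<rho> \<in> Omega U" for \<rho>
    using step[OF that] by simp
  have "moves U es n (pmul U \<rho> (push c \<zeta>)) = pmul U (moves U es n \<rho>) (push c \<zeta>) \<and> moves U es n \<rho> \<in> Omega U"
    using moves_closed[OF U es \<rho>] by (induction n) (auto simp: moves_def \<rho> step' step)
  then show ?thesis by blast
qed

text \<open>By induction over a central extension of a p-group by Z/p, the p^k-th iterate changes a point by a
  homomorphism into the central Z/p. The word fixes that homomorphism, so iterating p more times
  changes the point by a p-th power, which is trivial.\<close>

theorem moves_torsion:
  fixes U :: "nat monoid"
  assumes p: "Factorial_Ring.prime p" and es: "set es \<subseteq> E"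
    and triv: "\<And>\<zeta>. \<zeta> \<in> Omega (integer_mod_group p) \<Longrightarrow> moves (integer_mod_group p) es 1 \<zeta> = \<zeta>"
    and U: "group U" "finite (carrier U)" "card (carrier U) = p ^ k" and \<rho>: "\<rho> \<in> Omega U"
  shows "moves U es (p ^ k) \<rho> = \<rho>"
  using U \<rho>
proof (induction k arbitrary: U \<rho>)
  case 0
  \<comment> \<open>With a single possible value for every homomorphism, \<open>Omega U\<close> has
    at most one point, and \<open>p ^ 0\<close> iterations fix it.\<close>
  then obtain u where "carrier U = {u}" using card_1_singletonE by (metis power_0)
  then have "\<sigma> (v, i) g = u" if "\<sigma> \<in> Omega U" "v \<in> V" "g \<in> carrier (Gv v)" for \<sigma> v i g
    using Omega_closed[OF that] by blast
  then show ?case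
    by (intro Omega_eqI[OF moves_closed[OF 0(1) es 0(4)] 0(4)]) (metis "0"(1,4) es moves_closed)
next
  case (Suc k)
  let ?Z = "integer_mod_group p"
  interpret U: group U by (rule Suc.prems(1))
  interpret Z: group ?Z by simp
  obtain c N q where c: "c \<in> hom ?Z U" "inj_on c (carrier ?Z)"
    "\<And>i x. i \<in> carrier ?Z \<Longrightarrow> x \<in> carrier U \<Longrightarrow> x \<otimes>\<^bsub>U\<^esub> c i = c i \<otimes>\<^bsub>U\<^esub> x"
    and N: "group (N :: nat monoid)" "finite (carrier N)" "card (carrier N) = p ^ k" and q: "q \<in> hom U N"
    and ker: "\<And>x. x \<in> carrier U \<Longrightarrow> q x = \<one>\<^bsub>N\<^esub> \<Longrightarrow> x \<in> c ` carrier ?Z"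
    using p_group_central_extension[OF p Suc.prems(1-3)] by blast
  interpret N: group N by (rule N(1))
  interpret q: group_hom U N q using q by (simp add: group_hom_def group_hom_axioms_def U.is_group N.is_group)
  interpret c: group_hom ?Z U c using c(1) by (simp add: group_hom_def group_hom_axioms_def U.is_group)
  have cent: "central_hom ?Z U c" using c by (simp add: central_hom_def)
  define T where "T = moves U es (p ^ k)"
  have TO: "T \<sigma> \<in> Omega U" if "\<sigma> \<in> Omega U" for \<sigma>
    unfolding T_def by (rule moves_closed[OF U.is_group es that])
  note \<rho> = Suc.prems(4)
  \<comment> \<open>By the induction hypothesis the iterate fixes the image of \<open>\<rho>\<close>
    over \<open>N\<close>, so \<open>T \<rho>\<close> and \<open>\<rho>\<close> differ by values in
    the kernel of \<open>q\<close>, which are central.\<close>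
  have qT: "q (T \<rho> (v, i) g) = q (\<rho> (v, i) g)" if "v \<in> V" "g \<in> carrier (Gv v)" for v i g
  proof -
    have "push q (T \<rho>) = push q \<rho>"
      unfolding T_def using moves_push[OF U.is_group N(1) es q \<rho>] Suc.IH[OF N push_closed[OF q \<rho>]] by metis
    then show ?thesis using push_apply[OF that] by metis
  qed
  define d where "d v i g = inv_into (carrier ?Z) c (inv\<^bsub>U\<^esub> \<rho> (v, i) g \<otimes>\<^bsub>U\<^esub> T \<rho> (v, i) g)" for v i g
  have dZ: "d v i g \<in> carrier ?Z" and cd: "c (d v i g) = inv\<^bsub>U\<^esub> \<rho> (v, i) g \<otimes>\<^bsub>U\<^esub> T \<rho> (v, i) g"
    if "v \<in> V" "g \<in> carrier (Gv v)" for v i g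
  proof -
    note cl = Omega_closed[OF \<rho> that, of i] Omega_closed[OF TO[OF \<rho>] that, of i]
    have "q (inv\<^bsub>U\<^esub> \<rho> (v, i) g \<otimes>\<^bsub>U\<^esub> T \<rho> (v, i) g) = \<one>\<^bsub>N\<^esub>"
      using cl qT[OF that] by simp
    then have "inv\<^bsub>U\<^esub> \<rho> (v, i) g \<otimes>\<^bsub>U\<^esub> T \<rho> (v, i) g \<in> c ` carrier ?Z"
      using ker cl by simp
    then show "d v i g \<in> carrier ?Z" "c (d v i g) = inv\<^bsub>U\<^esub> \<rho> (v, i) g \<otimes>\<^bsub>U\<^esub> T \<rho> (v, i) g"
      unfolding d_def by (auto intro: inv_into_into f_inv_into_f)
  qed
  have T_eq: "T \<rho> (v, i) g = \<rho> (v, i) g \<otimes>\<^bsub>U\<^esub> c (d v i g)" if "v \<in> V" "g \<in> carrier (Gv v)" for v i g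
    using cd[OF that] Omega_closed[OF \<rho> that, of i] Omega_closed[OF TO[OF \<rho>] that, of i]
    by (simp add: U.m_assoc[symmetric])
  \<comment> \<open>Centrality lets the correction at \<open>g\<close> pass
    \<open>\<rho> (v, i) h\<close>; injectivity of \<open>c\<close> then transfers multiplicativity
    to Z/p.\<close>
  have dhom: "d v i \<in> hom (Gv v) ?Z" if v: "v \<in> V" for v i
  proof (rule homI)
    fix g h assume g: "g \<in> carrier (Gv v)" and h: "h \<in> carrier (Gv v)"
    have gh: "g \<otimes>\<^bsub>Gv v\<^esub> h \<in> carrier (Gv v)" using grpv[OF v] g h by (simp add: group.is_monoid monoid.m_closed)
    note cl = Omega_closed[OF \<rho> v g, of i] Omega_closed[OF \<rho> v h, of i] c.hom_closed[OF dZ[OF v g, of i]] c.hom_closed[OF dZ[OF v h, of i]]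
      c.hom_closed[OF dZ[OF v gh, of i]]
    have "(\<rho> (v, i) g \<otimes>\<^bsub>U\<^esub> \<rho> (v, i) h) \<otimes>\<^bsub>U\<^esub> c (d v i (g \<otimes>\<^bsub>Gv v\<^esub> h)) = T \<rho> (v, i) g \<otimes>\<^bsub>U\<^esub> T \<rho> (v, i) h"
      using T_eq[OF v gh, of i] Omega_mult[OF TO[OF \<rho>] v g h, of i] Omega_mult[OF \<rho> v g h, of i] by simp
    also have "\<dots> = \<rho> (v, i) g \<otimes>\<^bsub>U\<^esub> (c (d v i g) \<otimes>\<^bsub>U\<^esub> \<rho> (v, i) h) \<otimes>\<^bsub>U\<^esub> c (d v i h)"
      unfolding T_eq[OF v g] T_eq[OF v h] using cl by (simp add: U.m_assoc)
    also have "\<dots> = (\<rho> (v, i) g \<otimes>\<^bsub>U\<^esub> \<rho> (v, i) h) \<otimes>\<^bsub>U\<^esub> (c (d v i g) \<otimes>\<^bsub>U\<^esub> c (d v i h))"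
      unfolding c(3)[OF dZ[OF v g] cl(2), symmetric] using cl by (simp add: U.m_assoc)
    finally have "c (d v i (g \<otimes>\<^bsub>Gv v\<^esub> h)) = c (d v i g) \<otimes>\<^bsub>U\<^esub> c (d v i h)"
      using cl by (simp add: U.m_assoc)
    also have "\<dots> = c (d v i g \<otimes>\<^bsub>?Z\<^esub> d v i h)" by (rule c.hom_mult[OF dZ[OF v g] dZ[OF v h], symmetric])
    finally show "d v i (g \<otimes>\<^bsub>Gv v\<^esub> h) = d v i g \<otimes>\<^bsub>?Z\<^esub> d v i h"
      using c(2) dZ[OF v] g h gh Z.m_closed by (meson inj_onD)
  qed (rule dZ[OF v])
  \<comment> \<open>The point over Z/p by which the \<open>n\<close>-th iterate of \<open>T\<close>
    differs from \<open>\<rho>\<close>: each application of \<open>T\<close> adds one more factor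
    \<open>d\<close>.\<close>
  define \<zeta> where "\<zeta> n = (\<lambda>z\<in>V \<times> UNIV. \<lambda>g\<in>carrier (Gv (fst z)). d (fst z) (snd z) g [^]\<^bsub>?Z\<^esub> (n :: nat))" for n
  have \<zeta>O: "\<zeta> n \<in> Omega ?Z" for n
  proof -
    interpret Zc: comm_group ?Z by simp
    have "(\<lambda>g. d v i g [^]\<^bsub>?Z\<^esub> n) \<in> hom (Gv v) ?Z" if v: "v \<in> V" for v i
      using dhom[OF v] dZ[OF v]
      by (intro homI) (simp_all add: hom_def Zc.nat_pow_distrib del: pow_integer_mod_group mult_integer_mod_group)
    then show ?thesis unfolding \<zeta>_def by (rule Omega_I)
  qed
  have \<zeta>_apply: "\<zeta> n (v, i) g = d v i g [^]\<^bsub>?Z\<^esub> n" if "v \<in> V" "g \<in> carrier (Gv v)" for n v i g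
    using that by (simp add: \<zeta>_def)
  have iter: "(T ^^ n) \<rho> = pmul U \<rho> (push c (\<zeta> n))" for n
  proof (induction n)
    case 0
    show ?case
      by (rule Omega_eqI[OF _ pmul_closed[OF U.is_group cent \<rho> \<zeta>O]])
        (use \<rho> Omega_closed[OF \<rho>] in \<open>auto simp: pmul_apply push_apply \<zeta>_apply simp del: pow_integer_mod_group one_integer_mod_group\<close>)
  next
    case (Suc n)
    have "(T ^^ Suc n) \<rho> = T (pmul U \<rho> (push c (\<zeta> n)))" using Suc.IH by simp
    also have "\<dots> = pmul U (T \<rho>) (push c (\<zeta> n))"
      unfolding T_def by (rule moves_pmul[OF U.is_group Z.is_group es cent \<rho> \<zeta>O triv])
    also have "\<dots> = pmul U \<rho> (push c (\<zeta> (Suc n)))"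
    proof (rule Omega_eqI)
      show "pmul U (T \<rho>) (push c (\<zeta> n)) \<in> Omega U" by (rule pmul_closed[OF U.is_group cent TO[OF \<rho>] \<zeta>O])
      show "pmul U \<rho> (push c (\<zeta> (Suc n))) \<in> Omega U" by (rule pmul_closed[OF U.is_group cent \<rho> \<zeta>O])
      fix v i g assume vg: "v \<in> V" "g \<in> carrier (Gv v)"
      have "d v i g [^]\<^bsub>?Z\<^esub> Suc n = d v i g \<otimes>\<^bsub>?Z\<^esub> d v i g [^]\<^bsub>?Z\<^esub> n"
        using dZ[OF vg] by (rule Z.nat_pow_Suc2)
      then show "pmul U (T \<rho>) (push c (\<zeta> n)) (v, i) g = pmul U \<rho> (push c (\<zeta> (Suc n))) (v, i) g"
        using Omega_closed[OF \<rho> vg, of i] dZ[OF vg, of i] Z.nat_pow_closed[OF dZ[OF vg, of i], of n]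
        by (simp add: pmul_apply[OF vg] push_apply[OF vg] \<zeta>_apply[OF vg] T_eq[OF vg] U.m_assoc
            del: pow_integer_mod_group mult_integer_mod_group nat_pow_Suc Z.nat_pow_Suc)
    qed
    finally show ?case .
  qed
  have "moves U es (p ^ Suc k) = T ^^ p"
    unfolding T_def moves_def by (simp add: funpow_mult mult.commute)
  moreover have "(T ^^ p) \<rho> = \<rho>"
    unfolding iter
  proof (rule Omega_eqI[OF pmul_closed[OF U.is_group cent \<rho> \<zeta>O] \<rho>])
    fix v i g assume vg: "v \<in> V" "g \<in> carrier (Gv v)"
    have "d v i g [^]\<^bsub>?Z\<^esub> p = \<one>\<^bsub>?Z\<^esub>" using dZ[OF vg] by simp
    then show "pmul U \<rho> (push c (\<zeta> p)) (v, i) g = \<rho> (v, i) g"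
      using Omega_closed[OF \<rho> vg, of i] c.hom_one
      by (simp add: pmul_apply[OF vg] push_apply[OF vg] \<zeta>_apply[OF vg] del: pow_integer_mod_group one_integer_mod_group)
  qed
  ultimately show ?case by simp
qed

end

section \<open>The fundamental group of a graph of groups\<close>

lemma rel_cong_append:
  assumes "rel_cong R u u'" "rel_cong R v v'"
  shows "rel_cong R (u @ v) (u' @ v')"
  using rel_cong.ctxt[OF assms(1), of "[]" v] rel_cong.ctxt[OF assms(2), of u' "[]"]
  by (simp add: rel_cong.trans)

lemma not_successively_split:
  "\<not> successively Q l \<Longrightarrow> \<exists>l1 x y l2. l = l1 @ x # y # l2 \<and> \<not> Q x y"
proof (induction l rule: induct_list012)
  case (3 x y zs)
  show ?case
  proof (cases "Q x y")
    case True
    then obtain l1 a b l2 where "y # zs = l1 @ a # b # l2" "\<not> Q a b" using 3 by auto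
    then show ?thesis by (intro exI[of _ "x # l1"]) auto
  next
    case False
    then show ?thesis by (intro exI[of _ "[]"]) auto
  qed
qed auto

context clean_gog
begin

abbreviation words where "words \<equiv> gog_words V E Gv"
abbreviation rels where "rels \<equiv> gog_relations V E bar tau Gv Ge f"
abbreviation eqv :: "('v, 'a, 'e) gog_letter list \<Rightarrow> ('v, 'a, 'e) gog_letter list \<Rightarrow> bool" where
  "eqv \<equiv> rel_cong rels"

definition cls :: "('v, 'a, 'e) gog_letter list \<Rightarrow> ('v, 'a, 'e) gog_letter list set" where
  "cls w = {z \<in> words. eqv w z}"

lemma words_append [simp]: "u @ v \<in> words \<longleftrightarrow> u \<in> words \<and> v \<in> words"
  and words_Nil [simp]: "[] \<in> words"
  and words_Cons [simp]: "(x, b) # w \<in> words \<longleftrightarrow> x \<in> gog_generators V E Gv \<and> w \<in> words"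
  by (auto simp: gog_words_def)

lemma gens [simp]:
  "Inl (v, g) \<in> gog_generators V E Gv \<longleftrightarrow> v \<in> V \<and> g \<in> carrier (Gv v)"
  "Inr e \<in> gog_generators V E Gv \<longleftrightarrow> e \<in> E"
  by (auto simp: gog_generators_def)

text \<open>\<open>rel_cong\<close> admits contexts with arbitrary letters. As both sides of every
  relation use generators only, no class straddles the boundary of \<open>words\<close>.\<close>

lemma eqv_words:
  assumes "eqv u v"
  shows "u \<in> words \<longleftrightarrow> v \<in> words"
  using assms
proof (induction rule: rel_cong.induct)
  case (base u v)
  then show ?case
    unfolding gog_relations_def
    using bar(1) tau f_closed f_bar_closed grpv
    by (auto simp: group.is_monoid monoid.m_closed monoid.one_closed)
qed auto

lemma cls_eq_iff: "u \<in> words \<Longrightarrow> v \<in> words \<Longrightarrow> cls u = cls v \<longleftrightarrow> eqv u v"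
  unfolding cls_def using rel_cong.refl rel_cong.sym rel_cong.trans by blast

lemma cls_self: "w \<in> words \<Longrightarrow> w \<in> cls w"
  by (simp add: cls_def rel_cong.refl)

abbreviation FG where "FG v0 \<equiv> fundamental_group V E bar tau Gv Ge f v0"

lemma carrier_FG: "carrier (FG v0) = {cls w | w. path_word V E bar tau Gv v0 v0 w}"
  and one_FG: "\<one>\<^bsub>FG v0\<^esub> = cls []"
  by (simp_all add: fundamental_group_def path_group_def Let_def cls_def)

lemma mult_FG:
  assumes "u \<in> words" "v \<in> words"
  shows "cls u \<otimes>\<^bsub>FG v0\<^esub> cls v = cls (u @ v)"
proof -
  have "cls u \<otimes>\<^bsub>FG v0\<^esub> cls v = {z \<in> words. \<exists>x\<in>cls u. \<exists>y\<in>cls v. eqv (x @ y) z}"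
    by (simp add: fundamental_group_def path_group_def Let_def cls_def)
  also have "\<dots> = cls (u @ v)"
  proof -
    have "(\<exists>x\<in>cls u. \<exists>y\<in>cls v. eqv (x @ y) z) \<longleftrightarrow> eqv (u @ v) z" for z
    proof
      assume "\<exists>x\<in>cls u. \<exists>y\<in>cls v. eqv (x @ y) z"
      then show "eqv (u @ v) z"
        unfolding cls_def using rel_cong_append rel_cong.trans by blast
    qed (use cls_self assms in blast)
    then show ?thesis by (simp add: cls_def)
  qed
  finally show ?thesis .
qed

section \<open>Path words as lists of edges followed by vertex elements\<close>

fun valid :: "'v \<Rightarrow> ('e \<times> 'a) list \<Rightarrow> 'v \<Rightarrow> bool" where
  "valid u [] v \<longleftrightarrow> u = v"
| "valid u ((e, g) # l) v \<longleftrightarrow> e \<in> E \<and> tau (bar e) = u \<and> g \<in> carrier (Gv (tau e)) \<and> valid (tau e) l v"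

definition tail_word :: "('e \<times> 'a) list \<Rightarrow> ('v, 'a, 'e) gog_letter list" where
  "tail_word l = concat (map (\<lambda>(e, g). [(Inr e, True), (Inl (tau e, g), True)]) l)"

definition path :: "'v \<Rightarrow> 'a \<Rightarrow> ('e \<times> 'a) list \<Rightarrow> ('v, 'a, 'e) gog_letter list" where
  "path u g l = (Inl (u, g), True) # tail_word l"

lemma tail_word_simps [simp]:
  "tail_word [] = []"
  "tail_word ((e, g) # l) = (Inr e, True) # (Inl (tau e, g), True) # tail_word l"
  "tail_word (l @ l') = tail_word l @ tail_word l'"
  by (simp_all add: tail_word_def)

lemma path_append: "path u g (l @ l') = path u g l @ tail_word l'"
  by (simp add: path_def)

lemma valid_append: "valid u (l @ l') v \<longleftrightarrow> (\<exists>x. valid u l x \<and> valid x l' v)"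
  by (induction u l v rule: valid.induct) auto

lemma tail_words: "valid u l v \<Longrightarrow> tail_word l \<in> words"
  by (induction u l v rule: valid.induct) (auto simp: tau)

lemma valid_V: "valid u l v \<Longrightarrow> u \<in> V \<Longrightarrow> v \<in> V"
  by (induction u l v rule: valid.induct) (auto simp: tau)

lemma path_words: "u \<in> V \<Longrightarrow> g \<in> carrier (Gv u) \<Longrightarrow> valid u l v \<Longrightarrow> path u g l \<in> words"
  by (simp add: path_def tail_words)

lemma path_word_iff:
  "path_word V E bar tau Gv u v w \<longleftrightarrow>
     (\<exists>g l. u \<in> V \<and> g \<in> carrier (Gv u) \<and> valid u l v \<and> w = path u g l)"
proof
  assume "path_word V E bar tau Gv u v w"
  then show "\<exists>g l. u \<in> V \<and> g \<in> carrier (Gv u) \<and> valid u l v \<and> w = path u g l"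
  proof (induction rule: path_word.induct)
    case (start u g)
    then show ?case by (intro exI[of _ g] exI[of _ "[]"]) (simp add: path_def)
  next
    case (step u v w e h)
    then obtain g l where "u \<in> V" "g \<in> carrier (Gv u)" "valid u l v" "w = path u g l" by blast
    then show ?case
      using step by (intro exI[of _ g] exI[of _ "l @ [(e, h)]"]) (simp add: valid_append path_append)
  qed
next
  assume "\<exists>g l. u \<in> V \<and> g \<in> carrier (Gv u) \<and> valid u l v \<and> w = path u g l"
  then obtain g l where gl: "u \<in> V" "g \<in> carrier (Gv u)" "valid u l v" "w = path u g l" by blast
  have "path_word V E bar tau Gv u v (path u g l)"
    using gl(3)
  proof (induction l arbitrary: v rule: rev_induct)
    case Nil
    have "path_word V E bar tau Gv u u [(Inl (u, g), True)]" using gl(1,2) by (rule path_word.start)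
    then show ?case using Nil by (simp add: path_def)
  next
    case (snoc a l)
    obtain e h where a: "a = (e, h)" by (cases a)
    have "valid u l (tau (bar e))" "e \<in> E" "h \<in> carrier (Gv (tau e))" "v = tau e"
      using snoc.prems by (auto simp: valid_append a)
    then show ?case
      using path_word.step[OF snoc.IH, of "tau (bar e)" e h] by (simp add: a path_append)
  qed
  then show "path_word V E bar tau Gv u v w" using gl(4) by simp
qed

lemma path_word_words: "path_word V E bar tau Gv u v w \<Longrightarrow> w \<in> words"
  unfolding path_word_iff using path_words by (elim exE conjE) simp

lemma eqv_vertex_mult:
  assumes "v \<in> V" "g \<in> carrier (Gv v)" "h \<in> carrier (Gv v)"
  shows "eqv [(Inl (v, g), True), (Inl (v, h), True)] [(Inl (v, g \<otimes>\<^bsub>Gv v\<^esub> h), True)]"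
  by (rule rel_cong.base) (use assms in \<open>auto simp: gog_relations_def\<close>)

lemma eqv_vertex_one: "v \<in> V \<Longrightarrow> eqv [(Inl (v, \<one>\<^bsub>Gv v\<^esub>), True)] []"
  by (rule rel_cong.base) (auto simp: gog_relations_def)

lemma eqv_bar: "e \<in> E \<Longrightarrow> eqv [(Inr (bar e), True)] [(Inr e, False)]"
  by (rule rel_cong.base) (auto simp: gog_relations_def)

lemma eqv_edge_bar: assumes "e \<in> E" shows "eqv [(Inr e, True), (Inr (bar e), True)] []"
proof -
  have "eqv [(Inr e, True), (Inr e, False)] []"
    by (rule rel_cong.base) (use assms in \<open>auto simp: gog_relations_def\<close>)
  then show ?thesis
    using rel_cong.ctxt[OF eqv_bar[OF assms], of "[(Inr e, True)]" "[]"] by (simp add: rel_cong.trans)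
qed

lemma eqv_edge_conj:
  assumes "e \<in> E" "a \<in> carrier (Ge e)"
  shows "eqv [(Inr e, True), (Inl (tau e, f e a), True), (Inr (bar e), True)] [(Inl (tau (bar e), f (bar e) a), True)]"
proof -
  have "eqv [(Inr e, True), (Inl (tau e, f e a), True), (Inr e, False)] [(Inl (tau (bar e), f (bar e) a), True)]"
    by (rule rel_cong.base) (use assms in \<open>auto simp: gog_relations_def\<close>)
  then show ?thesis
    using rel_cong.ctxt[OF eqv_bar[OF assms(1)], of "[(Inr e, True), (Inl (tau e, f e a), True)]" "[]"]
    by (simp add: rel_cong.trans)
qed

text \<open>The last vertex element is \<open>g\<close> for a path without edges and belongs to the
  last pair otherwise; making it replaceable hides this distinction from
  \<open>eqv_path_append\<close>.\<close>

lemma path_last: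
  assumes u: "u \<in> V" "g \<in> carrier (Gv u)" and l: "valid u l y"
  obtains pre x where "x \<in> carrier (Gv y)" "path u g l = pre @ [(Inl (y, x), True)]"
    "\<And>x'. x' \<in> carrier (Gv y) \<Longrightarrow> \<exists>g' l'. g' \<in> carrier (Gv u) \<and> length l' = length l \<and> valid u l' y \<and>
       pre @ [(Inl (y, x'), True)] = path u g' l'"
proof (cases l rule: rev_cases)
  case Nil
  have "\<exists>g' l'. g' \<in> carrier (Gv u) \<and> length l' = length l \<and> valid u l' y \<and>
       [] @ [(Inl (y, x'), True)] = path u g' l'" if "x' \<in> carrier (Gv y)" for x'
    using that l Nil by (intro exI[of _ x'] exI[of _ "[]"]) (simp add: path_def)
  then show thesis using that[of g "[]"] l u Nil by (simp add: path_def)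
next
  case (snoc l1 a)
  obtain e h where a: "a = (e, h)" by (cases a)
  have v: "valid u l1 (tau (bar e))" "e \<in> E" "h \<in> carrier (Gv (tau e))" "y = tau e"
    using l by (auto simp: valid_append snoc a)
  have "\<exists>g' l'. g' \<in> carrier (Gv u) \<and> length l' = length l \<and> valid u l' y \<and>
       (path u g l1 @ [(Inr e, True)]) @ [(Inl (y, x'), True)] = path u g' l'" if "x' \<in> carrier (Gv y)" for x'
    using that v u by (intro exI[of _ g] exI[of _ "l1 @ [(e, x')]"]) (simp add: path_append valid_append snoc)
  then show thesis using that[of h "path u g l1 @ [(Inr e, True)]"] v by (simp add: path_append snoc a)
qed

lemma eqv_path_append:
  assumes u: "u \<in> V" "g \<in> carrier (Gv u)" and l: "valid u l y" and h: "h \<in> carrier (Gv y)"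
  obtains g' l' where "g' \<in> carrier (Gv u)" "length l' = length l" "valid u l' y"
    "eqv (path u g l @ [(Inl (y, h), True)]) (path u g' l')"
proof -
  have y: "y \<in> V" using valid_V l u by blast
  obtain pre x where x: "x \<in> carrier (Gv y)" "path u g l = pre @ [(Inl (y, x), True)]"
    and re: "\<And>x'. x' \<in> carrier (Gv y) \<Longrightarrow> \<exists>g' l'. g' \<in> carrier (Gv u) \<and> length l' = length l \<and> valid u l' y \<and>
       pre @ [(Inl (y, x'), True)] = path u g' l'"
    by (rule path_last[OF u l]) (rule that)
  have "x \<otimes>\<^bsub>Gv y\<^esub> h \<in> carrier (Gv y)" using x h grpv[OF y] by (simp add: group.is_monoid monoid.m_closed)
  then obtain g' l' where "g' \<in> carrier (Gv u)" "length l' = length l" "valid u l' y"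
    "pre @ [(Inl (y, x \<otimes>\<^bsub>Gv y\<^esub> h), True)] = path u g' l'" using re by blast
  moreover have "eqv (path u g l @ [(Inl (y, h), True)]) (pre @ [(Inl (y, x \<otimes>\<^bsub>Gv y\<^esub> h), True)])"
    using rel_cong.ctxt[OF eqv_vertex_mult[OF y x(1) h], of pre "[]"] x(2) by simp
  ultimately show thesis using that by simp
qed

lemma path_word_mult:
  assumes "path_word V E bar tau Gv u v w1" "path_word V E bar tau Gv v x w2"
  shows "\<exists>w. path_word V E bar tau Gv u x w \<and> eqv (w1 @ w2) w"
proof -
  obtain g l where 1: "u \<in> V" "g \<in> carrier (Gv u)" "valid u l v" "w1 = path u g l"
    using assms(1) path_word_iff by blast
  obtain h l2 where 2: "v \<in> V" "h \<in> carrier (Gv v)" "valid v l2 x" "w2 = path v h l2"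
    using assms(2) path_word_iff by blast
  obtain g' l' where 3: "g' \<in> carrier (Gv u)" "valid u l' v" "eqv (path u g l @ [(Inl (v, h), True)]) (path u g' l')"
    using eqv_path_append[OF 1(1,2,3) 2(2)] by blast
  have "eqv (w1 @ w2) (path u g' (l' @ l2))"
    using rel_cong.ctxt[OF 3(3), of "[]" "tail_word l2"] 1(4) 2(4) by (simp add: path_append path_def)
  moreover have "path_word V E bar tau Gv u x (path u g' (l' @ l2))"
    using 1 2 3 path_word_iff valid_append by blast
  ultimately show ?thesis by blast
qed

lemma path_word_inverse:
  assumes "u \<in> V" "g \<in> carrier (Gv u)" "valid u l v"
  shows "\<exists>w'. path_word V E bar tau Gv v u w' \<and> eqv (path u g l @ w') []"
  using assms
proof (induction l arbitrary: u g)
  case Nil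
  interpret group "Gv u" by (rule grpv[OF Nil(1)])
  have "eqv [(Inl (u, g), True), (Inl (u, inv\<^bsub>Gv u\<^esub> g), True)] []"
    using eqv_vertex_mult[OF Nil(1,2) inv_closed[OF Nil(2)]] eqv_vertex_one[OF Nil(1)] Nil(2)
    by (simp add: rel_cong.trans)
  moreover have "path_word V E bar tau Gv u u [(Inl (u, inv\<^bsub>Gv u\<^esub> g), True)]"
    using Nil(1) inv_closed[OF Nil(2)] by (rule path_word.start)
  ultimately show ?case
    using Nil by (intro exI[of _ "[(Inl (u, inv\<^bsub>Gv u\<^esub> g), True)]"]) (simp add: path_def)
next
  case (Cons a l)
  obtain e h where a: "a = (e, h)" by (cases a)
  interpret group "Gv u" by (rule grpv[OF Cons(2)])
  have e: "e \<in> E" "tau (bar e) = u" "h \<in> carrier (Gv (tau e))" "valid (tau e) l v"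
    using Cons.prems by (auto simp: a)
  obtain w where w: "path_word V E bar tau Gv v (tau e) w" "eqv (path (tau e) h l @ w) []"
    using Cons.IH[OF tau[OF e(1)] e(3,4)] by blast
  let ?end = "[(Inr (bar e), True), (Inl (u, inv\<^bsub>Gv u\<^esub> g), True)]"
  have "path_word V E bar tau Gv v u (w @ ?end)"
    using path_word.step[OF w(1), of "bar e" "inv\<^bsub>Gv u\<^esub> g"] bar[OF e(1)] e Cons.prems by simp
  moreover have "eqv (path u g (a # l) @ w @ ?end) []"
  proof -
    have "eqv (path u g (a # l) @ w @ ?end) ([(Inl (u, g), True), (Inr e, True)] @ ?end)"
      using rel_cong.ctxt[OF w(2), of "[(Inl (u, g), True), (Inr e, True)]" ?end] by (simp add: path_def a)
    moreover have "eqv ([(Inl (u, g), True), (Inr e, True)] @ ?end) [(Inl (u, g), True), (Inl (u, inv\<^bsub>Gv u\<^esub> g), True)]"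
      using rel_cong.ctxt[OF eqv_edge_bar[OF e(1)], of "[(Inl (u, g), True)]" "[(Inl (u, inv\<^bsub>Gv u\<^esub> g), True)]"] by simp
    moreover have "eqv [(Inl (u, g), True), (Inl (u, inv\<^bsub>Gv u\<^esub> g), True)] []"
      using eqv_vertex_mult[OF Cons.prems(1,2) inv_closed[OF Cons.prems(2)]] eqv_vertex_one[OF Cons.prems(1)] Cons.prems(2)
      by (simp add: rel_cong.trans)
    ultimately show ?thesis by (meson rel_cong.trans)
  qed
  ultimately show ?case by blast
qed

lemma group_FG:
  assumes v0: "v0 \<in> V"
  shows "group (FG v0)"
proof -
  have pw: "w \<in> words" if "path_word V E bar tau Gv v0 v0 w" for w
    using that path_word_words by blast
  interpret Gv0: group "Gv v0" by (rule grpv[OF v0])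
  have one: "path_word V E bar tau Gv v0 v0 [(Inl (v0, \<one>\<^bsub>Gv v0\<^esub>), True)]"
    using v0 Gv0.one_closed by (rule path_word.start)
  \<comment> \<open>The empty word is not a path word, so the identity must be represented by the
    trivial element at the base vertex.\<close>
  have one_eq: "cls [(Inl (v0, \<one>\<^bsub>Gv v0\<^esub>), True)] = cls []"
    using cls_eq_iff eqv_vertex_one[OF v0] v0 by simp
  show ?thesis
  proof (rule groupI)
    fix Q Y assume "Q \<in> carrier (FG v0)" "Y \<in> carrier (FG v0)"
    then obtain w w' where w: "Q = cls w" "Y = cls w'" "path_word V E bar tau Gv v0 v0 w" "path_word V E bar tau Gv v0 v0 w'"
      by (auto simp: carrier_FG)
    obtain z where z: "path_word V E bar tau Gv v0 v0 z" "eqv (w @ w') z"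
      using path_word_mult[OF w(3,4)] by blast
    have "Q \<otimes>\<^bsub>FG v0\<^esub> Y = cls z"
      using w z pw by (simp add: mult_FG cls_eq_iff)
    then show "Q \<otimes>\<^bsub>FG v0\<^esub> Y \<in> carrier (FG v0)" using z by (auto simp: carrier_FG)
  next
    show "\<one>\<^bsub>FG v0\<^esub> \<in> carrier (FG v0)"
      unfolding one_FG one_eq[symmetric] carrier_FG using one by blast
  next
    fix Q Y Z assume "Q \<in> carrier (FG v0)" "Y \<in> carrier (FG v0)" "Z \<in> carrier (FG v0)"
    then show "Q \<otimes>\<^bsub>FG v0\<^esub> Y \<otimes>\<^bsub>FG v0\<^esub> Z = Q \<otimes>\<^bsub>FG v0\<^esub> (Y \<otimes>\<^bsub>FG v0\<^esub> Z)"
      using pw by (auto simp: carrier_FG mult_FG)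
  next
    fix Q assume "Q \<in> carrier (FG v0)"
    then show "\<one>\<^bsub>FG v0\<^esub> \<otimes>\<^bsub>FG v0\<^esub> Q = Q"
      using pw by (auto simp: carrier_FG mult_FG one_FG)
  next
    fix Q assume "Q \<in> carrier (FG v0)"
    then obtain w where w: "Q = cls w" "path_word V E bar tau Gv v0 v0 w" by (auto simp: carrier_FG)
    obtain w' where w': "path_word V E bar tau Gv v0 v0 w'" "eqv (w @ w') []"
      using path_word_inverse w(2) path_word_iff by metis
    \<comment> \<open>Only right inverses are available so far; a right inverse of \<open>w'\<close>
      shows that \<open>w'\<close> is also a left inverse of \<open>w\<close>.\<close>
    obtain w'' where w'': "path_word V E bar tau Gv v0 v0 w''" "eqv (w' @ w'') []"
      using path_word_inverse w'(1) path_word_iff by metis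
    have "eqv (w' @ w) (w' @ w @ w' @ w'')"
      using rel_cong.ctxt[OF rel_cong.sym[OF w''(2)], of "w' @ w" "[]"] by simp
    moreover have "eqv (w' @ w @ w' @ w'') (w' @ w'')"
      using rel_cong.ctxt[OF w'(2), of w' w''] by simp
    ultimately have "eqv (w' @ w) []" using w''(2) by (meson rel_cong.trans)
    then have "cls w' \<otimes>\<^bsub>FG v0\<^esub> Q = \<one>\<^bsub>FG v0\<^esub>"
      using pw w w' by (simp add: mult_FG one_FG cls_eq_iff)
    then show "\<exists>Y\<in>carrier (FG v0). Y \<otimes>\<^bsub>FG v0\<^esub> Q = \<one>\<^bsub>FG v0\<^esub>"
      using w'(1) by (auto simp: carrier_FG)
  qed
qed

definition reduced_path :: "('e \<times> 'a) list \<Rightarrow> bool" where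
  "reduced_path l \<longleftrightarrow> successively (\<lambda>x y. \<not> (fst y = bar (fst x) \<and> snd x \<in> A (fst x))) l"

text \<open>A backtrack across an element of the edge group equals an element at the origin of the
  edge. It is absorbed, with the vertex element after the backtrack, into the preceding vertex
  letter, and the path loses two edges.\<close>

lemma ex_reduced_path:
  assumes "u \<in> V" "g \<in> carrier (Gv u)" "valid u l v"
  shows "\<exists>g' l'. g' \<in> carrier (Gv u) \<and> valid u l' v \<and> reduced_path l' \<and> eqv (path u g l) (path u g' l')"
  using assms
proof (induction "length l" arbitrary: g l rule: less_induct)
  case less
  show ?case
  proof (cases "reduced_path l")
    case True
    then show ?thesis using less.prems rel_cong.refl by blast
  next
    case False
    then obtain l1 x y l2 where xy: "l = l1 @ x # y # l2" "fst y = bar (fst x)" "snd x \<in> A (fst x)"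
      using not_successively_split[OF False[unfolded reduced_path_def]] by blast
    obtain e h e' k where "x = (e, h)" "y = (e', k)" by (metis surj_pair)
    then have l: "l = l1 @ (e, h) # (e', k) # l2" "e' = bar e" "h \<in> A e" using xy by simp_all
    obtain a where a: "a \<in> carrier (Ge e)" "h = f e a" using l(3) by blast
    have v: "valid u l1 (tau (bar e))" "e \<in> E" "k \<in> carrier (Gv (tau (bar e)))" "valid (tau (bar e)) l2 v"
      using less.prems(3) by (auto simp: l valid_append)
    have fa: "f (bar e) a \<in> carrier (Gv (tau (bar e)))" by (rule f_bar_closed[OF v(2) a(1)])
    obtain g1 l1' where 1: "g1 \<in> carrier (Gv u)" "length l1' = length l1" "valid u l1' (tau (bar e))"
      "eqv (path u g l1 @ [(Inl (tau (bar e), f (bar e) a), True)]) (path u g1 l1')"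
      by (rule eqv_path_append[OF less.prems(1,2) v(1) fa])
    obtain g2 l1'' where 2: "g2 \<in> carrier (Gv u)" "length l1'' = length l1'" "valid u l1'' (tau (bar e))"
      "eqv (path u g1 l1' @ [(Inl (tau (bar e), k), True)]) (path u g2 l1'')"
      by (rule eqv_path_append[OF less.prems(1) 1(1,3) v(3)])
    have "eqv (path u g l) ((path u g l1 @ [(Inl (tau (bar e), f (bar e) a), True)]) @ (Inl (tau (bar e), k), True) # tail_word l2)"
      using rel_cong.ctxt[OF eqv_edge_conj[OF v(2) a(1)], of "path u g l1" "(Inl (tau (bar e), k), True) # tail_word l2"]
      by (simp add: l path_append a(2))
    moreover have "eqv ((path u g l1 @ [(Inl (tau (bar e), f (bar e) a), True)]) @ (Inl (tau (bar e), k), True) # tail_word l2)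
        ((path u g1 l1' @ [(Inl (tau (bar e), k), True)]) @ tail_word l2)"
      using rel_cong.ctxt[OF 1(4), of "[]" "(Inl (tau (bar e), k), True) # tail_word l2"] by simp
    moreover have "eqv ((path u g1 l1' @ [(Inl (tau (bar e), k), True)]) @ tail_word l2) (path u g2 (l1'' @ l2))"
      using rel_cong.ctxt[OF 2(4), of "[]" "tail_word l2"] by (simp add: path_append)
    ultimately have eq: "eqv (path u g l) (path u g2 (l1'' @ l2))" by (meson rel_cong.trans)
    have "valid u (l1'' @ l2) v" using 2 v by (auto simp: valid_append)
    moreover have "length (l1'' @ l2) < length l" using 1 2 by (simp add: l)
    ultimately obtain g' l' where "g' \<in> carrier (Gv u)" "valid u l' v" "reduced_path l'" "eqv (path u g2 (l1'' @ l2)) (path u g' l')"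
      using less.hyps less.prems(1) 2(1) by blast
    then show ?thesis using eq rel_cong.trans by blast
  qed
qed

section \<open>Evaluating path words under representations of the graph of groups\<close>

definition rep :: "('c, 'm) monoid_scheme \<Rightarrow> ('v \<Rightarrow> 'a \<Rightarrow> 'c) \<Rightarrow> ('e \<Rightarrow> 'c) \<Rightarrow> bool" where
  "rep P \<nu> s \<longleftrightarrow> group P \<and> (\<forall>v\<in>V. \<nu> v \<in> hom (Gv v) P) \<and>
     (\<forall>e\<in>E. s e \<in> carrier P \<and> s (bar e) = inv\<^bsub>P\<^esub> s e) \<and>
     (\<forall>e\<in>E. \<forall>a\<in>carrier (Ge e). s e \<otimes>\<^bsub>P\<^esub> \<nu> (tau e) (f e a) = \<nu> (tau (bar e)) (f (bar e) a) \<otimes>\<^bsub>P\<^esub> s e)"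

definition eval :: "('c, 'm) monoid_scheme \<Rightarrow> ('v \<Rightarrow> 'a \<Rightarrow> 'c) \<Rightarrow> ('e \<Rightarrow> 'c) \<Rightarrow> ('v, 'a, 'e) gog_letter list \<Rightarrow> 'c" where
  "eval P \<nu> s w = eval_word P (map (\<lambda>(x, b). (case x of Inl (v, g) \<Rightarrow> \<nu> v g | Inr e \<Rightarrow> s e, b)) w)"

lemma eval_Nil [simp]: "eval P \<nu> s [] = \<one>\<^bsub>P\<^esub>"
  and eval_Cons: "eval P \<nu> s ((x, b) # w) =
    (let y = (case x of Inl (v, g) \<Rightarrow> \<nu> v g | Inr e \<Rightarrow> s e) in if b then y else inv\<^bsub>P\<^esub> y) \<otimes>\<^bsub>P\<^esub> eval P \<nu> s w"
  by (simp_all add: eval_def eval_word_Cons Let_def)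

definition eval_cls :: "('c, 'm) monoid_scheme \<Rightarrow> ('v \<Rightarrow> 'a \<Rightarrow> 'c) \<Rightarrow> ('e \<Rightarrow> 'c) \<Rightarrow> ('v, 'a, 'e) gog_letter list set \<Rightarrow> 'c" where
  "eval_cls P \<nu> s Q = eval P \<nu> s (SOME w. w \<in> Q)"

context
  fixes P :: "('c, 'm) monoid_scheme" and \<nu> s
  assumes rep: "rep P \<nu> s"
begin

interpretation P: group P using rep by (simp add: rep_def)

lemma rep_vertex_closed: "v \<in> V \<Longrightarrow> g \<in> carrier (Gv v) \<Longrightarrow> \<nu> v g \<in> carrier P"
  and rep_edge_closed: "e \<in> E \<Longrightarrow> s e \<in> carrier P"
  using rep by (auto simp: rep_def hom_def)

lemma eval_closed: "w \<in> words \<Longrightarrow> eval P \<nu> s w \<in> carrier P"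
proof (induction w)
  case (Cons a w)
  obtain x b where "a = (x, b)" by (cases a)
  then show ?case using Cons rep_vertex_closed rep_edge_closed
    by (cases x) (auto simp: eval_Cons Let_def)
qed simp

lemma eval_append: "u \<in> words \<Longrightarrow> v \<in> words \<Longrightarrow> eval P \<nu> s (u @ v) = eval P \<nu> s u \<otimes>\<^bsub>P\<^esub> eval P \<nu> s v"
proof (induction u)
  case (Cons a u)
  obtain x b where "a = (x, b)" by (cases a)
  then show ?case using Cons rep_vertex_closed rep_edge_closed eval_closed[of u] eval_closed[of v]
    by (cases x) (auto simp: eval_Cons Let_def P.m_assoc)
qed (simp add: eval_closed)

text \<open>On \<open>words\<close> all letter values lie in the carrier, where inverses cancel;
  \<open>eqv_words\<close> keeps the symmetric, transitive and context steps of the induction within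
  \<open>words\<close>.\<close>

lemma eval_eqv:
  assumes "eqv u v" "u \<in> words"
  shows "eval P \<nu> s u = eval P \<nu> s v"
  using assms
proof (induction rule: rel_cong.induct)
  case (base u v)
  have \<nu>m: "\<nu> v (g \<otimes>\<^bsub>Gv v\<^esub> h) = \<nu> v g \<otimes>\<^bsub>P\<^esub> \<nu> v h" if "v \<in> V" "g \<in> carrier (Gv v)" "h \<in> carrier (Gv v)" for v g h
    using rep that by (simp add: rep_def hom_def)
  have \<nu>1: "\<nu> v \<one>\<^bsub>Gv v\<^esub> = \<one>\<^bsub>P\<^esub>" if "v \<in> V" for v
    using rep that grpv[OF that] P.is_group by (simp add: rep_def hom_one)
  have sb: "s (bar e) = inv\<^bsub>P\<^esub> s e" if "e \<in> E" for e using rep that by (simp add: rep_def)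
  have conj: "s e \<otimes>\<^bsub>P\<^esub> (\<nu> (tau e) (f e a) \<otimes>\<^bsub>P\<^esub> inv\<^bsub>P\<^esub> s e) = \<nu> (tau (bar e)) (f (bar e) a)"
    if "e \<in> E" "a \<in> carrier (Ge e)" for e a
  proof -
    have c: "\<nu> (tau e) (f e a) \<in> carrier P" "\<nu> (tau (bar e)) (f (bar e) a) \<in> carrier P" "s e \<in> carrier P"
      using that rep_vertex_closed rep_edge_closed f_closed f_bar_closed tau bar(1) by auto
    have "s e \<otimes>\<^bsub>P\<^esub> \<nu> (tau e) (f e a) = \<nu> (tau (bar e)) (f (bar e) a) \<otimes>\<^bsub>P\<^esub> s e" using rep that by (simp add: rep_def)
    then have "s e \<otimes>\<^bsub>P\<^esub> \<nu> (tau e) (f e a) \<otimes>\<^bsub>P\<^esub> inv\<^bsub>P\<^esub> s e = \<nu> (tau (bar e)) (f (bar e) a) \<otimes>\<^bsub>P\<^esub> s e \<otimes>\<^bsub>P\<^esub> inv\<^bsub>P\<^esub> s e"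
      by simp
    then show ?thesis using c by (simp add: P.m_assoc)
  qed
  have cancel: "y \<otimes>\<^bsub>P\<^esub> (inv\<^bsub>P\<^esub> y \<otimes>\<^bsub>P\<^esub> \<one>\<^bsub>P\<^esub>) = \<one>\<^bsub>P\<^esub>" "inv\<^bsub>P\<^esub> y \<otimes>\<^bsub>P\<^esub> (y \<otimes>\<^bsub>P\<^esub> \<one>\<^bsub>P\<^esub>) = \<one>\<^bsub>P\<^esub>" if "y \<in> carrier P" for y
    using that by simp_all
  have letter: "(case x of Inl (v, g) \<Rightarrow> \<nu> v g | Inr e \<Rightarrow> s e) \<in> carrier P" if "x \<in> gog_generators V E Gv" for x
    using that rep_vertex_closed rep_edge_closed by (cases x) auto
  from base show ?case
    unfolding gog_relations_def
  proof (elim UnE, goal_cases)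
    case 1 then show ?case using letter by (auto simp: eval_Cons Let_def)
  next
    case 2 then show ?case using letter by (auto simp: eval_Cons Let_def)
  next
    case 3 then show ?case using rep_vertex_closed by (auto simp: eval_Cons Let_def \<nu>m P.m_assoc)
  next
    case 4 then show ?case by (auto simp: eval_Cons Let_def \<nu>1)
  next
    case 5 then show ?case by (auto simp: eval_Cons Let_def sb)
  next
    case 6
    then show ?case
      using conj rep_vertex_closed rep_edge_closed f_bar_closed tau bar(1) by (auto simp: eval_Cons Let_def)
  qed
next
  case (sym u v)
  then show ?case using eqv_words by metis
next
  case (trans u v w)
  then show ?case using eqv_words by metis
next
  case (ctxt u v a b)
  then show ?case using eqv_words[of u v] by (simp add: eval_append)
qed simp

lemma eval_cls: assumes "w \<in> words" shows "eval_cls P \<nu> s (cls w) = eval P \<nu> s w"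
proof -
  have "(SOME x. x \<in> cls w) \<in> cls w" using cls_self[OF assms] by (rule someI)
  then have "eqv w (SOME x. x \<in> cls w)" by (simp add: cls_def)
  then show ?thesis unfolding eval_cls_def using eval_eqv assms by metis
qed

lemma eval_cls_hom: "eval_cls P \<nu> s \<in> hom (FG v0) P"
  by (rule homI) (auto simp: carrier_FG eval_cls eval_closed mult_FG eval_append dest!: path_word_words)

end

end

section \<open>Virtual residual p-finiteness\<close>

lemma carrier_BijGroup: "carrier (BijGroup S) = Bij S"
  and one_BijGroup: "\<one>\<^bsub>BijGroup S\<^esub> = (\<lambda>x\<in>S. x)"
  by (simp_all add: BijGroup_def)

lemma BijGroup_mult_apply:
  "a \<in> carrier (BijGroup S) \<Longrightarrow> b \<in> carrier (BijGroup S) \<Longrightarrow> z \<in> S \<Longrightarrow> (a \<otimes>\<^bsub>BijGroup S\<^esub> b) z = a (b z)"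
  by (simp add: BijGroup_def compose_def)

lemma BijGroup_eqI:
  "a \<in> carrier (BijGroup S) \<Longrightarrow> b \<in> carrier (BijGroup S) \<Longrightarrow> (\<And>z. z \<in> S \<Longrightarrow> a z = b z) \<Longrightarrow> a = b"
  unfolding carrier_BijGroup by (rule extensionalityI[OF Bij_imp_extensional Bij_imp_extensional])

lemma restrict_in_BijGroup:
  assumes "\<And>z. z \<in> S \<Longrightarrow> a z \<in> S" "\<And>z. z \<in> S \<Longrightarrow> b z \<in> S" "\<And>z. z \<in> S \<Longrightarrow> b (a z) = z" "\<And>z. z \<in> S \<Longrightarrow> a (b z) = z"
  shows "(\<lambda>z\<in>S. a z) \<in> carrier (BijGroup S)"
proof -
  have "bij_betw (\<lambda>z\<in>S. a z) S S"
    by (rule bij_betwI[of _ _ _ b]) (use assms in auto)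
  then show ?thesis by (simp add: carrier_BijGroup Bij_def)
qed

lemma finite_BijGroup: "finite S \<Longrightarrow> finite (carrier (BijGroup S))"
proof -
  assume S: "finite S"
  have "Bij S \<subseteq> S \<rightarrow>\<^sub>E S"
    unfolding PiE_def by (intro subsetI IntI Bij_imp_funcset Bij_imp_extensional)
  moreover have "finite (S \<rightarrow>\<^sub>E S)" using S by (intro finite_PiE) auto
  ultimately show ?thesis unfolding carrier_BijGroup by (rule finite_subset)
qed

text \<open>First isomorphism theorem: the cosets of a kernel embed into the finite target.\<close>

lemma finite_rcosets_kernel:
  assumes "group_hom G L h" "finite (carrier L)"
  shows "finite (rcosets\<^bsub>G\<^esub> (kernel G L h))"
proof -
  interpret group_hom G L h by fact
  have "(\<lambda>c. the_elem (h ` c)) ` carrier (G Mod kernel G L h) \<subseteq> carrier L"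
    using FactGroup_the_elem_mem by blast
  then have "finite (carrier (G Mod kernel G L h))"
    using FactGroup_inj_on assms(2) by (meson finite_imageD finite_subset)
  then show ?thesis by (simp add: FactGroup_def)
qed

context clean_gog
begin

section \<open>The permutation representation on Omega U times U\<close>

abbreviation points :: "('c, 'm) monoid_scheme \<Rightarrow> (('v \<times> bool \<Rightarrow> 'a \<Rightarrow> 'c) \<times> 'c) set" where
  "points U \<equiv> Omega U \<times> carrier U"

abbreviation Sym :: "('c, 'm) monoid_scheme \<Rightarrow> (('v \<times> bool \<Rightarrow> 'a \<Rightarrow> 'c) \<times> 'c \<Rightarrow> ('v \<times> bool \<Rightarrow> 'a \<Rightarrow> 'c) \<times> 'c) monoid" where
  "Sym U \<equiv> BijGroup (points U)"

text \<open>The vertex groups act through the copy \<open>False\<close>; the copy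
  \<open>True\<close> holds what the edge permutations exchange with it.\<close>

definition vrep where "vrep U v g = (\<lambda>z\<in>points U. (fst z, fst z (v, False) g \<otimes>\<^bsub>U\<^esub> snd z))"
text \<open>The index is \<open>bar e\<close> because then the first clause of
  \<open>swapped\<close> becomes the edge relation of the path group.\<close>

definition erep where "erep U e = (\<lambda>z\<in>points U. (act U (bar e) (fst z), snd z))"

text \<open>A skew product over \<open>Omega U\<close>: the second coordinate is multiplied on the
  left by an element depending on the first coordinate only. Composition preserves this form, and it
  allows torsion to be bounded first on the base and then on the fibres.\<close>

definition skew where
  "skew U T a \<longleftrightarrow> a \<in> carrier (Sym U) \<and> T \<in> Omega U \<rightarrow> Omega U \<and>
     (\<exists>c. \<forall>\<rho>\<in>Omega U. c \<rho> \<in> carrier U \<and> (\<forall>x\<in>carrier U. a (\<rho>, x) = (T \<rho>, c \<rho> \<otimes>\<^bsub>U\<^esub> x)))"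

lemma finite_Sym: "group U \<Longrightarrow> finite (carrier U) \<Longrightarrow> finite (carrier (Sym U))"
  by (intro finite_BijGroup finite_cartesian_product finite_Omega)

lemma skew_vrep:
  assumes U: "group U" and v: "v \<in> V" and g: "g \<in> carrier (Gv v)"
  shows "skew U id (vrep U v g)"
proof -
  interpret U: group U by fact
  interpret G: group "Gv v" by (rule grpv[OF v])
  have inv: "\<rho> (v, False) (inv\<^bsub>Gv v\<^esub> g) = inv\<^bsub>U\<^esub> (\<rho> (v, False) g)" if "\<rho> \<in> Omega U" for \<rho>
    using Omega_hom[OF that v] g group_hom.hom_inv[of "Gv v" U "\<rho> (v, False)" g]
    by (simp add: group_hom_def group_hom_axioms_def U G.is_group)
  have "vrep U v g \<in> carrier (Sym U)"
    unfolding vrep_def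
    by (rule restrict_in_BijGroup[where b = "\<lambda>z. (fst z, fst z (v, False) (inv\<^bsub>Gv v\<^esub> g) \<otimes>\<^bsub>U\<^esub> snd z)"])
      (auto simp: inv Omega_closed v g U.m_assoc[symmetric])
  then show ?thesis
    unfolding skew_def using v g by (auto simp: vrep_def Omega_closed intro!: exI[of _ "\<lambda>\<rho>. \<rho> (v, False) g"])
qed

lemma skew_erep:
  assumes U: "group U" and e: "e \<in> E"
  shows "skew U (act U (bar e)) (erep U e)"
proof -
  interpret U: group U by fact
  have "erep U e \<in> carrier (Sym U)"
    unfolding erep_def
    by (rule restrict_in_BijGroup[where b = "\<lambda>z. (act U e (fst z), snd z)"])
      (use act_closed[OF U] act_bar_act[OF U] act_bar_act[OF U bar(1)[OF e]] bar[OF e] e in auto)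
  then show ?thesis
    unfolding skew_def using act_closed[OF U bar(1)[OF e]]
    by (auto simp: erep_def intro!: exI[of _ "\<lambda>_. \<one>\<^bsub>U\<^esub>"])
qed

lemma skew_one: "group U \<Longrightarrow> skew U id \<one>\<^bsub>Sym U\<^esub>"
  unfolding skew_def using monoid.one_closed[OF group.is_monoid[OF group_BijGroup[of "points U"]]]
  by (auto simp: one_BijGroup group.is_monoid monoid.one_closed monoid.l_one intro!: exI[of _ "\<lambda>_. \<one>\<^bsub>U\<^esub>"])

lemma skew_mult:
  assumes U: "group U" and a: "skew U T a" and b: "skew U T' b"
  shows "skew U (T \<circ> T') (a \<otimes>\<^bsub>Sym U\<^esub> b)"
proof -
  interpret U: group U by fact
  interpret S: group "Sym U" by (rule group_BijGroup)
  have ab: "a \<in> carrier (Sym U)" "b \<in> carrier (Sym U)" and T: "T' \<in> Omega U \<rightarrow> Omega U" "T \<in> Omega U \<rightarrow> Omega U"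
    using a b by (auto simp: skew_def)
  obtain c where c: "\<And>\<rho>. \<rho> \<in> Omega U \<Longrightarrow> c \<rho> \<in> carrier U"
    "\<And>\<rho> x. \<rho> \<in> Omega U \<Longrightarrow> x \<in> carrier U \<Longrightarrow> a (\<rho>, x) = (T \<rho>, c \<rho> \<otimes>\<^bsub>U\<^esub> x)"
    using a unfolding skew_def by blast
  obtain c' where c': "\<And>\<rho>. \<rho> \<in> Omega U \<Longrightarrow> c' \<rho> \<in> carrier U"
    "\<And>\<rho> x. \<rho> \<in> Omega U \<Longrightarrow> x \<in> carrier U \<Longrightarrow> b (\<rho>, x) = (T' \<rho>, c' \<rho> \<otimes>\<^bsub>U\<^esub> x)"
    using b unfolding skew_def by blast
  have T': "T' \<rho> \<in> Omega U" if "\<rho> \<in> Omega U" for \<rho> using T(1) that by blast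
  have "(a \<otimes>\<^bsub>Sym U\<^esub> b) (\<rho>, x) = (T (T' \<rho>), (c (T' \<rho>) \<otimes>\<^bsub>U\<^esub> c' \<rho>) \<otimes>\<^bsub>U\<^esub> x)"
    if "\<rho> \<in> Omega U" "x \<in> carrier U" for \<rho> x
    using BijGroup_mult_apply[OF ab, of "(\<rho>, x)"] that c c' T' by (simp add: U.m_assoc)
  moreover have "c (T' \<rho>) \<otimes>\<^bsub>U\<^esub> c' \<rho> \<in> carrier U" if "\<rho> \<in> Omega U" for \<rho> using c c' T' that by simp
  moreover have "a \<otimes>\<^bsub>Sym U\<^esub> b \<in> carrier (Sym U)" using ab by simp
  ultimately show ?thesis
    unfolding skew_def using T by (auto intro!: exI[of _ "\<lambda>\<rho>. c (T' \<rho>) \<otimes>\<^bsub>U\<^esub> c' \<rho>"])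
qed

lemma skew_pow:
  assumes U: "group U" and a: "skew U T a"
  shows "skew U (T ^^ n) (a [^]\<^bsub>Sym U\<^esub> n)"
proof (induction n)
  case (Suc n)
  interpret S: group "Sym U" by (rule group_BijGroup)
  have "a [^]\<^bsub>Sym U\<^esub> Suc n = a [^]\<^bsub>Sym U\<^esub> n \<otimes>\<^bsub>Sym U\<^esub> a" by simp
  then show ?case
    using skew_mult[OF U Suc a] by (simp only: funpow_Suc_right)
qed (use skew_one[OF U] in \<open>simp add: id_def\<close>)

text \<open>Once \<open>n\<close> iterations fix the base, each fibre undergoes left multiplication
  by one element of \<open>U\<close>, and the order of \<open>U\<close> kills that.\<close>

lemma skew_torsion:
  assumes U: "group U" and a: "skew U T a" and T: "\<And>\<rho>. \<rho> \<in> Omega U \<Longrightarrow> (T ^^ n) \<rho> = \<rho>"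
  shows "a [^]\<^bsub>Sym U\<^esub> (n * order U) = \<one>\<^bsub>Sym U\<^esub>"
proof -
  interpret U: group U by fact
  interpret S: group "Sym U" by (rule group_BijGroup)
  define b where "b = a [^]\<^bsub>Sym U\<^esub> n"
  have aS: "a \<in> carrier (Sym U)" using a by (simp add: skew_def)
  then have bS: "b \<in> carrier (Sym U)" by (simp add: b_def)
  obtain c where c: "\<And>\<rho>. \<rho> \<in> Omega U \<Longrightarrow> c \<rho> \<in> carrier U"
    "\<And>\<rho> x. \<rho> \<in> Omega U \<Longrightarrow> x \<in> carrier U \<Longrightarrow> b (\<rho>, x) = (\<rho>, c \<rho> \<otimes>\<^bsub>U\<^esub> x)"
    using skew_pow[OF U a, of n] T unfolding skew_def b_def by fastforce
  have "(b [^]\<^bsub>Sym U\<^esub> m) (\<rho>, x) = (\<rho>, c \<rho> [^]\<^bsub>U\<^esub> m \<otimes>\<^bsub>U\<^esub> x)" if "\<rho> \<in> Omega U" "x \<in> carrier U" for m :: nat and \<rho> x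
    using that
  proof (induction m arbitrary: x)
    case 0
    then show ?case by (simp add: one_BijGroup)
  next
    case (Suc m)
    have "(b [^]\<^bsub>Sym U\<^esub> Suc m) (\<rho>, x) = (b [^]\<^bsub>Sym U\<^esub> m) (b (\<rho>, x))"
      using BijGroup_mult_apply[OF S.nat_pow_closed[OF bS] bS, of "(\<rho>, x)"] Suc.prems by simp
    then show ?case using Suc c by (simp add: U.m_assoc)
  qed
  then have "(b [^]\<^bsub>Sym U\<^esub> order U) z = \<one>\<^bsub>Sym U\<^esub> z" if "z \<in> points U" for z
    using that c(1) U.pow_order_eq_1 by (auto simp: one_BijGroup)
  then have "b [^]\<^bsub>Sym U\<^esub> order U = \<one>\<^bsub>Sym U\<^esub>"
    using bS by (intro BijGroup_eqI) auto
  then show ?thesis using aS by (simp add: b_def S.nat_pow_pow)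
qed

lemma rep_Sym:
  assumes U: "group U"
  shows "rep (Sym U) (vrep U) (erep U)"
  unfolding rep_def
proof (intro conjI ballI)
  interpret U: group U by fact
  interpret S: group "Sym U" by (rule group_BijGroup)
  show "group (Sym U)" by (rule group_BijGroup)
  have vS: "vrep U v g \<in> carrier (Sym U)" if "v \<in> V" "g \<in> carrier (Gv v)" for v g
    using skew_vrep[OF U that] by (simp add: skew_def)
  have eS: "erep U e \<in> carrier (Sym U)" if "e \<in> E" for e
    using skew_erep[OF U that] by (simp add: skew_def)
  show "vrep U v \<in> hom (Gv v) (Sym U)" if v: "v \<in> V" for v
  proof (rule homI)
    fix g h assume gh: "g \<in> carrier (Gv v)" "h \<in> carrier (Gv v)"
    have ghc: "g \<otimes>\<^bsub>Gv v\<^esub> h \<in> carrier (Gv v)" using gh grpv[OF v] by (simp add: group.is_monoid monoid.m_closed)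
    show "vrep U v (g \<otimes>\<^bsub>Gv v\<^esub> h) = vrep U v g \<otimes>\<^bsub>Sym U\<^esub> vrep U v h"
    proof (rule BijGroup_eqI[OF vS[OF v ghc] S.m_closed[OF vS[OF v gh(1)] vS[OF v gh(2)]]])
      fix z assume "z \<in> points U"
      then obtain \<rho> x where z: "z = (\<rho>, x)" "\<rho> \<in> Omega U" "x \<in> carrier U" by auto
      show "vrep U v (g \<otimes>\<^bsub>Gv v\<^esub> h) z = (vrep U v g \<otimes>\<^bsub>Sym U\<^esub> vrep U v h) z"
        using BijGroup_mult_apply[OF vS[OF v gh(1)] vS[OF v gh(2)], of z] z Omega_closed[OF z(2) v gh(1)]
          Omega_closed[OF z(2) v gh(2)] Omega_mult[OF z(2) v gh]
        by (simp add: vrep_def U.m_assoc)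
    qed
  qed (rule vS[OF v])
  fix e assume e: "e \<in> E"
  have eb: "bar e \<in> E" using bar e by blast
  show "erep U e \<in> carrier (Sym U)" by (rule eS[OF e])
  have "erep U (bar e) \<otimes>\<^bsub>Sym U\<^esub> erep U e = \<one>\<^bsub>Sym U\<^esub>"
  proof (rule BijGroup_eqI[OF S.m_closed[OF eS[OF eb] eS[OF e]] S.one_closed])
    fix z assume "z \<in> points U"
    then obtain \<rho> x where z: "z = (\<rho>, x)" "\<rho> \<in> Omega U" "x \<in> carrier U" by auto
    show "(erep U (bar e) \<otimes>\<^bsub>Sym U\<^esub> erep U e) z = \<one>\<^bsub>Sym U\<^esub> z"
      using BijGroup_mult_apply[OF eS[OF eb] eS[OF e], of z] z act_closed[OF U eb z(2)] act_bar_act[OF U eb z(2)]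
      by (simp add: erep_def one_BijGroup)
  qed
  then show "erep U (bar e) = inv\<^bsub>Sym U\<^esub> erep U e" using eS e eb S.inv_equality by metis
  fix a assume a: "a \<in> carrier (Ge e)"
  note fa = f_closed[OF e a] and fba = f_bar_closed[OF e a]
  note te = tau[OF e] and tb = tau[OF eb]
  show "erep U e \<otimes>\<^bsub>Sym U\<^esub> vrep U (tau e) (f e a) = vrep U (tau (bar e)) (f (bar e) a) \<otimes>\<^bsub>Sym U\<^esub> erep U e"
  proof (rule BijGroup_eqI[OF S.m_closed[OF eS[OF e] vS[OF te fa]] S.m_closed[OF vS[OF tb fba] eS[OF e]]])
    fix z assume "z \<in> points U"
    then obtain \<rho> x where z: "z = (\<rho>, x)" "\<rho> \<in> Omega U" "x \<in> carrier U" by auto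
    have ac: "act U (bar e) \<rho> \<in> Omega U" by (rule act_closed[OF U eb z(2)])
    have "act U (bar e) \<rho> (tau (bar e), False) (f (bar e) a) = \<rho> (tau e, False) (f e a)"
      using swapped_act[OF U eb z(2)] a e unfolding swapped_def by (simp add: Ge_bar bar)
    then show "(erep U e \<otimes>\<^bsub>Sym U\<^esub> vrep U (tau e) (f e a)) z = (vrep U (tau (bar e)) (f (bar e) a) \<otimes>\<^bsub>Sym U\<^esub> erep U e) z"
      using BijGroup_mult_apply[OF eS[OF e] vS[OF te fa], of z] BijGroup_mult_apply[OF vS[OF tb fba] eS[OF e], of z]
        z ac Omega_closed[OF z(2) te fa]
      by (simp add: erep_def vrep_def)
  qed
qed

text \<open>Vertex letters are the identity on the base, so only the edges of the path determine the
  permutation of \<open>Omega U\<close>.\<close>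

lemma skew_eval_path:
  assumes U: "group U" and "u \<in> V" "g \<in> carrier (Gv u)" "valid u l v"
  shows "skew U (foldr (\<lambda>e. act U (bar e)) (map fst l)) (eval (Sym U) (vrep U) (erep U) (path u g l))"
proof -
  have "skew U (foldr (\<lambda>e. act U (bar e)) (map fst l)) (eval (Sym U) (vrep U) (erep U) (tail_word l))"
    using assms(4)
  proof (induction u l v rule: valid.induct)
    case (1 u v)
    then show ?case using skew_one[OF U] by (simp add: id_def)
  next
    case (2 u e g l v)
    have "skew U (act U (bar e) \<circ> (id \<circ> foldr (\<lambda>e. act U (bar e)) (map fst l)))
      (erep U e \<otimes>\<^bsub>Sym U\<^esub> (vrep U (tau e) g \<otimes>\<^bsub>Sym U\<^esub> eval (Sym U) (vrep U) (erep U) (tail_word l)))"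
      by (intro skew_mult[OF U] skew_erep[OF U] skew_vrep[OF U] 2 tau) (use 2 in auto)
    then show ?case by (simp add: eval_Cons Let_def comp_def)
  qed
  then have "skew U (id \<circ> foldr (\<lambda>e. act U (bar e)) (map fst l))
      (vrep U u g \<otimes>\<^bsub>Sym U\<^esub> eval (Sym U) (vrep U) (erep U) (tail_word l))"
    by (intro skew_mult[OF U] skew_vrep[OF U] assms)
  then show ?thesis by (simp add: path_def eval_Cons Let_def)
qed

lemma valid_elems: "valid u l v \<Longrightarrow> (e, h) \<in> set l \<Longrightarrow> e \<in> E \<and> h \<in> carrier (Gv (tau e))"
  by (induction u l v rule: valid.induct) auto

lemma valid_edges: "valid u l v \<Longrightarrow> set (map fst l) \<subseteq> E"
  by (induction u l v rule: valid.induct) auto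

text \<open>One factor \<open>p ^ k\<close> comes from \<open>moves_torsion\<close> on the base, the
  other is the order of \<open>U\<close> acting on the fibres.\<close>

lemma eval_path_torsion:
  fixes U :: "nat monoid"
  assumes p: "Factorial_Ring.prime p" and U: "group U" "finite (carrier U)" "card (carrier U) = p ^ k"
    and path: "u \<in> V" "g \<in> carrier (Gv u)" "valid u l v"
    and triv: "eval (Sym (integer_mod_group p)) (vrep (integer_mod_group p)) (erep (integer_mod_group p)) (path u g l) =
      \<one>\<^bsub>Sym (integer_mod_group p)\<^esub>"
  shows "eval (Sym U) (vrep U) (erep U) (path u g l) [^]\<^bsub>Sym U\<^esub> (p ^ (k + k)) = \<one>\<^bsub>Sym U\<^esub>"
proof -
  let ?Z = "integer_mod_group p"
  have es: "set (map fst l) \<subseteq> E" by (rule valid_edges[OF path(3)])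
  have "moves ?Z (map fst l) 1 \<zeta> = \<zeta>" if \<zeta>: "\<zeta> \<in> Omega ?Z" for \<zeta>
  proof -
    \<comment> \<open>Reading the identity permutation at the fibre element 0 shows that its base
      part is trivial.\<close>
    have "skew ?Z (foldr (\<lambda>e. act ?Z (bar e)) (map fst l)) \<one>\<^bsub>Sym ?Z\<^esub>"
      using skew_eval_path[OF group_integer_mod_group path, of p] by (simp only: triv)
    moreover have "0 \<in> carrier ?Z" by simp
    ultimately have "fst (\<one>\<^bsub>Sym ?Z\<^esub> (\<zeta>, 0)) = foldr (\<lambda>e. act ?Z (bar e)) (map fst l) \<zeta>"
      unfolding skew_def using \<zeta> by (metis fst_conv)
    then show ?thesis using \<zeta> by (simp add: one_BijGroup moves_def)
  qed
  then have "(foldr (\<lambda>e. act U (bar e)) (map fst l) ^^ (p ^ k)) \<rho> = \<rho>" if "\<rho> \<in> Omega U" for \<rho>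
    using moves_torsion[OF p es _ U that] by (simp add: moves_def)
  then have "eval (Sym U) (vrep U) (erep U) (path u g l) [^]\<^bsub>Sym U\<^esub> (p ^ k * order U) = \<one>\<^bsub>Sym U\<^esub>"
    by (rule skew_torsion[OF U(1) skew_eval_path[OF U(1) path]])
  then show ?thesis by (simp add: order_def U(3) power_add)
qed

text \<open>Every homomorphism \<open>\<mu>\<close> occurs as a coordinate of some point of
  \<open>Omega U\<close>, completed by trivial homomorphisms at the other vertices; at the fibre
  element 1 the permutation reveals the value of \<open>\<mu>\<close>.\<close>

lemma vrep_eqD:
  assumes U: "group U" and v: "v \<in> V" and g: "g \<in> carrier (Gv v)" "h \<in> carrier (Gv v)"
    and eq: "vrep U v g = vrep U v h" and \<mu>: "\<mu> \<in> hom (Gv v) U"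
  shows "\<mu> g = \<mu> h"
proof -
  interpret U: group U by fact
  define m where "m w (i :: bool) = (if w = v then \<mu> else (\<lambda>_. \<one>\<^bsub>U\<^esub>))" for w i
  define \<rho> where "\<rho> = (\<lambda>z\<in>V \<times> UNIV. \<lambda>g\<in>carrier (Gv (fst z)). m (fst z) (snd z) g)"
  have \<rho>: "\<rho> \<in> Omega U"
    unfolding \<rho>_def
  proof (rule Omega_I)
    have "(\<lambda>_. \<one>\<^bsub>U\<^esub>) \<in> hom (Gv w) U" for w by (simp add: hom_def)
    then show "m w i \<in> hom (Gv w) U" for w i using \<mu> by (simp add: m_def)
  qed
  have "\<rho> (v, False) x = \<mu> x" if "x \<in> carrier (Gv v)" for x
    using v that by (simp add: \<rho>_def m_def)
  moreover have "\<mu> x \<in> carrier U" if "x \<in> carrier (Gv v)" for x using \<mu> that by (auto simp: hom_def)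
  ultimately show ?thesis
    using fun_cong[OF eq, of "(\<rho>, \<one>\<^bsub>U\<^esub>)"] \<rho> g by (simp add: vrep_def)
qed

lemma A_closed: "e \<in> E \<Longrightarrow> x \<in> A e \<Longrightarrow> x \<in> carrier (Gv (tau e))"
  using f_closed by auto

definition retraction :: "'e \<Rightarrow> 'a \<Rightarrow> 'a" where
  "retraction e = (SOME r. r \<in> hom (Gv (tau e)) (Gv (tau e)) \<and> (\<forall>x\<in>A e. r x = x) \<and> (\<forall>x\<in>carrier (Gv (tau e)). r x \<in> A e))"

text \<open>Supplied by the universal property of the free product: the identity on
  \<open>A e\<close> and the trivial map on \<open>K e\<close>.\<close>

lemma retraction:
  assumes e: "e \<in> E"
  shows "retraction e \<in> hom (Gv (tau e)) (Gv (tau e))" "x \<in> A e \<Longrightarrow> retraction e x = x"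
    "y \<in> carrier (Gv (tau e)) \<Longrightarrow> retraction e y \<in> A e"
proof -
  let ?G = "Gv (tau e)"
  have G: "group ?G" by (rule grpv[OF tau[OF e]])
  let ?B = "?G\<lparr>carrier := A e\<rparr>"
  have B: "group ?B" by (rule subgroup.subgroup_is_group[OF subgroup_A[OF e] G])
  interpret B: group ?B by (rule B)
  have 1: "id \<in> hom (?G\<lparr>carrier := A e\<rparr>) ?B" by (auto simp: hom_def)
  have 2: "(\<lambda>_. \<one>\<^bsub>?B\<^esub>) \<in> hom (?G\<lparr>carrier := K e\<rparr>) ?B"
    by (rule homI) (use B.one_closed B.l_one[OF B.one_closed] in auto)
  obtain r where r: "r \<in> hom ?G ?B" "\<forall>x\<in>A e. r x = id x" "\<forall>x\<in>K e. r x = \<one>\<^bsub>?B\<^esub>"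
    by (rule free_product_extend[OF G B K[OF e] 1 2])
  have "r \<in> hom ?G ?G" "\<forall>x\<in>carrier ?G. r x \<in> A e"
    using r(1) f_closed[OF e] by (auto simp: hom_def Pi_iff)
  then have "\<exists>r. r \<in> hom ?G ?G \<and> (\<forall>x\<in>A e. r x = x) \<and> (\<forall>x\<in>carrier ?G. r x \<in> A e)"
    using r(2) by auto
  then have "retraction e \<in> hom ?G ?G \<and> (\<forall>x\<in>A e. retraction e x = x) \<and> (\<forall>x\<in>carrier ?G. retraction e x \<in> A e)"
    unfolding retraction_def by (rule someI_ex)
  then show "retraction e \<in> hom ?G ?G" "x \<in> A e \<Longrightarrow> retraction e x = x"
    "y \<in> carrier ?G \<Longrightarrow> retraction e y \<in> A e" by blast+
qed

text \<open>If \<open>h\<close> acted like some \<open>a\<close> in \<open>A e\<close>, both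
  \<open>\<mu>\<close> and its composite with the retraction would send \<open>h\<close> to the
  value of \<open>\<mu>\<close> at \<open>a\<close>. Thus avoiding a whole subgroup reduces to
  detecting one element, the inverse of \<open>h\<close> times its retraction.\<close>

lemma vrep_notin:
  assumes U: "group U" and e: "e \<in> E" and h: "h \<in> carrier (Gv (tau e))"
    and \<mu>: "\<mu> \<in> hom (Gv (tau e)) U" "\<mu> (inv\<^bsub>Gv (tau e)\<^esub> h \<otimes>\<^bsub>Gv (tau e)\<^esub> retraction e h) \<noteq> \<one>\<^bsub>U\<^esub>"
  shows "vrep U (tau e) h \<notin> vrep U (tau e) ` A e"
proof
  interpret U: group U by fact
  interpret G: group "Gv (tau e)" by (rule grpv[OF tau[OF e]])
  interpret \<mu>: group_hom "Gv (tau e)" U \<mu>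
    using \<mu>(1) by (simp add: group_hom_def group_hom_axioms_def U G.is_group)
  assume "vrep U (tau e) h \<in> vrep U (tau e) ` A e"
  then obtain a where a: "a \<in> A e" "vrep U (tau e) h = vrep U (tau e) a" by blast
  have aG: "a \<in> carrier (Gv (tau e))" by (rule A_closed[OF e a(1)])
  have rh: "retraction e h \<in> carrier (Gv (tau e))" by (rule A_closed[OF e retraction(3)[OF e h]])
  have "\<mu> h = \<mu> a" by (rule vrep_eqD[OF U tau[OF e] h aG a(2) \<mu>(1)])
  moreover have "(\<mu> \<circ> retraction e) h = (\<mu> \<circ> retraction e) a"
    by (rule vrep_eqD[OF U tau[OF e] h aG a(2) hom_compose[OF retraction(1)[OF e] \<mu>(1)]])
  ultimately have "\<mu> (retraction e h) = \<mu> h" using retraction(2)[OF e a(1)] by simp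
  then show False using \<mu>(2) h rh by simp
qed

text \<open>The edge permutations themselves serve as the images \<open>t e\<close> of the stable
  letters. The associated subgroup is the edge group at the origin of \<open>e\<close>, hence the
  index \<open>bar e\<close>.\<close>

lemma hnn_data_Sym:
  assumes U: "group U" "finite (carrier U)"
  shows "hnn_data (Sym U) E bar (erep U) (\<lambda>e. vrep U (tau (bar e)) ` A (bar e))"
proof -
  interpret S: group "Sym U" by (rule group_BijGroup)
  note r = rep_Sym[OF U(1)]
  have sub: "subgroup (vrep U (tau e) ` A e) (Sym U)" if "e \<in> E" for e
    using group_hom.subgroup_img_is_subgroup[OF _ subgroup_A[OF that], of "Sym U" "vrep U (tau e)"]
      r tau[OF that] grpv[OF tau[OF that]] by (simp add: rep_def group_hom_def group_hom_axioms_def)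
  have conj: "erep U e \<otimes>\<^bsub>Sym U\<^esub> vrep U (tau e) (f e a) \<otimes>\<^bsub>Sym U\<^esub> inv\<^bsub>Sym U\<^esub> erep U e = vrep U (tau (bar e)) (f (bar e) a)"
    if "e \<in> E" "a \<in> carrier (Ge e)" for e a
  proof -
    have "erep U e \<in> carrier (Sym U)" "vrep U (tau (bar e)) (f (bar e) a) \<in> carrier (Sym U)"
      using rep_edge_closed[OF r] rep_vertex_closed[OF r] that f_bar_closed tau bar by auto
    moreover have "erep U e \<otimes>\<^bsub>Sym U\<^esub> vrep U (tau e) (f e a) = vrep U (tau (bar e)) (f (bar e) a) \<otimes>\<^bsub>Sym U\<^esub> erep U e"
      using r that by (simp add: rep_def)
    ultimately show ?thesis by (simp add: S.m_assoc)
  qed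
  show ?thesis
  proof (rule hnn_data.intro)
    show "group (Sym U)" by (rule group_BijGroup)
    show "finite (carrier (Sym U))" by (rule finite_Sym[OF U])
    show "finite E" by (rule finE)
    fix e assume e: "e \<in> E"
    show "bar e \<in> E" "bar e \<noteq> e" "bar (bar e) = e" using bar e by auto
    show "erep U e \<in> carrier (Sym U)" "erep U (bar e) = inv\<^bsub>Sym U\<^esub> erep U e"
      using r e by (auto simp: rep_def)
    show "subgroup (vrep U (tau (bar e)) ` A (bar e)) (Sym U)" using sub bar(1)[OF e] by blast
    fix c assume "c \<in> vrep U (tau (bar (bar e))) ` A (bar (bar e))"
    then obtain a where "a \<in> carrier (Ge e)" "c = vrep U (tau e) (f e a)" using bar(3)[OF e] by auto
    then show "erep U e \<otimes>\<^bsub>Sym U\<^esub> c \<otimes>\<^bsub>Sym U\<^esub> inv\<^bsub>Sym U\<^esub> erep U e \<in> vrep U (tau (bar e)) ` A (bar e)"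
      using conj[OF e] Ge_bar[OF e] by simp
  qed
qed

end

section \<open>The finite index subgroup and its p-quotients\<close>

locale clean_gog_p = clean_gog V E bar tau Gv Ge f
  for V :: "'v set" and E :: "'e set" and bar tau and Gv :: "'v \<Rightarrow> 'a monoid" and Ge :: "'e \<Rightarrow> 'b monoid" and f +
  fixes p :: nat and v0 :: 'v
  assumes p: "Factorial_Ring.prime p" and v0: "v0 \<in> V"
begin

abbreviation Zp where "Zp \<equiv> integer_mod_group p"

definition H where
  "H = kernel (FG v0) (Sym Zp) (eval_cls (Sym Zp) (vrep Zp) (erep Zp))"

lemma hom_Zp: "group_hom (FG v0) (Sym Zp) (eval_cls (Sym Zp) (vrep Zp) (erep Zp))"
  using eval_cls_hom[OF rep_Sym[OF group_integer_mod_group]] group_FG[OF v0] group_BijGroup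
  by (auto simp: group_hom_def group_hom_axioms_def)

lemma subgroup_H: "subgroup H (FG v0)"
  unfolding H_def by (rule group_hom.subgroup_kernel[OF hom_Zp])

lemma finite_index_H: "finite (rcosets\<^bsub>FG v0\<^esub> H)"
proof -
  have "finite (carrier Zp)" using prime_gt_0_nat[OF p] by (simp add: carrier_integer_mod_group)
  then show ?thesis
    unfolding H_def by (intro finite_rcosets_kernel[OF hom_Zp] finite_Sym) simp
qed

text \<open>\<open>U\<close> and the height of the stage are chosen after \<open>Q\<close>, while
  \<open>H\<close> is not. The target is the image of \<open>H\<close> in the stage: the whole stage
  need not be a p-group, but elements of \<open>H\<close> have p-power order in it.\<close>

lemma p_quotient:
  assumes Q: "Q \<in> H" "Q \<noteq> \<one>\<^bsub>FG v0\<^esub>"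
  shows "\<exists>(P :: nat monoid) \<phi> k. group P \<and> finite (carrier P) \<and> card (carrier P) = p ^ k \<and>
    \<phi> \<in> hom (FG v0\<lparr>carrier := H\<rparr>) P \<and> \<phi> ` H = carrier P \<and> \<phi> Q \<noteq> \<one>\<^bsub>P\<^esub>"
proof -
  have HF: "H \<subseteq> carrier (FG v0)" using subgroup_H by (rule subgroup.subset)
  have ex_path: "\<exists>g l. g \<in> carrier (Gv v0) \<and> valid v0 l v0 \<and> Y = cls (path v0 g l)" if "Y \<in> H" for Y
  proof -
    have "Y \<in> carrier (FG v0)" using HF that by blast
    then show ?thesis unfolding carrier_FG path_word_iff by blast
  qed
  obtain g1 l1 where 1: "g1 \<in> carrier (Gv v0)" "valid v0 l1 v0" "Q = cls (path v0 g1 l1)"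
    using ex_path[OF Q(1)] by blast
  obtain g l where gl: "g \<in> carrier (Gv v0)" "valid v0 l v0" "reduced_path l" "eqv (path v0 g1 l1) (path v0 g l)"
    using ex_reduced_path[OF v0 1(1,2)] by blast
  have Qgl: "Q = cls (path v0 g l)"
    using cls_eq_iff[OF path_words[OF v0 1(1,2)] path_words[OF v0 gl(1,2)]] gl(4) 1(3) by simp
  have l_elems: "e \<in> E \<and> h \<in> carrier (Gv (tau e))" if "(e, h) \<in> set l" for e h
    using valid_elems[OF gl(2) that] .
  define x where "x e h = inv\<^bsub>Gv (tau e)\<^esub> h \<otimes>\<^bsub>Gv (tau e)\<^esub> retraction e h" for e h
  \<comment> \<open>\<open>U\<close> must detect the initial element \<open>g\<close>, which decides
    the case of a path without edges, and, for each later vertex element outside its edge group, the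
    element that \<open>vrep_notin\<close> asks for.\<close>
  define xs where "xs = (if g = \<one>\<^bsub>Gv v0\<^esub> then [] else [(v0, g)]) @
    map (\<lambda>(e, h). (tau e, x e h)) (filter (\<lambda>(e, h). h \<notin> A e) l)"
  have xs: "free_group_finite_rank (Gv v) \<and> y \<in> carrier (Gv v) \<and> y \<noteq> \<one>\<^bsub>Gv v\<^esub>" if vy: "(v, y) \<in> set xs" for v y
  proof -
    consider "v = v0" "y = g" "g \<noteq> \<one>\<^bsub>Gv v0\<^esub>"
      | e h where "(e, h) \<in> set l" "h \<notin> A e" "v = tau e" "y = x e h"
      using vy by (auto simp: xs_def split: if_splits)
    then show ?thesis
    proof cases
      case 1
      then show ?thesis using gl(1) v0 free_v by simp
    next
      case 2
      have e: "e \<in> E" "h \<in> carrier (Gv (tau e))" using l_elems[OF 2(1)] by auto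
      interpret G: group "Gv (tau e)" by (rule grpv[OF tau[OF e(1)]])
      have rA: "retraction e h \<in> A e" by (rule retraction(3)[OF e])
      then have rG: "retraction e h \<in> carrier (Gv (tau e))" by (rule A_closed[OF e(1)])
      have "x e h \<noteq> \<one>\<^bsub>Gv (tau e)\<^esub>"
      proof
        assume "x e h = \<one>\<^bsub>Gv (tau e)\<^esub>"
        then have "retraction e h = h" using e(2) rG unfolding x_def by (metis G.inv_closed G.inv_equality G.inv_inv)
        then show False using rA 2(2) by simp
      qed
      then show ?thesis using 2 e rG free_v tau by (simp add: x_def)
    qed
  qed
  obtain U :: "nat monoid" and k where U: "group U" "finite (carrier U)" "card (carrier U) = p ^ k"
    and sepU: "\<forall>(v, y) \<in> set xs. \<exists>\<mu> \<in> hom (Gv v) U. \<mu> y \<noteq> \<one>\<^bsub>U\<^esub>"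
    using p_separated_list[OF p, of xs Gv] xs by blast
  interpret S: group "Sym U" by (rule group_BijGroup)
  interpret hnn_data "Sym U" E bar "erep U" "\<lambda>e. vrep U (tau (bar e)) ` A (bar e)"
    by (rule hnn_data_Sym[OF U(1,2)])
  \<comment> \<open>Britton's lemma will be applied to the image of the path itself, which has
    \<open>length l\<close> stable letters.\<close>
  obtain P :: "nat monoid" and \<iota> \<pi> s where st: "stage p (length l) P \<iota> \<pi> s"
    using ex_stage[of p "length l"] prime_gt_1_nat[OF p] by blast
  interpret st: hnn_step "Sym U" E bar "erep U" "\<lambda>e. vrep U (tau (bar e)) ` A (bar e)" p "length l" P \<iota> \<pi> s
    using st prime_gt_1_nat[OF p] by unfold_locales
  note P = st.grpP st.finP and \<iota> = st.\<iota>hom and \<pi> = st.\<pi>hom and \<pi>\<iota> = st.\<pi>\<iota>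
    and comm = st.s_comm and tors = st.tors and sep = st.sep
  have s: "s e \<in> carrier P \<and> s (bar e) = inv\<^bsub>P\<^esub> s e \<and> \<pi> (s e) = erep U e" if "e \<in> E" for e
    using that by (simp add: st.s_closed st.s_bar st.\<pi>s)
  note rU = rep_Sym[OF U(1)]
  define \<nu> where "\<nu> v y = \<iota> (vrep U v y)" for v y
  have rP: "rep P \<nu> s"
    unfolding rep_def
  proof (intro conjI ballI)
    show "group P" by (rule P(1))
    show "\<nu> v \<in> hom (Gv v) P" if "v \<in> V" for v
    proof -
      have "vrep U v \<in> hom (Gv v) (Sym U)" using rU that by (simp add: rep_def)
      from hom_compose[OF this \<iota>] show ?thesis by (simp add: \<nu>_def[abs_def] comp_def)
    qed
    fix e assume e: "e \<in> E"
    show "s e \<in> carrier P" "s (bar e) = inv\<^bsub>P\<^esub> s e" using s[OF e] by auto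
    fix a assume a: "a \<in> carrier (Ge e)"
    have c: "vrep U (tau (bar e)) (f (bar e) a) \<in> carrier (Sym U)" "erep U e \<in> carrier (Sym U)"
      using rep_vertex_closed[OF rU] rep_edge_closed[OF rU] e a f_bar_closed tau bar by auto
    have "erep U e \<otimes>\<^bsub>Sym U\<^esub> vrep U (tau e) (f e a) = vrep U (tau (bar e)) (f (bar e) a) \<otimes>\<^bsub>Sym U\<^esub> erep U e"
      using rU e a by (simp add: rep_def)
    then have "erep U e \<otimes>\<^bsub>Sym U\<^esub> vrep U (tau e) (f e a) \<otimes>\<^bsub>Sym U\<^esub> inv\<^bsub>Sym U\<^esub> erep U e = vrep U (tau (bar e)) (f (bar e) a)"
      using c by (simp add: S.m_assoc)
    then show "s e \<otimes>\<^bsub>P\<^esub> \<nu> (tau e) (f e a) = \<nu> (tau (bar e)) (f (bar e) a) \<otimes>\<^bsub>P\<^esub> s e"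
      using comm[OF e, of "vrep U (tau e) (f e a)"] e a bar(3)[OF e] by (simp add: \<nu>_def)
  qed
  \<comment> \<open>The retraction of the stage onto its base sends each letter to its permutation,
    so the value of a path in \<open>P\<close> lies over its action on the points.\<close>
  have \<pi>eval: "\<pi> (eval P \<nu> s w) = eval (Sym U) (vrep U) (erep U) w" if "w \<in> words" for w
    using that
  proof (induction w)
    case (Cons a w)
    obtain y b where a: "a = (y, b)" by (cases a)
    define z z' where "z = (case y of Inl (v, g) \<Rightarrow> \<nu> v g | Inr e \<Rightarrow> s e)"
      and "z' = (case y of Inl (v, g) \<Rightarrow> vrep U v g | Inr e \<Rightarrow> erep U e)"
    have "z \<in> carrier P \<and> \<pi> z = z'"
      using Cons.prems rep_vertex_closed[OF rP] rep_vertex_closed[OF rU] s unfolding z_def z'_def a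
      by (cases y) (auto simp: \<nu>_def \<pi>\<iota>)
    then show ?case
      using Cons eval_closed[OF rP] by (simp add: a eval_Cons Let_def flip: z_def z'_def)
  qed simp
  define \<phi> where "\<phi> = eval_cls P \<nu> s"
  have \<phi>FG: "\<phi> \<in> hom (FG v0) P" unfolding \<phi>_def by (rule eval_cls_hom[OF rP])
  have \<phi>: "\<phi> \<in> hom (FG v0\<lparr>carrier := H\<rparr>) P"
    using \<phi>FG HF by (auto simp: hom_def Pi_iff)
  interpret FH: group "FG v0\<lparr>carrier := H\<rparr>"
    by (rule subgroup.subgroup_is_group[OF subgroup_H group_FG[OF v0]])
  interpret \<phi>: group_hom "FG v0\<lparr>carrier := H\<rparr>" P \<phi>
    using \<phi> by (simp add: group_hom_def group_hom_axioms_def st.P.is_group FH.is_group)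
  have sub: "subgroup (\<phi> ` H) P" using \<phi>.img_is_subgroup by simp
  let ?P = "P\<lparr>carrier := \<phi> ` H\<rparr>"
  have grp: "group ?P" by (rule subgroup.subgroup_is_group[OF sub P(1)])
  have fin: "finite (carrier ?P)" using P(2) subgroup.subset[OF sub] by (simp add: finite_subset)
  have "\<exists>j. y [^]\<^bsub>?P\<^esub> (p ^ j :: nat) = \<one>\<^bsub>?P\<^esub>" if yI: "y \<in> carrier ?P" for y
  proof -
    obtain Y where Y: "Y \<in> H" "y = \<phi> Y" using yI by auto
    obtain g' l' where g'l': "g' \<in> carrier (Gv v0)" "valid v0 l' v0" "Y = cls (path v0 g' l')"
      using ex_path[OF Y(1)] by blast
    note w = path_words[OF v0 g'l'(1,2)]
    have "eval (Sym Zp) (vrep Zp) (erep Zp) (path v0 g' l') = \<one>\<^bsub>Sym Zp\<^esub>"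
      using Y(1) eval_cls[OF rep_Sym[OF group_integer_mod_group] w] by (simp add: H_def kernel_def g'l'(3))
    then have t: "eval (Sym U) (vrep U) (erep U) (path v0 g' l') [^]\<^bsub>Sym U\<^esub> (p ^ (k + k)) = \<one>\<^bsub>Sym U\<^esub>"
      by (rule eval_path_torsion[OF p U v0 g'l'(1,2)])
    have y: "y = eval P \<nu> s (path v0 g' l')" using eval_cls[OF rP w] Y(2) g'l'(3) by (simp add: \<phi>_def)
    have yP: "y \<in> carrier P" unfolding y by (rule eval_closed[OF rP w])
    \<comment> \<open>This power lies in the kernel of \<open>\<pi>\<close>, where
      \<open>p ^ length l\<close> is an exponent by the stage property.\<close>
    have "\<pi> (y [^]\<^bsub>P\<^esub> (p ^ (k + k))) = \<one>\<^bsub>Sym U\<^esub>"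
      using t st.\<pi>.hom_nat_pow[OF yP] \<pi>eval[OF w] by (simp add: y)
    then have "(y [^]\<^bsub>P\<^esub> (p ^ (k + k))) [^]\<^bsub>P\<^esub> (p ^ length l) = \<one>\<^bsub>P\<^esub>"
      using tors yP by simp
    then have "y [^]\<^bsub>P\<^esub> (p ^ (k + k + length l)) = \<one>\<^bsub>P\<^esub>"
      using yP by (simp add: st.P.nat_pow_pow power_add)
    then show ?thesis by (auto simp: nat_pow_def)
  qed
  then obtain j where j: "card (carrier ?P) = p ^ j" using p_torsion_imp_p_group[OF p grp fin] by blast
  have \<phi>Q: "\<phi> Q = eval P \<nu> s (path v0 g l)"
    using eval_cls[OF rP path_words[OF v0 gl(1,2)]] by (simp add: \<phi>_def Qgl)
  have vg: "vrep U v0 g \<in> carrier (Sym U)" by (rule rep_vertex_closed[OF rU v0 gl(1)])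
  have "\<phi> Q \<noteq> \<one>\<^bsub>P\<^esub>"
  proof (cases "l = []")
    case True
    have "g \<noteq> \<one>\<^bsub>Gv v0\<^esub>"
    proof
      assume "g = \<one>\<^bsub>Gv v0\<^esub>"
      then have "eqv (path v0 g l) []" using True eqv_vertex_one[OF v0] by (simp add: path_def)
      then show False
        using Q(2) cls_eq_iff[OF path_words[OF v0 gl(1,2)] words_Nil] by (simp add: Qgl one_FG)
    qed
    then obtain \<mu> where \<mu>: "\<mu> \<in> hom (Gv v0) U" "\<mu> g \<noteq> \<one>\<^bsub>U\<^esub>" using sepU by (auto simp: xs_def)
    interpret G: group "Gv v0" by (rule grpv[OF v0])
    have "vrep U v0 g \<noteq> vrep U v0 \<one>\<^bsub>Gv v0\<^esub>"
      using vrep_eqD[OF U(1) v0 gl(1) G.one_closed _ \<mu>(1)] \<mu> hom_one[OF \<mu>(1) G.is_group U(1)] by auto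
    moreover have "vrep U v0 \<one>\<^bsub>Gv v0\<^esub> = \<one>\<^bsub>Sym U\<^esub>"
      using rU v0 G.is_group S.is_group by (simp add: rep_def hom_one)
    ultimately have "\<iota> (vrep U v0 g) \<noteq> \<one>\<^bsub>P\<^esub>" using \<pi>\<iota>[OF vg] by (metis st.\<pi>.hom_one)
    then show ?thesis using vg by (simp add: \<phi>Q True path_def eval_Cons Let_def \<nu>_def)
  next
    case False
    define m where "m = map (\<lambda>(e, h). (e, vrep U (tau e) h)) l"
    have tail: "eval P \<nu> s (tail_word l') = word_val P s \<iota> (map (\<lambda>(e, h). (e, vrep U (tau e) h)) l')" for l'
      by (induction l') (auto simp: eval_Cons Let_def \<nu>_def)
    have "reduced m"
      unfolding reduced_def
    proof
      show "set m \<subseteq> E \<times> carrier (Sym U)"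
        using l_elems rep_vertex_closed[OF rU] tau by (fastforce simp: m_def)
      \<comment> \<open>A vertex element outside its edge group stays outside the image of that edge
        group, so no pinch arises in the image of the reduced path.\<close>
      have "vrep U (tau e) h \<notin> vrep U (tau e) ` A e" if eh: "(e, h) \<in> set l" "h \<notin> A e" for e h
      proof -
        have "(tau e, x e h) \<in> set xs" using eh by (force simp: xs_def)
        then obtain \<mu> where "\<mu> \<in> hom (Gv (tau e)) U" "\<mu> (x e h) \<noteq> \<one>\<^bsub>U\<^esub>" using sepU by blast
        then show ?thesis using vrep_notin[OF U(1)] l_elems[OF eh(1)] unfolding x_def by blast
      qed
      then have *: "vrep U (tau e) h \<notin> vrep U (tau e) ` A e" if "(e, h) \<in> set l" "h \<notin> A e" for e h
        using that by blast
      have "successively (\<lambda>y z. \<not> (fst z = bar (fst y) \<and> vrep U (tau (fst y)) (snd y) \<in> vrep U (tau (bar (fst z))) ` A (bar (fst z)))) l"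
        using gl(3) unfolding reduced_path_def
      proof (rule successively_mono)
        fix y z assume yz: "y \<in> set l" "z \<in> set l" "\<not> (fst z = bar (fst y) \<and> snd y \<in> A (fst y))"
        then show "\<not> (fst z = bar (fst y) \<and> vrep U (tau (fst y)) (snd y) \<in> vrep U (tau (bar (fst z))) ` A (bar (fst z)))"
          using *[of "fst y" "snd y"] l_elems[of "fst y" "snd y"] bar(3)[of "fst y"] by auto
      qed
      then show "successively (\<lambda>y z. \<not> (fst z = bar (fst y) \<and> snd y \<in> vrep U (tau (bar (fst z))) ` A (bar (fst z)))) m"
        by (simp add: m_def successively_map case_prod_unfold)
    qed
    then have nin: "word_val P s \<iota> m \<notin> \<iota> ` carrier (Sym U)"
      using sep[of m] False by (simp add: m_def)
    have "\<phi> Q = \<iota> (vrep U v0 g) \<otimes>\<^bsub>P\<^esub> word_val P s \<iota> m"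
      by (simp add: \<phi>Q path_def eval_Cons Let_def tail \<nu>_def m_def)
    moreover have wP: "word_val P s \<iota> m \<in> carrier P"
      using eval_closed[OF rP tail_words[OF gl(2)]] by (simp add: tail m_def)
    \<comment> \<open>Were the product 1, the word value would be the inverse of an element of the
      base group and hence lie in it, against \<open>nin\<close>.\<close>
    ultimately show ?thesis
      using nin vg
      by (metis st.P.inv_equality st.P.inv_comm S.inv_closed st.\<iota>.hom_closed st.\<iota>.hom_inv imageI)
  qed
  then have "\<phi> Q \<noteq> \<one>\<^bsub>?P\<^esub>" by simp
  moreover have "\<phi> \<in> hom (FG v0\<lparr>carrier := H\<rparr>) ?P" using \<phi> by (auto simp: hom_def)
  moreover have "\<phi> ` H = carrier ?P" by simp
  ultimately show ?thesis using grp fin j by blast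
qed

end

theorem theorem1p1:
  fixes p :: nat
    and V :: "'v set" and E :: "'e set" and bar :: "'e \<Rightarrow> 'e" and tau :: "'e \<Rightarrow> 'v"
    and Gv :: "'v \<Rightarrow> 'a monoid" and Ge :: "'e \<Rightarrow> 'b monoid" and f :: "'e \<Rightarrow> 'b \<Rightarrow> 'a"
    and v0 :: 'v
  assumes "Factorial_Ring.prime p"
    and "algebraically_clean V E bar tau Gv Ge f"
    and "v0 \<in> V"
  shows "\<exists>H. subgroup H (fundamental_group V E bar tau Gv Ge f v0) \<and>
             finite (rcosets\<^bsub>fundamental_group V E bar tau Gv Ge f v0\<^esub> H) \<and>
             residually_p_finite p ((fundamental_group V E bar tau Gv Ge f v0)\<lparr>carrier := H\<rparr>)"
proof -
  interpret clean_gog_p V E bar tau Gv Ge f p v0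
    using assms by unfold_locales
  have "residually_p_finite p ((FG v0)\<lparr>carrier := H\<rparr>)"
    unfolding residually_p_finite_def using p_quotient by simp
  then show ?thesis using subgroup_H finite_index_H by blast
qed

end
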